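(* Let $k$ be a field of characteristic $p>0$, and let $f\in k[z,t]$ (a polynomial ring in two variables) be such that $k[z,t]/(f)\cong_k k^{[1]}$ but $k[z,t]\neq k[f]^{[1]}$. For $m\ge 1$ let $$A_m=k[x,y,z,t]/(x^m y+f(z,t)).$$ Then for every $m\ge 2$, $A_m\notin\mathcal{U}_k(3,\mathbf{G})$; that is, $A_m$ (which is a unique factorization domain of transcendence degree $3$ over $k$) admits no positive $\mathbb{Z}$-grading over $k$.
   Context: $R^{[1]}$ denotes the polynomial ring in one variable over $R$; the condition $k[z,t]\ne k[f]^{[1]}$ means that there is no $g\in k[z,t]$ with $k[z,t]=k[f,g]$. The rings $A_m$ are the coordinate rings of the Asanuma threefolds. $\mathcal{U}_k(3,\mathbf{G})$ denotes the set of $k$-isomorphism classes of unique factorization domains containing $k$, of transcendence degree $3$ over $k$, which admit a positive $\mathbb{Z}$-grading over $k$. A $\mathbb{Z}$-grading $B=\bigoplus_{i\in\mathbb{Z}}B_i$ over $k$ (so $k\subset B_0$) is positive if $B_i=\{0\}$ for $i<0$ and $B_0=k$. *)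

theory Defs
  imports
    "HOL-Algebra.Algebra"
    "HOL-Algebra.Algebraic_Closure_Type"
    "HOL-Computational_Algebra.Polynomial"
begin

text \<open>
  The base field is a type \<open>'a :: field\<close>. A \<open>k\<close>-algebra is a ring record \<open>A\<close> together with its
  structure map \<open>\<alpha> :: 'a \<Rightarrow> _\<close>; the copy of \<open>k\<close> inside \<open>A\<close> is then \<open>range \<alpha>\<close>.
\<close>

definition k_isomorphic ::
    "('b, 'm) ring_scheme \<Rightarrow> ('a::field \<Rightarrow> 'b) \<Rightarrow> ('c, 'n) ring_scheme \<Rightarrow> ('a \<Rightarrow> 'c) \<Rightarrow> bool" where
  "k_isomorphic A \<alpha> B \<beta> \<longleftrightarrow> (\<exists>\<phi> \<in> ring_iso A B. \<forall>c. \<phi> (\<alpha> c) = \<beta> c)"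


subsection \<open>Transcendence degree\<close>

text \<open>
  \<open>S\<close> is algebraically independent over the subfield \<open>K\<close> if the monomials in any finite
  subset \<open>T\<close> of \<open>S\<close> are linearly independent over \<open>K\<close>. A polynomial in the elements of \<open>T\<close> is
  given by a finite set \<open>M\<close> of exponent vectors \<open>e : T \<rightarrow> \<nat>\<close> and coefficients \<open>c : M \<rightarrow> K\<close>.
\<close>

definition algebraically_independent ::
    "('b, 'm) ring_scheme \<Rightarrow> 'b set \<Rightarrow> 'b set \<Rightarrow> bool" where
  "algebraically_independent A K S \<longleftrightarrow>
     (\<forall>T M c. finite T \<and> T \<subseteq> S \<and> finite M \<and> M \<subseteq> (T \<rightarrow>\<^sub>E (UNIV :: nat set)) \<and> c \<in> M \<rightarrow> K \<and>
        (\<Oplus>\<^bsub>A\<^esub> e \<in> M. c e \<otimes>\<^bsub>A\<^esub> (\<Otimes>\<^bsub>A\<^esub> s \<in> T. s [^]\<^bsub>A\<^esub> e s)) = \<zero>\<^bsub>A\<^esub>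
        \<longrightarrow> (\<forall>e \<in> M. c e = \<zero>\<^bsub>A\<^esub>))"

text \<open>
  For a domain \<open>A\<close> containing \<open>K\<close>: a transcendence basis of \<open>A\<close> over \<open>K\<close> is a maximal
  algebraically independent subset. Such a set is also a transcendence basis of the fraction
  field of \<open>A\<close>, so its cardinality is the transcendence degree in either reading.
\<close>

definition transcendence_basis ::
    "('b, 'm) ring_scheme \<Rightarrow> 'b set \<Rightarrow> 'b set \<Rightarrow> bool" where
  "transcendence_basis A K S \<longleftrightarrow>
     S \<subseteq> carrier A \<and> algebraically_independent A K S \<and>
     (\<forall>S'. S \<subseteq> S' \<and> S' \<subseteq> carrier A \<and> algebraically_independent A K S' \<longrightarrow> S' = S)"

definition has_transcendence_degree ::
    "('b, 'm) ring_scheme \<Rightarrow> 'b set \<Rightarrow> nat \<Rightarrow> bool" where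
  "has_transcendence_degree A K n \<longleftrightarrow>
     (\<exists>S. finite S \<and> card S = n \<and> transcendence_basis A K S)"


subsection \<open>Gradings\<close>

definition int_grading :: "('b, 'm) ring_scheme \<Rightarrow> (int \<Rightarrow> 'b set) \<Rightarrow> bool" where
  "int_grading A B \<longleftrightarrow>
     (\<forall>i. additive_subgroup (B i) A) \<and>
     (\<forall>a \<in> carrier A. \<exists>!u. (\<forall>i. u i \<in> B i) \<and> finite {i. u i \<noteq> \<zero>\<^bsub>A\<^esub>} \<and>
        a = (\<Oplus>\<^bsub>A\<^esub> i \<in> {i. u i \<noteq> \<zero>\<^bsub>A\<^esub>}. u i)) \<and>
     (\<forall>i j. \<forall>a \<in> B i. \<forall>b \<in> B j. a \<otimes>\<^bsub>A\<^esub> b \<in> B (i + j))"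

definition int_grading_over ::
    "('b, 'm) ring_scheme \<Rightarrow> 'b set \<Rightarrow> (int \<Rightarrow> 'b set) \<Rightarrow> bool" where
  "int_grading_over A K B \<longleftrightarrow> int_grading A B \<and> K \<subseteq> B 0"

definition positive_grading_over ::
    "('b, 'm) ring_scheme \<Rightarrow> 'b set \<Rightarrow> (int \<Rightarrow> 'b set) \<Rightarrow> bool" where
  "positive_grading_over A K B \<longleftrightarrow>
     int_grading_over A K B \<and> (\<forall>i<0. B i = {\<zero>\<^bsub>A\<^esub>}) \<and> B 0 = K"

text \<open>
  Membership of (the \<open>k\<close>-isomorphism class of) \<open>(A, \<alpha>)\<close> in \<open>U\<^sub>k(n, G)\<close>. All conditions are
  invariant under \<open>k\<close>-isomorphism, so the class is represented by the predicate on \<open>k\<close>-algebras;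
  \<open>\<alpha>\<close> is injective because \<open>A\<close> is a domain.
\<close>

definition in_UG ::
    "nat \<Rightarrow> ('b, 'm) ring_scheme \<Rightarrow> ('a::field \<Rightarrow> 'b) \<Rightarrow> bool" where
  "in_UG n A \<alpha> \<longleftrightarrow>
     factorial_domain A \<and> \<alpha> \<in> ring_hom (ring_of_type_algebra :: 'a ring) A \<and>
     has_transcendence_degree A (range \<alpha>) n \<and>
     (\<exists>B. positive_grading_over A (range \<alpha>) B)"


subsection \<open>Polynomial rings and the rings \<open>A\<^sub>m\<close>\<close>

definition principal_quot :: "'r::comm_ring_1 \<Rightarrow> 'r set ring" where
  "principal_quot a = ring_of_type_algebra Quot (PIdl\<^bsub>ring_of_type_algebra\<^esub> a)"

definition residue_class :: "'r::comm_ring_1 \<Rightarrow> 'r \<Rightarrow> 'r set" where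
  "residue_class a r = (PIdl\<^bsub>ring_of_type_algebra\<^esub> a) +>\<^bsub>ring_of_type_algebra\<^esub> r"

text \<open>\<open>k[z,t]\<close> is \<open>'a poly poly\<close>, with constants \<open>[:[:c:]:]\<close>. The following is \<open>k[f,g] \<subseteq> k[z,t]\<close>.\<close>

definition subalgebra2 :: "'a::field poly poly \<Rightarrow> 'a poly poly \<Rightarrow> 'a poly poly set" where
  "subalgebra2 f g = generate_ring ring_of_type_algebra (range (\<lambda>c. [:[:c:]:]) \<union> {f, g})"

text \<open>
  \<open>k[x,y,z,t]\<close> is taken as \<open>k[z,t][y][x]\<close>, i.e. \<open>'a poly poly poly poly\<close>: the outermost variable
  is \<open>x\<close>, the next one is \<open>y\<close>, and \<open>f \<in> k[z,t]\<close> is embedded as \<open>[:[:f:]:]\<close>.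
\<close>

definition asanuma_polynomial :: "nat \<Rightarrow> 'a::field poly poly \<Rightarrow> 'a poly poly poly poly" where
  "asanuma_polynomial m f = (let x = [:0, 1:]; y = [:[:0, 1:]:] in x ^ m * y + [:[:f:]:])"

definition asanuma_ring :: "nat \<Rightarrow> 'a::field poly poly \<Rightarrow> 'a poly poly poly poly set ring" where
  "asanuma_ring m f = principal_quot (asanuma_polynomial m f)"

definition asanuma_const :: "nat \<Rightarrow> 'a::field poly poly \<Rightarrow> 'a \<Rightarrow> 'a poly poly poly poly set" where
  "asanuma_const m f c = residue_class (asanuma_polynomial m f) [:[:[:[:c:]:]:]:]"

end

theory Submission
  imports Defs "Berlekamp_Zassenhaus.Unique_Factorization_Poly" "HOL-Library.Poly_Mapping"
begin

text \<open>
  \<open>A\<close> is realised inside \<open>k[z,t][x,1/x]\<close>, with \<open>y = - f / x^m\<close>. Suppose that it carries a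
  positive grading. Its irrelevant ideal \<open>M\<close> satisfies \<open>dim M / M^2 \<le> 3\<close>, since the line
  \<open>f = 0\<close> is smooth and \<open>m \<ge> 2\<close>; so three homogeneous elements generate \<open>A\<close>, and counting
  monomials shows that they are algebraically independent. One of them, \<open>u\<close> say, has a pole along
  \<open>x = 0\<close>, and translating another generator gives a non-trivial exponential map fixing \<open>u\<close>.
  Its leading part for the grading by powers of \<open>x\<close> is a homogeneous non-trivial exponential map
  that fixes \<open>y\<close>. If it fixes \<open>x\<close>, then also \<open>f\<close>, and putting \<open>x = 1\<close> gives a non-trivial
  exponential map of \<open>k[z,t]\<close> whose ring of invariants is \<open>k[f]\<close>, so that \<open>f\<close> is a coordinate;
  this is seen over the algebraic closure of \<open>k\<close> first and then descends. If it moves \<open>x\<close>, then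
  \<open>x\<close> has minimal positive degree because \<open>m \<ge> 2\<close>; hence \<open>f\<close> is a coordinate over the fraction
  field of the ring \<open>G\<close> of invariants in \<open>k[z,t]\<close>, the line maps \<open>G\<close> isomorphically to
  \<open>k[\<tau>]\<close>, and again \<open>f\<close> is a coordinate.

  Factoriality is Nagata's criterion: \<open>x\<close> is prime in \<open>A\<close>, and \<open>A[1/x] = k[z,t][x,1/x]\<close> is factorial.
\<close>

section \<open>Exponential maps\<close>

text \<open>In positive characteristic a single derivation does not determine the action, so all
  coefficients \<open>D i\<close> are kept. The least positive degree in T need not be 1, but it is
  a power of the characteristic and divides every degree, which is what makes division by a slice
  possible. The given grading bears no relation to the powers of x; hence the detour through the
  cotangent space and the counting argument. The pole of u matters because the lowest term of u then
  has y as a factor, and factors of invariants are invariant. The hypothesis m \<ge> 2 acts twice: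
  it puts f = - x^m y into M^2 when x lies in M, and, if x is moved, invariants live in degrees
  divisible by m while x has degree 1. The algebraic closure is used because there the primes of
  k[f] are the f - c, with residue field k, so that denominators cancel one linear factor at a
  time.\<close>

lemma of_nat_choose_prime_power_neq_0:
  fixes N i :: nat
  assumes p: "p = CHAR('r::idom)" "p > 0" and N: "\<not> p dvd N"
  shows "(of_nat (p ^ i * N choose p ^ i) :: 'r) \<noteq> 0"
proof -
  have pr: "Factorial_Ring.prime p" using p prime_CHAR_semidom by blast
  define q where "q = p ^ i"
  have q0: "q > 0" using pr by (simp add: q_def prime_gt_0_nat)
  \<comment> \<open>The coefficient of T^q is compared on both sides of (1 + T)^(q N) = (1 + T^q)^N,
    an instance of the Frobenius identity; the right-hand side gives N, which p does not
    divide.\<close>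
  have "[:1, 1::'r:] = [:1:] + monom 1 1" by (simp add: monom_Suc one_pCons del: pCons_one)
  then have "[:1, 1::'r:] ^ (q * N) = (([:1:] + monom 1 1) ^ q) ^ N"
    by (simp only: power_mult)
  also have "([:1::'r:] + monom 1 1) ^ q = [:1:] ^ q + monom 1 1 ^ q"
    using freshmans_dream'[of "q" i "[:1::'r:]" "monom 1 1"] p pr unfolding q_def
    by simp
  also have "\<dots> = monom 1 q + 1" by (simp add: monom_power)
  also have "(monom (1::'r) q + 1) ^ N = (\<Sum>k\<le>N. of_nat (N choose k) * monom 1 (q * k))"
    by (simp add: binomial_ring monom_power)
  finally have eq: "[:1, 1::'r:] ^ (q * N) = (\<Sum>k\<le>N. of_nat (N choose k) * monom 1 (q * k))" .
  have "of_nat (q * N choose q) = coeff ([:1, 1::'r:] ^ (q * N)) q"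
    using N by (cases N) (simp_all add: coeff_linear_poly_power del: pCons_one)
  also have "\<dots> = (\<Sum>k\<le>N. of_nat (N choose k) * (if k = 1 then 1 else 0))"
    unfolding eq coeff_sum using q0
    by (intro sum.cong refl) (auto simp: of_nat_poly)
  also have "\<dots> = of_nat N"
    using N by (cases "N = 0") (auto simp: if_distrib[of "(*) _"] cong: if_cong)
  finally show ?thesis using N p by (simp add: q_def of_nat_eq_0_iff_char_dvd)
qed

text \<open>An exponential map on the subring \<open>A\<close>, given by the coefficients \<open>D i\<close> of
  \<open>a \<mapsto> \<Sum>i. D i a * T ^ i\<close>; the last but one axiom is the coaction property.\<close>

locale exp_map =
  fixes A :: "'r::idom set" and D :: "nat \<Rightarrow> 'r \<Rightarrow> 'r"
  assumes one_in [simp]: "1 \<in> A"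
    and add_in [simp]: "a \<in> A \<Longrightarrow> b \<in> A \<Longrightarrow> a + b \<in> A"
    and mult_in [simp]: "a \<in> A \<Longrightarrow> b \<in> A \<Longrightarrow> a * b \<in> A"
    and uminus_in [simp]: "a \<in> A \<Longrightarrow> - a \<in> A"
    and D_in [simp]: "a \<in> A \<Longrightarrow> D i a \<in> A"
    and D_add: "a \<in> A \<Longrightarrow> b \<in> A \<Longrightarrow> D i (a + b) = D i a + D i b"
    and D_mult: "a \<in> A \<Longrightarrow> b \<in> A \<Longrightarrow> D i (a * b) = (\<Sum>j\<le>i. D j a * D (i - j) b)"
    and D_0 [simp]: "a \<in> A \<Longrightarrow> D 0 a = a"
    and D_D: "a \<in> A \<Longrightarrow> D i (D j a) = of_nat (i + j choose i) * D (i + j) a"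
    and D_finite: "a \<in> A \<Longrightarrow> \<exists>N. \<forall>i>N. D i a = 0"
begin

lemma zero_in [simp]: "0 \<in> A"
  using add_in[OF one_in uminus_in[OF one_in]] by simp

lemma diff_in [simp]: "a \<in> A \<Longrightarrow> b \<in> A \<Longrightarrow> a - b \<in> A"
  using add_in[of a "- b"] by simp

lemma power_in [simp]: "a \<in> A \<Longrightarrow> a ^ n \<in> A"
  by (induction n) auto

lemma sum_in [simp]: "(\<And>x. x \<in> I \<Longrightarrow> f x \<in> A) \<Longrightarrow> sum f I \<in> A"
  by (induction I rule: infinite_finite_induct) auto

lemma D_zero [simp]: "D i 0 = 0"
  using D_add[of 0 0 i] by (metis add_cancel_right_right zero_in)

lemma D_uminus: "a \<in> A \<Longrightarrow> D i (- a) = - D i a"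
  using D_add[of a "- a" i] by (simp add: eq_neg_iff_add_eq_0 add.commute)

lemma D_diff: "a \<in> A \<Longrightarrow> b \<in> A \<Longrightarrow> D i (a - b) = D i a - D i b"
  using D_add[of a "- b" i] by (simp add: D_uminus)

lemma D_sum: "(\<And>x. x \<in> I \<Longrightarrow> f x \<in> A) \<Longrightarrow> D i (sum f I) = (\<Sum>x\<in>I. D i (f x))"
  by (induction I rule: infinite_finite_induct) (auto simp: D_add)

section \<open>The degree in T and its additivity\<close>

definition tdeg :: "'r \<Rightarrow> nat" where
  "tdeg a = (if a = 0 then 0 else GREATEST i. D i a \<noteq> 0)"

lemma
  assumes "a \<in> A"
  shows lead_neq_0: "a \<noteq> 0 \<Longrightarrow> D (tdeg a) a \<noteq> 0"
    and D_above_tdeg: "i > tdeg a \<Longrightarrow> D i a = 0"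
proof -
  obtain N where N: "\<forall>i>N. D i a = 0" using D_finite[OF assms] by blast
  have *: "D 0 a \<noteq> 0" if "a \<noteq> 0" using that assms by simp
  have bd: "y \<le> N" if "D y a \<noteq> 0" for y using N that by (meson not_le)
  show "D (tdeg a) a \<noteq> 0" if "a \<noteq> 0"
    using GreatestI_nat[of "\<lambda>i. D i a \<noteq> 0", OF *[OF that] bd] that by (simp add: tdeg_def)
  show "D i a = 0" if "i > tdeg a"
    using Greatest_le_nat[of "\<lambda>i. D i a \<noteq> 0" i N] bd that
    by (cases "a = 0") (auto simp: tdeg_def)
qed

lemma tdeg_ge: "a \<in> A \<Longrightarrow> D i a \<noteq> 0 \<Longrightarrow> i \<le> tdeg a"
  using D_above_tdeg not_le by blast

lemma tdeg_leI: "a \<in> A \<Longrightarrow> (\<And>i. i > N \<Longrightarrow> D i a = 0) \<Longrightarrow> tdeg a \<le> N"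
  by (metis lead_neq_0 not_le tdeg_def zero_le)

lemma tdeg_0 [simp]: "tdeg 0 = 0" by (simp add: tdeg_def)

lemma D_mult_top:
  assumes "a \<in> A" "b \<in> A" "tdeg a \<le> m" "tdeg b \<le> n"
  shows "D (m + n) (a * b) = D m a * D n b"
proof -
  have "D (m + n) (a * b) = (\<Sum>j\<le>m + n. if j = m then D m a * D n b else 0)"
    unfolding D_mult[OF assms(1,2)]
  proof (intro sum.cong refl)
    fix j assume "j \<in> {..m + n}"
    then show "D j a * D (m + n - j) b = (if j = m then D m a * D n b else 0)"
      using D_above_tdeg[OF assms(1), of j] D_above_tdeg[OF assms(2), of "m + n - j"] assms(3,4)
      by (cases "j < m"; cases "j > m") auto
  qed
  then show ?thesis by simp
qed

lemma D_mult_above: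
  assumes "a \<in> A" "b \<in> A" "tdeg a + tdeg b < i"
  shows "D i (a * b) = 0"
  unfolding D_mult[OF assms(1,2)]
proof (rule sum.neutral, safe)
  fix j assume "j \<le> i"
  then have "j > tdeg a \<or> i - j > tdeg b" using assms by linarith
  then show "D j a * D (i - j) b = 0" using D_above_tdeg assms by auto
qed

lemma tdeg_mult:
  assumes "a \<in> A" "b \<in> A" "a \<noteq> 0" "b \<noteq> 0"
  shows "tdeg (a * b) = tdeg a + tdeg b"
proof (rule antisym)
  show "tdeg (a * b) \<le> tdeg a + tdeg b" using assms D_mult_above by (intro tdeg_leI) auto
  show "tdeg a + tdeg b \<le> tdeg (a * b)"
    using assms D_mult_top[OF assms(1,2) order_refl order_refl] lead_neq_0 by (intro tdeg_ge) auto
qed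

lemma tdeg_power: "a \<in> A \<Longrightarrow> a \<noteq> 0 \<Longrightarrow> tdeg (a ^ n) = n * tdeg a"
proof (induction n)
  case 0
  have "tdeg (1 * 1) = tdeg 1 + tdeg 1" using tdeg_mult[of 1 1] by simp
  then show ?case by simp
qed (simp add: tdeg_mult)

lemma tdeg_1 [simp]: "tdeg 1 = 0" using tdeg_power[of 1 0] by simp

lemma tdeg_add_le: "a \<in> A \<Longrightarrow> b \<in> A \<Longrightarrow> tdeg a \<le> N \<Longrightarrow> tdeg b \<le> N \<Longrightarrow> tdeg (a + b) \<le> N"
  by (intro tdeg_leI) (auto simp: D_add D_above_tdeg)

lemma tdeg_uminus [simp]: "a \<in> A \<Longrightarrow> tdeg (- a) = tdeg a"
  unfolding tdeg_def by (simp add: D_uminus)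

lemma tdeg_diff_le: "a \<in> A \<Longrightarrow> b \<in> A \<Longrightarrow> tdeg a \<le> N \<Longrightarrow> tdeg b \<le> N \<Longrightarrow> tdeg (a - b) \<le> N"
  by (intro tdeg_leI) (auto simp: D_diff D_above_tdeg)

lemma tdeg_mult_le: "a \<in> A \<Longrightarrow> b \<in> A \<Longrightarrow> tdeg (a * b) \<le> tdeg a + tdeg b"
  using D_mult_above by (intro tdeg_leI) auto

section \<open>The ring of invariants, closed under taking factors\<close>

definition Inv :: "'r set" where "Inv = {a \<in> A. tdeg a = 0}"

lemma InvD: "a \<in> Inv \<Longrightarrow> a \<in> A" "a \<in> Inv \<Longrightarrow> tdeg a = 0" "a \<in> Inv \<Longrightarrow> i > 0 \<Longrightarrow> D i a = 0"
  by (auto simp: Inv_def D_above_tdeg)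

lemma InvI: "a \<in> A \<Longrightarrow> (\<And>i. i > 0 \<Longrightarrow> D i a = 0) \<Longrightarrow> a \<in> Inv"
  using tdeg_leI[of a 0] by (simp add: Inv_def)

lemma Inv_0 [simp]: "0 \<in> Inv" and Inv_1 [simp]: "1 \<in> Inv" by (auto simp: Inv_def)

lemma Inv_add [simp]: "a \<in> Inv \<Longrightarrow> b \<in> Inv \<Longrightarrow> a + b \<in> Inv"
  using tdeg_add_le[of a b 0] by (auto simp: Inv_def)

lemma Inv_uminus [simp]: "a \<in> Inv \<Longrightarrow> - a \<in> Inv" by (auto simp: Inv_def)

lemma Inv_diff [simp]: "a \<in> Inv \<Longrightarrow> b \<in> Inv \<Longrightarrow> a - b \<in> Inv"
  using tdeg_diff_le[of a b 0] by (auto simp: Inv_def)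

lemma Inv_mult [simp]: "a \<in> Inv \<Longrightarrow> b \<in> Inv \<Longrightarrow> a * b \<in> Inv"
  using tdeg_mult_le[of a b] by (auto simp: Inv_def)

lemma Inv_power [simp]: "a \<in> Inv \<Longrightarrow> a ^ n \<in> Inv"
  by (induction n) auto

lemma Inv_sum [simp]: "(\<And>x. x \<in> I \<Longrightarrow> f x \<in> Inv) \<Longrightarrow> sum f I \<in> Inv"
  by (induction I rule: infinite_finite_induct) auto

lemma Inv_factor: "a \<in> A \<Longrightarrow> b \<in> A \<Longrightarrow> a * b \<in> Inv \<Longrightarrow> a * b \<noteq> 0 \<Longrightarrow> a \<in> Inv"
  using tdeg_mult[of a b] by (auto simp: Inv_def)

lemma Inv_factor2: "a \<in> A \<Longrightarrow> b \<in> A \<Longrightarrow> a * b \<in> Inv \<Longrightarrow> a * b \<noteq> 0 \<Longrightarrow> b \<in> Inv"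
  using tdeg_mult[of a b] by (auto simp: Inv_def)

lemma D_Inv_mult: "c \<in> Inv \<Longrightarrow> a \<in> A \<Longrightarrow> D i (c * a) = c * D i a"
proof -
  assume c: "c \<in> Inv" and a: "a \<in> A"
  have "D i (c * a) = (\<Sum>j\<le>i. D j c * D (i - j) a)" using c a InvD by (intro D_mult) auto
  also have "\<dots> = (\<Sum>j\<le>i. if j = 0 then c * D i a else 0)"
    using c a by (intro sum.cong) (auto simp: InvD(1,3))
  finally have "D i (c * a) = (\<Sum>j\<le>i. if j = 0 then c * D i a else 0)" .
  then show ?thesis by simp
qed

text \<open>By \<open>D_D\<close>, applying \<open>D i\<close> with i > 0 yields a multiple of
  \<open>D (i + n) a\<close>, which lies above the degree of \<open>a\<close> and vanishes.\<close>

lemma lead_in_Inv: "a \<in> A \<Longrightarrow> tdeg a \<le> n \<Longrightarrow> D n a \<in> Inv"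
  by (intro InvI) (auto simp: D_D D_above_tdeg)

lemma tdeg_pos: "a \<in> A \<Longrightarrow> a \<notin> Inv \<Longrightarrow> tdeg a > 0"
  by (auto simp: Inv_def)

section \<open>Minimal positive degrees and slices in characteristic p\<close>

definition mdeg :: nat where "mdeg = (LEAST n. n > 0 \<and> (\<exists>a\<in>A. tdeg a = n))"

lemma mdeg:
  assumes "\<not> A \<subseteq> Inv"
  shows "mdeg > 0" "\<exists>a\<in>A. tdeg a = mdeg"
proof -
  obtain a where "a \<in> A" "tdeg a > 0" using assms tdeg_pos by blast
  then have "mdeg > 0 \<and> (\<exists>a\<in>A. tdeg a = mdeg)"
    unfolding mdeg_def by (intro LeastI[of "\<lambda>n. n > 0 \<and> (\<exists>a\<in>A. tdeg a = n)"]) blast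
  then show "mdeg > 0" "\<exists>a\<in>A. tdeg a = mdeg" by auto
qed

lemma mdeg_le: "a \<in> A \<Longrightarrow> tdeg a > 0 \<Longrightarrow> mdeg \<le> tdeg a"
  unfolding mdeg_def by (rule Least_le) blast

text \<open>Write the degree of \<open>a\<close> as q N with q the full power of the characteristic
  in it. The coefficient \<open>D (tdeg a - q) a\<close> has degree exactly q: by \<open>D_D\<close>
  its q-th coefficient is the leading coefficient of \<open>a\<close> times binom(q N, q), a nonzero
  scalar.\<close>

lemma prime_power_tdeg:
  assumes "CHAR('r) > 0" "a \<in> A" "tdeg a > 0"
  shows "\<exists>i b. b \<in> A \<and> tdeg b = CHAR('r) ^ i \<and> CHAR('r) ^ i dvd tdeg a"
proof -
  let ?p = "CHAR('r)"
  have pr: "Factorial_Ring.prime ?p" using assms(1) prime_CHAR_semidom by blast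
  define q where "q = ?p ^ multiplicity ?p (tdeg a)"
  obtain N where N: "tdeg a = q * N" "\<not> ?p dvd N"
    using multiplicity_decompose'[of "tdeg a" ?p] assms(3) pr unfolding q_def
    by (metis not_prime_unit neq0_conv)
  have q: "q \<le> tdeg a" "q > 0" using N assms by (auto intro: dvd_imp_le simp: gr0I)
  define b where "b = D (tdeg a - q) a"
  have a0: "a \<noteq> 0" using assms by auto
  have "D q b = of_nat (tdeg a choose q) * D (tdeg a) a"
    using assms q by (simp add: b_def D_D)
  moreover have "of_nat (tdeg a choose q) \<noteq> (0::'r)"
    using of_nat_choose_prime_power_neq_0[OF refl assms(1) N(2)] N(1) unfolding q_def by metis
  ultimately have "D q b \<noteq> 0" using lead_neq_0[OF assms(2) a0] by simp
  moreover have "b \<in> A" "tdeg b \<le> q"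
    using assms q by (auto simp: b_def D_D D_above_tdeg intro!: tdeg_leI)
  ultimately have "b \<in> A" "tdeg b = q" using tdeg_ge by (auto intro: antisym)
  then show ?thesis using N(1) unfolding q_def by (intro exI[of _ "multiplicity ?p (tdeg a)"] exI[of _ b]) (metis dvd_triv_left)
qed

text \<open>\<open>mdeg\<close> is itself a power of the characteristic, since
  \<open>prime_power_tdeg\<close> cannot lower a minimal degree. Every positive degree is divisible
  by a power of the characteristic that is again a degree; that power is at least
  \<open>mdeg\<close>, and powers of one prime are comparable for divisibility.\<close>

lemma mdeg_dvd:
  assumes "CHAR('r) > 0" "a \<in> A"
  shows "mdeg dvd tdeg a"
proof (cases "tdeg a = 0")
  case False
  let ?p = "CHAR('r)"
  have pr: "Factorial_Ring.prime ?p" using assms(1) prime_CHAR_semidom by blast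
  obtain i b where b: "b \<in> A" "tdeg b = ?p ^ i" "?p ^ i dvd tdeg a"
    using prime_power_tdeg[OF assms] False by blast
  have ntriv: "\<not> A \<subseteq> Inv" using False assms by (auto simp: Inv_def)
  obtain s where s: "s \<in> A" "tdeg s = mdeg" using mdeg(2)[OF ntriv] by blast
  obtain j c where c: "c \<in> A" "tdeg c = ?p ^ j" "?p ^ j dvd mdeg"
    using prime_power_tdeg[OF assms(1) s(1)] s mdeg(1)[OF ntriv] by auto
  have pos: "?p ^ i > 0" "?p ^ j > 0" using pr by (auto simp: prime_gt_0_nat)
  have "mdeg = ?p ^ j"
    using c mdeg_le[OF c(1)] dvd_imp_le[OF c(3) mdeg(1)[OF ntriv]] pos by simp
  moreover have "mdeg \<le> ?p ^ i" using mdeg_le[OF b(1)] b(2) pos by simp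
  ultimately have "mdeg dvd ?p ^ i"
    using pr by (metis le_imp_power_dvd power_increasing_iff prime_gt_1_nat)
  then show ?thesis using b(3) dvd_trans by blast
qed simp

text \<open>In Horner form each step multiplies by \<open>s\<close> and adds an invariant, which
  cannot cancel a term of positive degree. In particular \<open>s\<close> is transcendental over the
  invariants.\<close>

lemma tdeg_poly:
  assumes s: "s \<in> A" "tdeg s > 0" and q: "\<And>i. coeff q i \<in> Inv" "q \<noteq> 0"
  shows "poly q s \<in> A \<and> poly q s \<noteq> 0 \<and> tdeg (poly q s) = tdeg s * degree q"
  using q
proof (induction q)
  case (pCons c q)
  have c: "c \<in> Inv" using pCons.prems(1)[of 0] by simp
  have coeff: "coeff q i \<in> Inv" for i using pCons.prems(1)[of "Suc i"] by simp
  have s0: "s \<noteq> 0" using s by auto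
  show ?case
  proof (cases "q = 0")
    case True
    then show ?thesis using c pCons.hyps by (auto simp: Inv_def)
  next
    case False
    note IH = pCons.IH[OF coeff False]
    let ?b = "s * poly q s"
    have b: "?b \<in> A" "?b \<noteq> 0" "tdeg ?b = tdeg s * Suc (degree q)"
      using IH s s0 by (auto simp: tdeg_mult)
    have cA: "c \<in> A" using c InvD by blast
    have pos: "tdeg ?b > 0" using b s by simp
    have "D (tdeg ?b) (c + ?b) = D (tdeg ?b) ?b"
      using c pos b(1) cA by (simp add: D_add InvD)
    then have ne: "D (tdeg ?b) (c + ?b) \<noteq> 0" using lead_neq_0[OF b(1,2)] by metis
    have "tdeg (c + ?b) = tdeg ?b"
      using tdeg_ge[OF _ ne] tdeg_add_le[OF cA b(1), of "tdeg ?b"] c cA b(1)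
      by (intro antisym) (auto simp: InvD)
    moreover have "c + ?b \<noteq> 0" using ne by auto
    ultimately show ?thesis using b cA False by simp
  qed
qed simp

text \<open>Division with remainder after inverting the leading coefficient t of \<open>s\<close>:
  since \<open>mdeg\<close> divides the degree of \<open>a\<close>, some power s^k has the same
  degree, and subtracting c s^k from t^k a, with c the leading coefficient of \<open>a\<close>,
  kills the top term.\<close>

lemma slice:
  assumes "CHAR('r) > 0" "s \<in> A" "tdeg s = mdeg" "\<not> A \<subseteq> Inv" "a \<in> A"
  shows "\<exists>e q. (\<forall>i. coeff q i \<in> Inv) \<and> D mdeg s ^ e * a = poly q s"
  using assms(5)
proof (induction "tdeg a" arbitrary: a rule: less_induct)
  case less
  let ?t = "D mdeg s"
  have s0: "s \<noteq> 0" using assms mdeg by auto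
  have t: "?t \<in> Inv" using lead_in_Inv assms by simp
  show ?case
  proof (cases "tdeg a = 0")
    case True
    then have "a \<in> Inv" using less by (simp add: Inv_def)
    then show ?thesis by (intro exI[of _ 0] exI[of _ "[:a:]"]) (auto simp: coeff_pCons split: nat.split)
  next
    case False
    obtain k where k: "tdeg a = mdeg * k" using mdeg_dvd[OF assms(1) less.prems] by blast
    then have k0: "k > 0" using False by simp
    define c where "c = D (tdeg a) a"
    have c: "c \<in> Inv" unfolding c_def by (rule lead_in_Inv[OF less.prems order_refl])
    define b where "b = ?t ^ k * a - c * s ^ k"
    have sk: "tdeg (s ^ k) = tdeg a" using tdeg_power assms s0 k by simp
    have lead: "D (mdeg * j) (s ^ j) = ?t ^ j" for j
    proof (induction j)
      case (Suc j)
      have "D (mdeg + mdeg * j) (s * s ^ j) = D mdeg s * D (mdeg * j) (s ^ j)"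
        using assms tdeg_power s0 by (intro D_mult_top) auto
      then show ?case using Suc by simp
    qed (use assms in simp)
    have bA: "b \<in> A" using c t assms less.prems by (auto simp: b_def InvD)
    have Db: "D i b = ?t ^ k * D i a - c * D i (s ^ k)" for i
      unfolding b_def using t c less.prems assms by (simp add: D_diff D_Inv_mult InvD)
    have z: "D i b = 0" if "i \<ge> tdeg a" for i
    proof (cases "i = tdeg a")
      case True
      then show ?thesis using Db[of i] lead[of k] k by (simp add: c_def)
    next
      case False
      then show ?thesis using that Db[of i] D_above_tdeg[OF less.prems, of i] assms
        D_above_tdeg[of "s ^ k" i] sk by simp
    qed
    have "tdeg b < tdeg a"
    proof (cases "b = 0")
      case nz: False
      show ?thesis using z[of "tdeg b"] lead_neq_0[OF bA nz] by (meson not_le)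
    qed (use False in simp)
    from less.hyps[OF this bA] obtain e q where
      q: "\<forall>i. coeff q i \<in> Inv" "?t ^ e * b = poly q s" by blast
    have "?t ^ (e + k) * a = poly (q + monom (?t ^ e * c) k) s"
      using q(2) by (simp add: b_def power_add algebra_simps poly_monom)
    moreover have "coeff (q + monom (?t ^ e * c) k) i \<in> Inv" for i
      using q(1) t c by auto
    ultimately show ?thesis by blast
  qed
qed

end

section \<open>Lines in the affine plane\<close>

definition cst :: "'a::comm_ring_1 \<Rightarrow> 'a poly poly" where "cst c = [:[:c:]:]"

lemma cst_0 [simp]: "cst 0 = 0" and cst_1 [simp]: "cst 1 = 1"
  and cst_add: "cst (a + b) = cst a + cst b" and cst_mult: "cst (a * b) = cst a * cst b"
  and cst_uminus: "cst (- a) = - cst a" and cst_diff: "cst (a - b) = cst a - cst b"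
  by (simp_all add: cst_def)

lemma cst_eq_0_iff [simp]: "cst a = 0 \<longleftrightarrow> a = 0" by (simp add: cst_def)

lemma cst_inverse: "(c::'a::field) \<noteq> 0 \<Longrightarrow> cst (inverse c) * cst c = 1"
  by (simp add: cst_def)

definition ev :: "'a::comm_ring_1 poly \<Rightarrow> 'a poly poly \<Rightarrow> 'a poly poly" where
  "ev P a = poly (map_poly cst P) a"

lemma pcompose_X [simp]: "pcompose P (pCons 0 1) = (P :: 'a::comm_ring_1 poly)"
  using pcompose_idR[of P] by (simp only: pCons_one)

lemma ev_0 [simp]: "ev 0 a = 0" by (simp add: ev_def)

lemma ev_pCons [simp]: "ev (pCons c P) a = cst c + a * ev P a"
  by (cases "c = 0 \<and> P = 0") (auto simp: ev_def map_poly_pCons)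

lemma ev_1 [simp]: "ev 1 a = 1" by (simp add: one_pCons del: pCons_one)

lemma ev_add: "ev (P + Q) a = ev P a + ev Q a"
  by (induction P arbitrary: Q rule: pCons_induct; case_tac Q)
     (simp_all add: cst_add algebra_simps)

lemma ev_smult: "ev (smult c P) a = cst c * ev P a"
  by (induction P rule: pCons_induct) (simp_all add: cst_mult algebra_simps)

lemma ev_mult: "ev (P * Q) a = ev P a * ev Q a"
  by (induction P rule: pCons_induct) (simp_all add: ev_add ev_smult algebra_simps)

lemma ev_uminus: "ev (- P) a = - ev P a"
  using ev_smult[of "-1" P a] by (simp add: cst_uminus)

lemma ev_diff: "ev (P - Q) a = ev P a - ev Q a"
  using ev_add[of P "- Q" a] by (simp add: ev_uminus)

lemma ev_power: "ev (P ^ n) a = ev P a ^ n"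
  by (induction n) (simp_all add: ev_mult)

lemma ev_sum: "ev (sum F I) a = (\<Sum>i\<in>I. ev (F i) a)"
  by (induction I rule: infinite_finite_induct) (simp_all add: ev_add)

lemma ev_altdef: "ev P a = (\<Sum>i\<le>degree P. cst (coeff P i) * a ^ i)"
proof -
  have "ev P a = ev (\<Sum>i\<le>degree P. monom (coeff P i) i) a"
    by (simp add: poly_as_sum_of_monoms)
  also have "\<dots> = (\<Sum>i\<le>degree P. cst (coeff P i) * a ^ i)"
    unfolding ev_sum
  proof (intro sum.cong refl)
    fix i
    have "ev (monom c i) a = cst c * a ^ i" for c
      by (induction i) (simp_all add: monom_0 monom_Suc algebra_simps)
    then show "ev (monom (coeff P i) i) a = cst (coeff P i) * a ^ i" by simp
  qed
  finally show ?thesis .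
qed

text \<open>Additive on products because leading coefficients multiply, and zero only on constants;
  it bounds chains of factors and the powers of f that divide an element.\<close>

definition msize :: "'a::field poly poly \<Rightarrow> nat" where
  "msize a = degree a + degree (lead_coeff a)"

lemma msize_mult: "a \<noteq> 0 \<Longrightarrow> b \<noteq> 0 \<Longrightarrow> msize (a * b) = msize a + msize b"
  unfolding msize_def lead_coeff_mult by (simp add: degree_mult_eq)

lemma msize_power: "a \<noteq> 0 \<Longrightarrow> msize (a ^ n) = n * msize a"
  by (induction n) (simp_all add: msize_mult, simp add: msize_def)

lemma msize_eq_0D:
  assumes "msize a = 0"
  obtains c where "a = cst c"
proof -
  have "degree a = 0" and *: "degree (lead_coeff a) = 0" using assms by (auto simp: msize_def)
  then obtain b where b: "a = [:b:]" using degree0_coeffs by blast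
  with * obtain c where "b = [:c:]" using degree0_coeffs by auto
  then show ?thesis using that b by (simp add: cst_def)
qed

lemma msize_cst [simp]: "msize (cst c) = 0" by (simp add: msize_def cst_def)

lemma msize_diff_cst: "msize (a - cst c) \<le> msize a"
proof (cases "degree a = 0")
  case True
  then obtain b where b: "a = [:b:]" using degree0_coeffs by blast
  have "degree (b - [:c:]) \<le> max (degree b) (degree [:c:])" by (rule degree_diff_le_max)
  then show ?thesis by (simp add: b cst_def msize_def)
next
  case False
  then obtain n where n: "degree a = Suc n" by (cases "degree a") auto
  have "degree (a - cst c) = degree a"
    unfolding cst_def using False by (simp only: diff_conv_add_uminus, subst degree_add_eq_left) auto
  then show ?thesis by (simp add: msize_def cst_def n coeff_pCons)
qed

lemma is_unit_cst_iff: "cst (c::'a::field) dvd 1 \<longleftrightarrow> c \<noteq> 0"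
  by (simp add: cst_def is_unit_const_poly_iff is_unit_iff_degree dvd_field_iff)

lemma subalgebra2_one: "1 \<in> subalgebra2 f g"
  and subalgebra2_cst: "cst c \<in> subalgebra2 f g"
  and subalgebra2_gens: "f \<in> subalgebra2 f g" "g \<in> subalgebra2 f g"
  and subalgebra2_add: "a \<in> subalgebra2 f g \<Longrightarrow> b \<in> subalgebra2 f g \<Longrightarrow> a + b \<in> subalgebra2 f g"
  and subalgebra2_mult: "a \<in> subalgebra2 f g \<Longrightarrow> b \<in> subalgebra2 f g \<Longrightarrow> a * b \<in> subalgebra2 f g"
  using generate_ring.one[of ring_of_type_algebra "range (\<lambda>c. [:[:c:]:]) \<union> {f, g}"]
    generate_ring.incl[of _ "range (\<lambda>c. [:[:c:]:]) \<union> {f, g}" ring_of_type_algebra]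
    generate_ring.eng_add[of _ ring_of_type_algebra "range (\<lambda>c. [:[:c:]:]) \<union> {f, g}"]
    generate_ring.eng_mult[of _ ring_of_type_algebra "range (\<lambda>c. [:[:c:]:]) \<union> {f, g}"]
  by (auto simp: subalgebra2_def cst_def ring_of_type_algebra_def)

lemma subalgebra2_ev: "a \<in> subalgebra2 f g \<Longrightarrow> ev P a \<in> subalgebra2 f g"
  by (induction P rule: pCons_induct)
     (use subalgebra2_cst[of 0] in \<open>auto intro: subalgebra2_add subalgebra2_mult subalgebra2_cst\<close>)

text \<open>\<open>\<psi>\<close> stands for reduction modulo \<open>f\<close> followed by the
  isomorphism with k[\<tau>], and \<open>q\<close> for a lift of the parameter \<tau>. Surjectivity
  is built into \<open>q\<close>, since \<open>\<psi> (ev P q) = P\<close>.\<close>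

locale line =
  fixes f :: "'a::field poly poly" and \<psi> :: "'a poly poly \<Rightarrow> 'a poly" and q
  assumes \<psi>_add: "\<psi> (a + b) = \<psi> a + \<psi> b" and \<psi>_mult: "\<psi> (a * b) = \<psi> a * \<psi> b"
    and \<psi>_cst [simp]: "\<psi> (cst c) = [:c:]"
    and \<psi>_eq_0_iff: "\<psi> a = 0 \<longleftrightarrow> f dvd a"
    and \<psi>_q [simp]: "\<psi> q = [:0, 1:]"
    and f_neq_0 [simp]: "f \<noteq> 0"
begin

lemma \<psi>_0 [simp]: "\<psi> 0 = 0" using \<psi>_cst[of 0] by simp

lemma \<psi>_1 [simp]: "\<psi> 1 = 1" using \<psi>_cst[of 1] by simp

lemma \<psi>_uminus: "\<psi> (- a) = - \<psi> a"
  using \<psi>_add[of a "- a"] by (simp add: eq_neg_iff_add_eq_0 add.commute)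

lemma \<psi>_diff: "\<psi> (a - b) = \<psi> a - \<psi> b"
  using \<psi>_add[of a "- b"] by (simp add: \<psi>_uminus)

lemma \<psi>_power: "\<psi> (a ^ n) = \<psi> a ^ n"
  by (induction n) (simp_all add: \<psi>_mult)

lemma \<psi>_sum: "\<psi> (sum F I) = (\<Sum>i\<in>I. \<psi> (F i))"
  by (induction I rule: infinite_finite_induct) (simp_all add: \<psi>_add)

lemma \<psi>_ev: "\<psi> (ev P a) = pcompose P (\<psi> a)"
  by (induction P rule: pCons_induct) (simp_all add: \<psi>_add \<psi>_mult pcompose_pCons)

lemma \<psi>_f [simp]: "\<psi> f = 0" by (simp add: \<psi>_eq_0_iff)

lemma prime_f: "prime_elem f"
  unfolding prime_elem_def
proof (intro conjI allI impI)
  show "\<not> f dvd 1" using \<psi>_eq_0_iff[of 1] by simp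
  fix a b assume "f dvd a * b"
  then show "f dvd a \<or> f dvd b" by (simp flip: \<psi>_eq_0_iff add: \<psi>_mult)
qed simp

lemma msize_f_pos: "msize f > 0"
proof (rule ccontr)
  assume "\<not> msize f > 0"
  then have "msize f = 0" by simp
  then obtain c where "f = cst c" by (rule msize_eq_0D)
  then show False using \<psi>_f f_neq_0 by simp
qed

text \<open>With \<open>G\<close> the ring of invariants in \<open>k[z,t]\<close>: if \<open>f\<close> is a coordinate over the fraction
  field of \<open>G\<close>, then restricting to the line \<open>f = 0\<close> identifies \<open>G\<close> with \<open>k[\<tau>]\<close>, because
  \<open>\<psi> ` G\<close> is factorial with fraction field \<open>k(\<tau>)\<close>.\<close>

lemma variable_if_coordinate_over_subring:
  assumes G1: "\<And>c. cst c \<in> G" and Gadd: "\<And>a b. a \<in> G \<Longrightarrow> b \<in> G \<Longrightarrow> a + b \<in> G"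
    and Gmult: "\<And>a b. a \<in> G \<Longrightarrow> b \<in> G \<Longrightarrow> a * b \<in> G"
    and Gfac: "\<And>a b. a * b \<in> G \<Longrightarrow> a * b \<noteq> 0 \<Longrightarrow> a \<in> G"
    and fG: "f \<notin> G"
    and frac: "\<And>a. \<exists>d P. d \<in> G \<and> d \<noteq> 0 \<and> (\<forall>i. coeff P i \<in> G) \<and> d * a = poly P f"
  shows "\<exists>g. subalgebra2 f g = UNIV"
proof -
  have Guminus: "- a \<in> G" if "a \<in> G" for a
    using Gmult[OF G1[of "-1"] that] by (simp add: cst_uminus)
  have Gdiff: "a - b \<in> G" if "a \<in> G" "b \<in> G" for a b
    using Gadd[OF that(1) Guminus[OF that(2)]] by simp
  have Gpow: "a ^ n \<in> G" if "a \<in> G" for a n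
    using G1[of 1] Gmult that by (induction n) auto
  have Gsum: "sum F I \<in> G" if "\<And>i. i \<in> I \<Longrightarrow> F i \<in> G" for F :: "nat \<Rightarrow> _" and I
    using that G1[of 0] Gadd by (induction I rule: infinite_finite_induct) auto
  have Gev: "ev P a \<in> G" if "a \<in> G" for P a
    unfolding ev_altdef using that by (intro Gsum Gmult G1 Gpow)
  \<comment> \<open>A nonzero element of the kernel has \<open>f\<close> as a factor, and closure of
    \<open>G\<close> under factors would put \<open>f\<close> into \<open>G\<close>.\<close>
  have inj: "h = 0" if "h \<in> G" "\<psi> h = 0" for h
  proof (rule ccontr)
    assume "h \<noteq> 0"
    obtain u where "h = f * u" using \<open>\<psi> h = 0\<close> by (auto simp: \<psi>_eq_0_iff)
    then show False using Gfac[of f u] that fG \<open>h \<noteq> 0\<close> by auto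
  qed
  \<comment> \<open>\<open>good B\<close> says that \<tau> is a fraction \<psi> A / \<psi> B with A
    and B from \<open>G\<close>. Clearing denominators for \<open>q\<close> and then reducing modulo
    f gives such a B; one of least size is kept.\<close>
  define good where "good B \<longleftrightarrow> B \<in> G \<and> B \<noteq> 0 \<and> (\<exists>A\<in>G. \<psi> B * [:0, 1:] = \<psi> A)" for B
  have "\<exists>B. good B"
  proof -
    obtain d P where d: "d \<in> G" "d \<noteq> 0" "\<forall>i. coeff P i \<in> G" "d * q = poly P f"
      using frac[of q] by blast
    have "\<psi> d * [:0, 1:] = \<psi> (poly P f)" using d(4) by (metis \<psi>_mult \<psi>_q)
    also have "\<dots> = \<psi> (coeff P 0)" by (cases P) (simp add: \<psi>_add \<psi>_mult)
    finally show ?thesis using d unfolding good_def by blast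
  qed
  then obtain B where B: "good B" and Bmin: "\<And>B'. good B' \<Longrightarrow> msize B \<le> msize B'"
    using ex_has_least_nat[of good _ msize] by blast
  from B obtain A where BG: "B \<in> G" "B \<noteq> 0" and A: "A \<in> G" "\<psi> B * [:0, 1:] = \<psi> A"
    unfolding good_def by blast
  have \<psi>B0: "\<psi> B \<noteq> 0" using inj BG by blast
  have A0: "A \<noteq> 0" using A \<psi>B0 by auto
  have "\<exists>h\<in>G. degree (\<psi> h) > 0"
  proof (rule ccontr)
    assume "\<not> ?thesis"
    then have "degree (\<psi> A) = 0" using A by auto
    moreover have "degree (\<psi> A) = degree (\<psi> B) + 1"
      unfolding A(2)[symmetric] using \<psi>B0 by (subst degree_mult_eq) auto
    ultimately show False by simp
  qed
  then obtain h where h: "h \<in> G" "degree (\<psi> h) > 0" by blast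
  define n where "n = degree (\<psi> h)"
  define c where "c = coeff (\<psi> h)"
  have cn: "c n \<noteq> 0" using h by (auto simp: c_def n_def)
  have powA: "\<psi> A ^ i * \<psi> B ^ (n - i) = [:0, 1:] ^ i * \<psi> B ^ n" if "i \<le> n" for i
  proof -
    have "\<psi> B ^ n = \<psi> B ^ i * \<psi> B ^ (n - i)" using that by (simp flip: power_add)
    then show ?thesis unfolding A(2)[symmetric] power_mult_distrib by (simp only: mult_ac)
  qed
  \<comment> \<open>Homogenised form of the expansion of \<psi> h in powers of \<tau> = \<psi> A /
    \<psi> B: it holds after \<psi>, hence in \<open>G\<close>, where \<psi> is injective. The term
    with i = n then shows that B divides A^n.\<close>
  have "(\<Sum>i\<le>n. cst (c i) * A ^ i * B ^ (n - i)) - h * B ^ n = 0"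
  proof (rule inj)
    show "(\<Sum>i\<le>n. cst (c i) * A ^ i * B ^ (n - i)) - h * B ^ n \<in> G"
      using A BG h by (intro Gdiff Gsum Gmult G1 Gpow)
    have "\<psi> (\<Sum>i\<le>n. cst (c i) * A ^ i * B ^ (n - i)) = (\<Sum>i\<le>n. smult (c i) ([:0, 1:] ^ i) * \<psi> B ^ n)"
      unfolding \<psi>_sum
    proof (intro sum.cong refl)
      fix i assume "i \<in> {..n}"
      then show "\<psi> (cst (c i) * A ^ i * B ^ (n - i)) = smult (c i) ([:0, 1:] ^ i) * \<psi> B ^ n"
        using powA[of i] by (simp add: \<psi>_mult \<psi>_power mult.assoc)
    qed
    also have "\<dots> = \<psi> h * \<psi> B ^ n"
    proof -
      have "(\<Sum>i\<le>n. smult (c i) ([:0, 1:] ^ i)) = \<psi> h"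
        using poly_as_sum_of_monoms[of "\<psi> h"] by (simp add: c_def n_def monom_altdef)
      then show ?thesis by (simp only: sum_distrib_right[symmetric])
    qed
    finally show "\<psi> ((\<Sum>i\<le>n. cst (c i) * A ^ i * B ^ (n - i)) - h * B ^ n) = 0"
      by (simp add: \<psi>_diff \<psi>_mult \<psi>_power)
  qed
  moreover obtain n' where n': "n = Suc n'" using h unfolding n_def by (cases "degree (\<psi> h)") auto
  ultimately have "cst (c n) * A ^ n = B * (h * B ^ n' - (\<Sum>i\<le>n'. cst (c i) * A ^ i * B ^ (n' - i)))"
    by (simp add: Suc_diff_le algebra_simps sum_distrib_left)
  then have "B dvd cst (inverse (c n)) * (cst (c n) * A ^ n)" by simp
  then have BA: "B dvd A ^ n" using cst_inverse[OF cn] by (simp flip: mult.assoc)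
  \<comment> \<open>A prime factor of B would also divide A; cancelling it from both leaves elements
    of \<open>G\<close>, by closure under factors, and hence a smaller denominator.\<close>
  have "B dvd 1"
  proof (rule ccontr)
    assume "\<not> B dvd 1"
    then obtain F where F: "mset_factors F B" using mset_factors_exist[OF BG(2)] by blast
    then obtain \<pi> where "\<pi> \<in># F" "Factorial_Ring.irreducible \<pi>" by (auto elim!: mset_factorsE)
    then have \<pi>: "prime_elem \<pi>" "\<pi> dvd B" using F mset_factors_imp_dvd by auto
    have "\<pi> dvd A ^ n" using \<pi>(2) BA by (rule dvd_trans)
    then have "\<pi> dvd A" using \<pi>(1) by (metis prime_elem_dvd_power)
    then obtain A' where A': "A = \<pi> * A'" by (rule dvdE)
    obtain B' where B': "B = \<pi> * B'" using \<pi>(2) by (rule dvdE)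
    have \<pi>G: "\<pi> \<in> G" "B' \<in> G" "A' \<in> G"
      using Gfac[of \<pi> B'] Gfac[of B' \<pi>] Gfac[of A' \<pi>] A A0 BG by (auto simp: A' B' mult.commute)
    have "\<psi> \<pi> \<noteq> 0" using inj \<pi> \<pi>G prime_elem_not_zeroI by (metis not_prime_elem_zero)
    moreover have "\<psi> \<pi> * (\<psi> B' * [:0, 1:]) = \<psi> \<pi> * \<psi> A'"
      using A(2) unfolding A' B' \<psi>_mult mult.assoc .
    ultimately have "\<psi> B' * [:0, 1:] = \<psi> A'" by (metis mult_left_cancel)
    then have "good B'" using \<pi>G BG by (auto simp: good_def B')
    then have "msize B \<le> msize B'" by (rule Bmin)
    then have "msize \<pi> = 0" using BG msize_mult[of \<pi> B'] by (auto simp: B')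
    then obtain u where "\<pi> = cst u" using msize_eq_0D by blast
    then show False using \<pi> by (metis cst_0 is_unit_cst_iff prime_elem_not_unit not_prime_elem_zero)
  qed
  then obtain b where b: "B = cst b"
    using msize_eq_0D[of B] BG msize_mult by (metis add_eq_0_iff_both_eq_0 dvdE msize_cst cst_1 mult_zero_left mult_zero_right zero_neq_one)
  have b0: "b \<noteq> 0" using BG b by auto
  define g where "g = cst (inverse b) * A"
  have gG: "g \<in> G" using Gmult G1 A unfolding g_def by blast
  have \<psi>g: "\<psi> g = [:0, 1:]"
    unfolding g_def \<psi>_mult A(2)[symmetric] using b0 by (simp add: b)
  have \<psi>ev: "\<psi> (ev P g) = P" for P by (simp add: \<psi>_ev \<psi>g)
  \<comment> \<open>Subtracting the polynomial in g with the same image under \<psi> leaves a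
    multiple f b of f. The constant term of the relation then lies in \<open>G\<close> and in the
    kernel of \<psi>, so it vanishes, and dividing by f gives a relation of smaller degree for
    b.\<close>
  have main: "a \<in> subalgebra2 f g"
    if "d \<in> G" "d \<noteq> 0" "\<forall>i. coeff P i \<in> G" "d * a = poly P f" for d a P
    using that
  proof (induction "degree P" arbitrary: P a rule: less_induct)
    case less
    have "f dvd a - ev (\<psi> a) g" by (simp flip: \<psi>_eq_0_iff add: \<psi>_diff \<psi>ev)
    then obtain b where b: "a - ev (\<psi> a) g = f * b" by blast
    obtain c0 P' where P: "P = pCons c0 P'" by (cases P)
    have c0: "c0 \<in> G" using less.prems(3) by (auto simp: P dest: spec[of _ 0])
    have P': "\<forall>i. coeff P' i \<in> G" using less.prems(3) by (auto simp: P dest: spec[of _ "Suc _"])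
    let ?e = "c0 - d * ev (\<psi> a) g"
    have eq: "?e + f * poly P' f = d * (f * b)"
      using less.prems(4) unfolding b[symmetric] by (simp add: P algebra_simps)
    have "\<psi> ?e = \<psi> (d * (f * b) - f * poly P' f)" by (simp flip: eq)
    also have "\<dots> = 0" by (simp add: \<psi>_diff \<psi>_mult)
    finally have "?e = 0" using c0 less.prems gG by (intro inj Gdiff Gmult Gev) auto
    then have "f * poly P' f = f * (d * b)" using eq by (simp add: algebra_simps)
    then have db: "d * b = poly P' f" by simp
    have "b \<in> subalgebra2 f g"
    proof (cases "P' = 0")
      case True
      then show ?thesis using db less.prems subalgebra2_cst[of 0] by simp
    next
      case False
      then show ?thesis using less.hyps[of P' b] db less.prems P' by (simp add: P)
    qed
    then have "ev (\<psi> a) g + f * b \<in> subalgebra2 f g"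
      by (intro subalgebra2_add subalgebra2_mult subalgebra2_ev subalgebra2_gens)
    then show ?case using b by (simp add: algebra_simps)
  qed
  have "a \<in> subalgebra2 f g" for a using frac[of a] main by blast
  then show ?thesis by blast
qed

text \<open>If \<open>\<psi> h\<close> were non-constant for an invariant \<open>h\<close>, every element would be congruent modulo
  \<open>f ^ N\<close> to one of bounded degree in \<open>T\<close>, so the leading coefficient of an element of large degree
  would be divisible by every \<open>f ^ N\<close>.\<close>

lemma invariants_of_exp_fixing_line:
  assumes "exp_map UNIV D" and fI: "f \<in> exp_map.Inv UNIV D" and cI: "\<And>c. cst c \<in> exp_map.Inv UNIV D"
    and ntriv: "exp_map.Inv UNIV D \<noteq> UNIV" and hI: "h \<in> exp_map.Inv UNIV D"
  shows "\<exists>P. h = ev P f"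
proof -
  interpret exp_map UNIV D by fact
  have f0: "tdeg f = 0" using fI InvD by blast
  have deg: "degree (\<psi> h) = 0" if hI: "h \<in> Inv" for h
  proof (rule ccontr)
    assume r: "degree (\<psi> h) \<noteq> 0"
    \<comment> \<open>Every polynomial in \<tau> lifts with degree at most C: repeated division by
      \<psi> h leaves remainders of degree below that of \<psi> h, which lift as polynomials in q,
      while multiplying by the invariant h costs no degree.\<close>
    define C where "C = degree (\<psi> h) * tdeg q"
    have h0: "tdeg h = 0" using hI InvD by blast
    have small: "tdeg (ev P q) \<le> degree P * tdeg q" for P
    proof (induction P rule: pCons_induct)
      case (pCons c P)
      have c: "tdeg (cst c) = 0" using cI InvD by blast
      show ?case
      proof (cases "P = 0")
        case False
        have "tdeg (q * ev P q) \<le> tdeg q + degree P * tdeg q"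
          using tdeg_mult_le[of q "ev P q"] pCons.IH by simp
        then show ?thesis using False c by (simp add: tdeg_add_le)
      qed (simp add: c)
    qed simp
    have lift: "\<exists>Q. \<psi> Q = P \<and> tdeg Q \<le> C" for P
    proof (induction "degree P" arbitrary: P rule: less_induct)
      case less
      show ?case
      proof (cases "degree P < degree (\<psi> h)")
        case True
        have "tdeg (ev P q) \<le> C" using small[of P] True unfolding C_def
          by (meson less_imp_le_nat mult_le_mono1 order_trans)
        then show ?thesis by (intro exI[of _ "ev P q"]) (simp add: \<psi>_ev)
      next
        case False
        define P1 where "P1 = P div \<psi> h"
        define P2 where "P2 = P mod \<psi> h"
        have P: "P = \<psi> h * P1 + P2" by (simp add: P1_def P2_def)
        have d2: "degree P2 < degree (\<psi> h)"
          unfolding P2_def using r degree_mod_less[of "\<psi> h" P]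
          by (cases "\<psi> h = 0"; cases "P mod \<psi> h = 0") auto
        have "\<exists>Q. \<psi> Q = P1 \<and> tdeg Q \<le> C"
        proof (cases "P1 = 0")
          case nz: False
          have hnz: "\<psi> h \<noteq> 0" using r by auto
          have "degree P2 < degree (\<psi> h * P1)" using d2 nz hnz by (simp add: degree_mult_eq)
          then have "degree P = degree (\<psi> h * P1)" unfolding P by (rule degree_add_eq_left)
          then have "degree P1 < degree P" using nz hnz r by (simp add: degree_mult_eq)
          then show ?thesis using less by blast
        qed (intro exI[of _ 0], simp)
        moreover have "\<exists>Q. \<psi> Q = P2 \<and> tdeg Q \<le> C" using less d2 False by simp
        ultimately obtain Q1 Q2 where Q: "\<psi> Q1 = P1" "tdeg Q1 \<le> C" "\<psi> Q2 = P2" "tdeg Q2 \<le> C" by blast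
        have "tdeg (h * Q1) \<le> C" using tdeg_mult_le[of h Q1] h0 Q by simp
        then have "tdeg (h * Q1 + Q2) \<le> C" using Q tdeg_add_le by simp
        then show ?thesis using Q P by (intro exI[of _ "h * Q1 + Q2"]) (simp add: \<psi>_add \<psi>_mult)
      qed
    qed
    have approx: "\<exists>Q b. a = Q + f ^ N * b \<and> tdeg Q \<le> C" for a N
    proof (induction N)
      case 0
      show ?case by (intro exI[of _ 0] exI[of _ a]) simp
    next
      case (Suc N)
      then obtain Q b where Q: "a = Q + f ^ N * b" "tdeg Q \<le> C" by blast
      obtain Q' where Q': "\<psi> Q' = \<psi> b" "tdeg Q' \<le> C" using lift by blast
      have "f dvd b - Q'" using Q' by (simp flip: \<psi>_eq_0_iff add: \<psi>_diff)
      then obtain b' where b': "b - Q' = f * b'" by blast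
      have "tdeg (f ^ N) = 0" using Inv_power[OF fI] InvD by blast
      then have "tdeg (f ^ N * Q') \<le> C" using tdeg_mult_le[of "f ^ N" Q'] Q' by simp
      then have "tdeg (Q + f ^ N * Q') \<le> C" using Q tdeg_add_le by simp
      moreover have "a = (Q + f ^ N * Q') + f ^ Suc N * b'"
        using Q(1) b' by (simp add: algebra_simps)
      ultimately show ?case by blast
    qed
    obtain a where "a \<notin> Inv" using ntriv by blast
    then have a: "tdeg a > 0" "a \<noteq> 0" using tdeg_pos by auto
    \<comment> \<open>The exponent makes the degree of u exceed C, so the part of bounded degree
      contributes nothing to the leading coefficient.\<close>
    define u where "u = a ^ Suc C"
    have "Suc C * 1 \<le> Suc C * tdeg a" using a by (intro mult_le_mono2) simp
    then have u: "tdeg u > C" "u \<noteq> 0" using a tdeg_power[of a "Suc C"] by (simp_all add: u_def)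
    let ?L = "D (tdeg u) u"
    have L: "?L \<noteq> 0" using lead_neq_0 u by simp
    have dvd: "f ^ N dvd ?L" for N
    proof -
      obtain Q b where Q: "u = Q + f ^ N * b" "tdeg Q \<le> C" using approx by blast
      have "?L = D (tdeg u) (Q + f ^ N * b)" using Q(1) by metis
      also have "\<dots> = D (tdeg u) Q + f ^ N * D (tdeg u) b" using Inv_power[OF fI] by (simp add: D_add D_Inv_mult)
      also have "D (tdeg u) Q = 0" using D_above_tdeg[of Q "tdeg u"] Q u by simp
      finally show ?thesis by simp
    qed
    obtain w where w: "?L = f ^ Suc (msize ?L) * w" using dvd by blast
    then have "msize ?L = Suc (msize ?L) * msize f + msize w"
      using L msize_mult[of "f ^ Suc (msize ?L)" w] msize_power[of f "Suc (msize ?L)"]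
      by (metis f_neq_0 mult_zero_left mult_zero_right)
    moreover have "Suc (msize ?L) * 1 \<le> Suc (msize ?L) * msize f"
      using msize_f_pos by (intro mult_le_mono2) simp
    ultimately show False by (metis le_add1 mult.right_neutral not_less_eq_eq order_refl order_trans)
  qed
  \<comment> \<open>All invariants now restrict to constants on the line, so h - c = f h', where h'
    is invariant as a factor of an invariant and has smaller size.\<close>
  show ?thesis using hI
  proof (induction "msize h" arbitrary: h rule: less_induct)
    case less
    obtain c where c: "\<psi> h = [:c:]" using deg[OF less.prems] degree0_coeffs by blast
    have "f dvd h - cst c" by (simp flip: \<psi>_eq_0_iff add: \<psi>_diff c)
    then obtain h' where h': "h - cst c = f * h'" by blast
    show ?case
    proof (cases "h' = 0")
      case True
      then show ?thesis using h' by (intro exI[of _ "[:c:]"]) simp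
    next
      case False
      have "h' \<in> Inv" using Inv_factor2[of f h'] h' less.prems cI False by (metis Inv_diff UNIV_I f_neq_0 no_zero_divisors)
      moreover have "msize h' < msize h"
        using msize_diff_cst[of h c] msize_mult[of f h'] False msize_f_pos by (simp add: h')
      ultimately obtain P where "h' = ev P f" using less by blast
      then show ?thesis using h' by (intro exI[of _ "pCons c P"]) (simp add: algebra_simps)
    qed
  qed
qed

end

section \<open>Exponential maps of the plane over an algebraically closed field\<close>

text \<open>\<open>P\<close> splits into linear factors, and each F - x is nonzero because
  \<open>F\<close> is not constant.\<close>

lemma ev_eq_0_imp:
  fixes F :: "'k::alg_closed_field poly poly"
  assumes "\<And>c. F \<noteq> cst c" "ev P F = 0"
  shows "P = 0"
proof (rule ccontr)
  assume "P \<noteq> 0"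
  then show False using assms(2)
  proof (induction "degree P" arbitrary: P)
    case 0
    then obtain c where "P = [:c:]" using degree0_coeffs by metis
    then show ?case using 0 by simp
  next
    case (Suc n)
    obtain x where "poly P x = 0" using alg_closed_imp_poly_has_root[of P] Suc by auto
    then obtain Q where Q: "P = [:-x, 1:] * Q" using poly_eq_0_iff_dvd by blast
    have "Q \<noteq> 0" using Suc Q by auto
    moreover have "(F - cst x) * ev Q F = 0"
      using Suc.prems(2) unfolding Q ev_mult by (simp add: cst_uminus)
    then have "ev Q F = 0" using assms(1)[of x] by simp
    moreover have "degree P = Suc (degree Q)" using \<open>Q \<noteq> 0\<close> unfolding Q by (subst degree_mult_eq) auto
    ultimately show ?case using Suc.hyps(1)[of Q] Suc.hyps(2) by simp
  qed
qed

lemma ev_inj: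
  fixes F :: "'k::alg_closed_field poly poly"
  assumes "\<And>c. F \<noteq> cst c" "ev P F = ev Q F"
  shows "P = Q"
  using ev_eq_0_imp[OF assms(1), of "P - Q"] assms(2) by (simp add: ev_diff)

lemma ev_diff_cst_dvd: "F - cst c dvd ev P F - cst (poly P c)"
proof -
  obtain Q where "P - [:poly P c:] = [:-c, 1:] * Q"
    using poly_eq_0_iff_dvd[of "P - [:poly P c:]" c] by auto
  then have "ev (P - [:poly P c:]) F = ev ([:-c, 1:] * Q) F" by simp
  then have "ev P F - cst (poly P c) = (F - cst c) * ev Q F"
    unfolding ev_mult ev_diff by (simp add: cst_uminus)
  then show ?thesis by simp
qed

text \<open>A slice h whose leading coefficient P(F) has least degree in \<open>F\<close> generates,
  because modulo each prime F - c it stays transcendental over k, and then denominators can be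
  cancelled. Making \<open>P\<close> monic is for the descent, where a k-linear retraction must not
  lose the leading coefficient.\<close>

lemma generator_over_alg_closed:
  fixes F :: "'k::alg_closed_field poly poly"
  assumes "exp_map UNIV D" and Inv: "exp_map.Inv UNIV D = range (\<lambda>P. ev P F)"
    and F: "\<And>c. F \<noteq> cst c" and ntriv: "exp_map.Inv UNIV D \<noteq> UNIV" and char: "CHAR('k) > 0"
  shows "\<exists>h P. lead_coeff P = 1 \<and> exp_map.tdeg D h = exp_map.mdeg UNIV D \<and>
      D (exp_map.mdeg UNIV D) h = ev P F \<and>
      (\<forall>a. \<exists>q. (\<forall>i. coeff q i \<in> exp_map.Inv UNIV D) \<and> a = poly q h)"
proof -
  interpret exp_map UNIV D by fact
  have nt: "\<not> UNIV \<subseteq> Inv" using ntriv by blast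
  have CHAR: "CHAR('k poly poly) > 0" using char by simp
  let ?n = mdeg
  have n: "?n > 0" using mdeg nt by blast
  have evI: "ev P F \<in> Inv" for P by (simp add: Inv)
  have cI: "cst c \<in> Inv" for c using evI[of "[:c:]"] by simp
  have FI: "F - cst c \<in> Inv" for c using evI[of "[:-c, 1:]"] by (simp add: cst_uminus)
  \<comment> \<open>Factors of F - c are invariant, hence polynomials in F; comparing degrees in F,
    one of them is constant.\<close>
  have prime: "prime_elem (F - cst c)" for c
  proof -
    have "Factorial_Ring.irreducible (F - cst c)"
    proof (rule Factorial_Ring.irreducibleI)
      show nz: "F - cst c \<noteq> 0" using F[of c] by simp
      show "\<not> F - cst c dvd 1"
      proof
        assume "F - cst c dvd 1"
        then obtain w where w: "1 = (F - cst c) * w" by (rule dvdE)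
        then have "msize (F - cst c) + msize w = msize (1 :: 'k poly poly)"
          using msize_mult[of "F - cst c" w] by (metis mult_zero_left mult_zero_right zero_neq_one)
        moreover have "msize (1 :: 'k poly poly) = 0" by (simp add: msize_def)
        ultimately have "msize (F - cst c) = 0" by simp
        then obtain b where "F - cst c = cst b" by (rule msize_eq_0D)
        then have "F = cst (b + c)" by (simp add: cst_add algebra_simps)
        then show False using F by blast
      qed
      fix a b assume ab: "F - cst c = a * b"
      then have "a * b \<in> Inv" "a * b \<noteq> 0" using FI[of c] nz by auto
      then have "a \<in> Inv" "b \<in> Inv" using Inv_factor[of a b] Inv_factor2[of a b] by auto
      then obtain P Q where P: "a = ev P F" and Q: "b = ev Q F" using Inv by auto
      have "ev [:-c, 1:] F = ev (P * Q) F" using ab by (simp add: ev_mult P Q cst_uminus)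
      then have PQ: "[:-c, 1:] = P * Q" by (rule ev_inj[OF F])
      then have "P \<noteq> 0" "Q \<noteq> 0" by auto
      then have "degree P + degree Q = 1" using degree_mult_eq[of P Q] by (simp flip: PQ)
      then have "degree P = 0 \<or> degree Q = 0" by linarith
      then show "a dvd 1 \<or> b dvd 1"
      proof
        assume "degree P = 0"
        then obtain u where "P = [:u:]" using degree0_coeffs by blast
        then have "a dvd 1" using \<open>P \<noteq> 0\<close> is_unit_cst_iff[of u] by (simp add: P)
        then show ?thesis ..
      next
        assume "degree Q = 0"
        then obtain u where "Q = [:u:]" using degree0_coeffs by blast
        then have "b dvd 1" using \<open>Q \<noteq> 0\<close> is_unit_cst_iff[of u] by (simp add: Q)
        then show ?thesis ..
      qed
    qed
    then show ?thesis by simp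
  qed
  define good where "good P \<longleftrightarrow> (\<exists>h. tdeg h = ?n \<and> D ?n h = ev P F)" for P
  have "\<exists>P. good P"
  proof -
    obtain h where "tdeg h = ?n" using mdeg(2)[OF nt] by blast
    moreover then have "D ?n h \<in> Inv" using lead_in_Inv by simp
    ultimately show ?thesis unfolding good_def Inv by blast
  qed
  then obtain P where "good P" and Pmin: "\<And>P'. good P' \<Longrightarrow> degree P \<le> degree P'"
    using ex_has_least_nat[of good _ degree] by blast
  then obtain h where h: "tdeg h = ?n" "D ?n h = ev P F" unfolding good_def by blast
  have "h \<noteq> 0" using h n by auto
  then have P0: "P \<noteq> 0" using h n lead_neq_0[of h] by auto
  \<comment> \<open>If h - d = (F - c) h', then h' has the same degree in T, but its leading
    coefficient has degree one less in F, contrary to minimality.\<close>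
  have nodvd: "\<not> F - cst c dvd h - cst d" for c d
  proof
    assume "F - cst c dvd h - cst d"
    then obtain h' where h': "h - cst d = (F - cst c) * h'" by (rule dvdE)
    have D: "D i h = (F - cst c) * D i h'" if "i > 0" for i
    proof -
      have "D i (h - cst d) = D i h" using that cI by (simp add: D_diff InvD(3))
      then show ?thesis unfolding h' using FI by (simp add: D_Inv_mult)
    qed
    have Fc: "F - cst c \<noteq> 0" using F[of c] by simp
    have "tdeg h' = ?n"
    proof (rule antisym)
      show "tdeg h' \<le> ?n"
      proof (rule tdeg_leI)
        fix i assume "i > ?n"
        then have "D i h = 0" using h D_above_tdeg by simp
        then show "D i h' = 0" using D[of i] \<open>i > ?n\<close> Fc by simp
      qed simp
      have "D ?n h' \<noteq> 0" using D[OF n] h lead_neq_0[of h] \<open>h \<noteq> 0\<close> by auto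
      then show "?n \<le> tdeg h'" by (intro tdeg_ge) auto
    qed
    moreover then obtain P' where P': "D ?n h' = ev P' F"
      using lead_in_Inv[of h' ?n] unfolding Inv by auto
    ultimately have le: "degree P \<le> degree P'" using Pmin good_def by blast
    have "ev P F = ev ([:-c, 1:] * P') F" using D[OF n] h(2) P' unfolding ev_mult by (simp add: cst_uminus)
    then have "P = [:-c, 1:] * P'" by (rule ev_inj[OF F])
    moreover then have "P' \<noteq> 0" using P0 by auto
    ultimately have "degree P = Suc (degree P')" by (simp only:, subst degree_mult_eq) auto
    then show False using le by simp
  qed
  \<comment> \<open>So no nonzero polynomial R(h) over k vanishes modulo the prime F - c: split R
    into linear factors.\<close>
  have nodvd2: "\<not> F - cst c dvd ev R h" if "R \<noteq> 0" for R c
    using that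
  proof (induction "degree R" arbitrary: R)
    case 0
    then obtain u where R: "R = [:u:]" using degree0_coeffs by metis
    then have unit: "ev R h dvd 1" using 0 is_unit_cst_iff[of u] by simp
    show ?case using dvd_trans[OF _ unit] prime_elem_not_unit[OF prime[of c]] by metis
  next
    case (Suc m)
    obtain x where "poly R x = 0" using alg_closed_imp_poly_has_root[of R] Suc by auto
    then obtain Q where Q: "R = [:-x, 1:] * Q" using poly_eq_0_iff_dvd by blast
    have "Q \<noteq> 0" using Suc Q by auto
    have "degree R = Suc (degree Q)" using \<open>Q \<noteq> 0\<close> unfolding Q by (subst degree_mult_eq) auto
    then have "\<not> F - cst c dvd ev Q h" using Suc \<open>Q \<noteq> 0\<close> by simp
    moreover have "ev R h = (h - cst x) * ev Q h" unfolding Q ev_mult by (simp add: cst_uminus)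
    ultimately show ?case using prime_elem_dvd_mult_iff[OF prime[of c]] nodvd by simp
  qed
  have gen: "\<exists>q. (\<forall>i. coeff q i \<in> Inv) \<and> a = poly q h" for a
  proof -
    \<comment> \<open>\<open>ok d\<close> says that d(F) is a denominator for a. At a root c of d
      the right-hand side is divisible by F - c. Reducing its coefficients modulo F - c gives R(h),
      so R = 0 by \<open>nodvd2\<close>; hence all coefficients are divisible by F - c and this
      factor cancels.\<close>
    define ok where "ok d \<longleftrightarrow> d \<noteq> 0 \<and> (\<exists>q. (\<forall>i. coeff q i \<in> Inv) \<and> ev d F * a = poly q h)" for d
    have "\<exists>d. ok d"
    proof -
      obtain e q where "\<forall>i. coeff q i \<in> Inv" "D ?n h ^ e * a = poly q h"
        using slice[OF CHAR _ h(1) nt, of a] by auto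
      then have "ok (P ^ e)" using P0 h by (auto simp: ok_def ev_power)
      then show ?thesis ..
    qed
    then obtain d where d: "ok d" and dmin: "\<And>d'. ok d' \<Longrightarrow> degree d \<le> degree d'"
      using ex_has_least_nat[of ok _ degree] by blast
    then obtain q where q: "\<forall>i. coeff q i \<in> Inv" "ev d F * a = poly q h" by (auto simp: ok_def)
    have d0: "d \<noteq> 0" using d by (simp add: ok_def)
    have "degree d = 0"
    proof (rule ccontr)
      assume "degree d \<noteq> 0"
      then obtain c where "poly d c = 0" using alg_closed_imp_poly_has_root[of d] by auto
      then obtain d' where d': "d = [:-c, 1:] * d'" using poly_eq_0_iff_dvd by blast
      have "d' \<noteq> 0" using d0 d' by auto
      have evd: "ev d F = (F - cst c) * ev d' F" unfolding d' ev_mult by (simp add: cst_uminus)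
      have "\<forall>i. \<exists>Q. coeff q i = ev Q F" using q(1) Inv by auto
      then obtain Q where Q: "\<And>i. coeff q i = ev (Q i) F" by metis
      define R where "R = (\<Sum>i\<le>degree q. monom (poly (Q i) c) i)"
      have "ev (monom u i) h = cst u * h ^ i" for u i
        by (induction i) (simp_all add: monom_0 monom_Suc algebra_simps)
      then have evR: "ev R h = (\<Sum>i\<le>degree q. cst (poly (Q i) c) * h ^ i)"
        by (simp add: R_def ev_sum)
      have "F - cst c dvd poly q h - ev R h"
        unfolding evR poly_altdef[of q h] Q sum_subtractf[symmetric] left_diff_distrib[symmetric]
        by (intro dvd_sum dvd_mult2 ev_diff_cst_dvd)
      moreover have "F - cst c dvd poly q h" unfolding q(2)[symmetric] evd by simp
      ultimately have "F - cst c dvd ev R h" using dvd_diff[of _ "poly q h" "poly q h - ev R h"] by simp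
      then have "R = 0" using nodvd2 by blast
      have "F - cst c dvd coeff q i" for i
      proof (cases "i \<le> degree q")
        case True
        have "coeff R i = poly (Q i) c" using True by (simp add: R_def coeff_sum)
        then show ?thesis using \<open>R = 0\<close> ev_diff_cst_dvd[of F c "Q i"] Q by simp
      qed (simp add: coeff_eq_0)
      then have "[:F - cst c:] dvd q" by (simp add: const_poly_dvd_iff)
      then obtain q' where "q = [:F - cst c:] * q'" by (rule dvdE)
      then have q': "q = smult (F - cst c) q'" by simp
      have "coeff q' i \<in> Inv" for i
      proof (cases "coeff q' i = 0")
        case False
        then have "(F - cst c) * coeff q' i \<in> Inv" "(F - cst c) * coeff q' i \<noteq> 0"
          using q(1) F[of c] by (auto simp: q' dest: spec[of _ i])
        then show ?thesis using Inv_factor2 by blast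
      qed simp
      moreover have "(F - cst c) * (ev d' F * a) = (F - cst c) * poly q' h"
        using q(2) by (simp add: evd q' mult.assoc)
      then have "ev d' F * a = poly q' h" using F[of c] by simp
      ultimately have "ok d'" using \<open>d' \<noteq> 0\<close> by (auto simp: ok_def)
      then have "degree d \<le> degree d'" by (rule dmin)
      moreover have "degree d = Suc (degree d')" using \<open>d' \<noteq> 0\<close> unfolding d' by (subst degree_mult_eq) auto
      ultimately show False by simp
    qed
    then obtain u where u: "d = [:u:]" using degree0_coeffs by blast
    then have u0: "u \<noteq> 0" using d0 by simp
    have "a = cst (inverse u) * (cst u * a)" using cst_inverse[OF u0] by (simp flip: mult.assoc)
    also have "\<dots> = poly (smult (cst (inverse u)) q) h" using q(2) by (simp add: u)
    finally show ?thesis using q(1) cI by (intro exI[of _ "smult (cst (inverse u)) q"]) auto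
  qed
  define w where "w = inverse (lead_coeff P)"
  have w: "w \<noteq> 0" using P0 by (simp add: w_def)
  define h2 where "h2 = cst w * h"
  have hh2: "h = cst (lead_coeff P) * h2"
    using cst_inverse[of "lead_coeff P"] P0 by (simp add: h2_def w_def mult_ac flip: mult.assoc)
  have "lead_coeff (smult w P) = 1" using P0 by (simp add: w_def)
  moreover have "tdeg h2 = ?n"
    using tdeg_mult[of "cst w" h] w h \<open>h \<noteq> 0\<close> cI InvD(2) by (auto simp: h2_def)
  moreover have "D ?n h2 = ev (smult w P) F"
    unfolding h2_def using cI h by (simp add: D_Inv_mult ev_smult)
  moreover have "\<exists>q. (\<forall>i. coeff q i \<in> Inv) \<and> a = poly q h2" for a
  proof -
    obtain q where q: "\<forall>i. coeff q i \<in> Inv" "a = poly q h" using gen by blast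
    have "a = poly (pcompose q [:0, cst (lead_coeff P):]) h2"
      using q hh2 by (simp add: poly_pcompose mult.commute)
    moreover have "coeff (pcompose q [:0, cst (lead_coeff P):]) i \<in> Inv" for i
      using q(1)
    proof (induction q arbitrary: i rule: pCons_induct)
      case (pCons x q)
      have x: "x \<in> Inv" using pCons.prems by (auto dest: spec[of _ 0])
      have "\<forall>i. coeff q i \<in> Inv" using pCons.prems by (auto dest: spec[of _ "Suc _"])
      then have IH: "coeff (pcompose q [:0, cst (lead_coeff P):]) i \<in> Inv" for i using pCons.IH by blast
      show ?case using IH x cI by (cases i) (simp_all add: pcompose_pCons)
    qed simp
    ultimately show ?thesis by blast
  qed
  ultimately show ?thesis by blast
qed

section \<open>Descent from the algebraic closure\<close>

text \<open>Coordinates in a basis of the closure over k that contains 1, extended by 0 off the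
  basis. Hence \<open>lam 1\<close> is a k-linear retraction onto k.\<close>

lemma ac_coordinates:
  obtains lam :: "'a::field alg_closure \<Rightarrow> 'a alg_closure \<Rightarrow> 'a" where
    "\<And>b x y. lam b (x + y) = lam b x + lam b y"
    "\<And>b c x. lam b (to_ac c * x) = c * lam b x"
    "\<And>x. finite {b. lam b x \<noteq> 0}"
    "\<And>x. (\<Sum>b | lam b x \<noteq> 0. b * to_ac (lam b x)) = x"
    "lam 1 1 = 1"
proof -
  interpret vs: vector_space "\<lambda>c (x :: 'a alg_closure). to_ac c * x"
    by unfold_locales (simp_all add: algebra_simps)
  have ind: "vs.independent {1}" by (simp add: vs.dependent_single)
  define B where "B = vs.extend_basis {1}"
  have B: "vs.independent B" "\<And>x. x \<in> vs.span B" "1 \<in> B"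
    using vs.independent_extend_basis[OF ind] vs.span_extend_basis[OF ind] vs.extend_basis_superset[OF ind]
    by (auto simp: B_def)
  show ?thesis
  proof (rule that[of "\<lambda>b x. vs.representation B x b"])
    show "(\<Sum>b | vs.representation B x b \<noteq> 0. b * to_ac (vs.representation B x b)) = x" for x
      using vs.sum_nonzero_representation_eq[OF B(1,2), of x] by (simp add: mult.commute)
  qed (use B in \<open>simp_all add: vs.representation_add vs.representation_scale
      vs.finite_representation vs.representation_basis\<close>)
qed

section \<open>Coefficients of plane polynomials and extension of scalars\<close>

definition cf :: "'a::zero poly poly \<Rightarrow> nat \<times> nat \<Rightarrow> 'a" where
  "cf u x = coeff (coeff u (fst x)) (snd x)"

definition mono :: "nat \<times> nat \<Rightarrow> 'a::comm_ring_1 poly poly" where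
  "mono x = monom (monom 1 (snd x)) (fst x)"

lemma cf_eqI: "(\<And>x. cf u x = cf v x) \<Longrightarrow> u = v"
  unfolding cf_def by (intro poly_eqI) force

lemma cf_0 [simp]: "cf 0 x = 0" and cf_add: "cf (u + v) x = cf u x + cf v x"
  by (simp_all add: cf_def)

lemma cf_cst_mult: "cf (cst c * u) x = c * cf u x"
  by (simp add: cf_def cst_def)

lemma cf_sum: "cf (sum F I) x = (\<Sum>i\<in>I. cf (F i) x)"
  by (simp add: cf_def coeff_sum)

lemma cf_mono: "cf (mono x) y = (if x = y then 1 else 0)"
  by (auto simp: cf_def mono_def prod_eq_iff)

lemma finite_cf: "finite {x. cf (u :: 'a::zero poly poly) x \<noteq> 0}"
proof -
  have "{x. cf u x \<noteq> 0} \<subseteq> (SIGMA j:{..degree u}. {..degree (coeff u j)})"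
    by (auto simp: cf_def intro: le_degree)
  then show ?thesis by (rule finite_subset) auto
qed

lemma cf_expand:
  assumes "finite I" "{x. cf u x \<noteq> 0} \<subseteq> I"
  shows "u = (\<Sum>x\<in>I. cst (cf u x) * mono x)"
proof (rule cf_eqI)
  fix y
  have "cf (\<Sum>x\<in>I. cst (cf u x) * mono x) y = (\<Sum>x\<in>I. if x = y then cf u x else 0)"
    unfolding cf_sum cf_cst_mult cf_mono by (intro sum.cong) auto
  also have "\<dots> = cf u y" using assms by (auto simp: sum.delta)
  finally show "cf u y = cf (\<Sum>x\<in>I. cst (cf u x) * mono x) y" ..
qed

definition map2 :: "('a::zero \<Rightarrow> 'b::zero) \<Rightarrow> 'a poly poly \<Rightarrow> 'b poly poly" where
  "map2 h = map_poly (map_poly h)"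

lemma cf_map2: "h 0 = 0 \<Longrightarrow> cf (map2 h u) x = h (cf u x)"
  by (simp add: cf_def map2_def coeff_map_poly)

lemma map_poly_mult_hom:
  assumes "h 0 = 0" "\<And>x y. h (x + y) = h x + h y" "\<And>x y. h (x * y) = h x * h y"
  shows "map_poly h (p * q) = map_poly h p * map_poly h q"
proof (rule poly_eqI)
  fix n
  have "h (sum F I) = (\<Sum>i\<in>I. h (F i))" for F and I :: "nat set"
    by (induction I rule: infinite_finite_induct) (simp_all add: assms)
  then show "coeff (map_poly h (p * q)) n = coeff (map_poly h p * map_poly h q) n"
    by (simp add: coeff_map_poly coeff_mult assms)
qed

lemma map_poly_add_hom:
  assumes "h 0 = 0" "\<And>x y. h (x + y) = h x + h y"
  shows "map_poly h (p + q) = map_poly h p + map_poly h q"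
  by (rule poly_eqI) (simp add: coeff_map_poly assms)

abbreviation ac2 :: "'a::field poly poly \<Rightarrow> 'a alg_closure poly poly" where
  "ac2 \<equiv> map2 to_ac"

lemma ac2_0 [simp]: "ac2 0 = 0" by (simp add: map2_def)

lemma ac2_add: "ac2 (u + v) = ac2 u + ac2 v"
  by (rule cf_eqI) (simp add: cf_map2 cf_add)

lemma ac2_mult: "ac2 (u * v) = ac2 u * ac2 v"
  unfolding map2_def by (rule map_poly_mult_hom) (simp_all add: map_poly_mult_hom map_poly_add_hom)

lemma ac2_cst: "ac2 (cst c) = cst (to_ac c)"
  by (cases "c = 0") (simp_all add: map2_def cst_def map_poly_pCons)

lemma ac2_1 [simp]: "ac2 1 = 1" using ac2_cst[of 1] by simp

lemma ac2_sum: "ac2 (sum F I) = (\<Sum>i\<in>I. ac2 (F i))"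
  by (induction I rule: infinite_finite_induct) (simp_all add: ac2_add)

lemma ac2_mono: "ac2 (mono x) = mono x"
  by (rule cf_eqI) (simp add: cf_map2 cf_mono)

lemma ac2_inj: "ac2 u = ac2 v \<longleftrightarrow> u = v"
proof
  assume "ac2 u = ac2 v"
  then have "cf (ac2 u) x = cf (ac2 v) x" for x by simp
  then show "u = v" by (intro cf_eqI) (simp add: cf_map2)
qed simp

lemma ac2_ev: "ac2 (ev P a) = ev (map_poly to_ac P) (ac2 a)"
  by (induction P rule: pCons_induct) (simp_all add: ac2_add ac2_mult ac2_cst map_poly_pCons)

lemma ac2_induct [case_names zero add base]:
  assumes "Q 0" "\<And>u v. Q u \<Longrightarrow> Q v \<Longrightarrow> Q (u + v)" "\<And>c v. Q (cst c * ac2 v)"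
  shows "Q u"
proof -
  have "Q (\<Sum>x\<in>I. cst (F x) * mono x)" for F and I :: "(nat \<times> nat) set"
  proof (induction I rule: infinite_finite_induct)
    case (insert x I)
    then show ?case using assms(3)[of "F x" "mono x"] assms(2) by (simp add: ac2_mono)
  qed (use assms in auto)
  then show ?thesis using cf_expand[OF finite_cf order_refl, of u] by metis
qed

locale plane_exp = exp_map UNIV D for D :: "nat \<Rightarrow> 'a::field poly poly \<Rightarrow> 'a poly poly" +
  assumes cst_Inv: "cst c \<in> Inv"
begin

text \<open>Extension of scalars of \<open>D\<close>: prescribed on monomials, which have
  coefficients in k, and linear over the closure. \<open>DK_base\<close> frees it from this choice
  of basis.\<close>

definition DK :: "nat \<Rightarrow> 'a alg_closure poly poly \<Rightarrow> 'a alg_closure poly poly" where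
  "DK i u = (\<Sum>x | cf u x \<noteq> 0. cst (cf u x) * ac2 (D i (mono x)))"

lemma DK_superset:
  assumes "finite I" "{x. cf u x \<noteq> 0} \<subseteq> I"
  shows "DK i u = (\<Sum>x\<in>I. cst (cf u x) * ac2 (D i (mono x)))"
  unfolding DK_def using assms by (intro sum.mono_neutral_left) auto

lemma DK_add: "DK i (u + v) = DK i u + DK i v"
proof -
  let ?I = "{x. cf u x \<noteq> 0} \<union> {x. cf v x \<noteq> 0}"
  have I: "finite ?I" "{x. cf (u + v) x \<noteq> 0} \<subseteq> ?I" "{x. cf u x \<noteq> 0} \<subseteq> ?I" "{x. cf v x \<noteq> 0} \<subseteq> ?I"
    by (auto simp: cf_add finite_cf)
  show ?thesis
    unfolding DK_superset[OF I(1,2)] DK_superset[OF I(1,3)] DK_superset[OF I(1,4)]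
    by (simp add: cf_add cst_add algebra_simps sum.distrib)
qed

lemma DK_0 [simp]: "DK i 0 = 0" by (simp add: DK_def)

lemma DK_base: "DK i (cst c * ac2 v) = cst c * ac2 (D i v)"
proof -
  let ?I = "{x. cf v x \<noteq> 0}"
  have I: "finite ?I" "{x. cf (cst c * ac2 v) x \<noteq> 0} \<subseteq> ?I"
    by (auto simp: cf_cst_mult cf_map2 finite_cf)
  have "D i v = D i (\<Sum>x\<in>?I. cst (cf v x) * mono x)"
    using cf_expand[OF I(1) order_refl] by metis
  also have "\<dots> = (\<Sum>x\<in>?I. cst (cf v x) * D i (mono x))"
    by (simp add: D_sum D_Inv_mult cst_Inv)
  finally have "ac2 (D i v) = (\<Sum>x\<in>?I. cst (to_ac (cf v x)) * ac2 (D i (mono x)))"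
    by (simp add: ac2_sum ac2_mult ac2_cst)
  then show ?thesis
    unfolding DK_superset[OF I] by (simp add: cf_cst_mult cf_map2 cst_mult sum_distrib_left mult.assoc)
qed

lemma DK_ac2: "DK i (ac2 v) = ac2 (D i v)"
  using DK_base[of i 1 v] by simp

lemma exp_map_DK: "exp_map UNIV DK"
proof
  show "DK i (u + v) = DK i u + DK i v" for i u v by (rule DK_add)
  show "DK 0 u = u" for u
    by (induction u rule: ac2_induct) (simp_all add: DK_add DK_base)
  show "DK i (u * v) = (\<Sum>j\<le>i. DK j u * DK (i - j) v)" for i u v
  proof (induction u rule: ac2_induct)
    case (base c u)
    show ?case
    proof (induction v rule: ac2_induct)
      case (base d v)
      have "DK i (cst c * ac2 u * (cst d * ac2 v)) = DK i (cst (c * d) * ac2 (u * v))"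
        by (simp add: cst_mult ac2_mult mult_ac)
      also have "\<dots> = (\<Sum>j\<le>i. DK j (cst c * ac2 u) * DK (i - j) (cst d * ac2 v))"
        unfolding DK_base by (simp add: D_mult ac2_sum ac2_mult cst_mult sum_distrib_left mult_ac)
      finally show ?case .
    qed (simp_all add: DK_add sum.distrib algebra_simps)
  qed (simp_all add: DK_add sum.distrib algebra_simps)
  show "DK i (DK j u) = of_nat (i + j choose i) * DK (i + j) u" for i j u
  proof (induction u rule: ac2_induct)
    case (base c u)
    have "ac2 (of_nat k :: 'a poly poly) = of_nat k" for k
      by (induction k) (simp_all add: ac2_add)
    then show ?case by (simp add: DK_base D_D ac2_mult mult_ac)
  qed (simp_all add: DK_add algebra_simps)
  show "\<exists>N. \<forall>i>N. DK i u = 0" for u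
  proof (induction u rule: ac2_induct)
    case (add u v)
    then obtain N M where "\<forall>i>N. DK i u = 0" "\<forall>i>M. DK i v = 0" by blast
    then show ?case by (intro exI[of _ "max N M"]) (simp add: DK_add)
  next
    case (base c v)
    obtain N where "\<forall>i>N. D i v = 0" using D_finite[of v] by auto
    then show ?case by (intro exI[of _ N]) (simp add: DK_base)
  qed simp
qed simp_all

end

text \<open>Coefficientwise application of a k-linear functional is linear over k[z,t], whose
  elements have coefficients in k.\<close>

lemma map2_base:
  fixes l :: "'a alg_closure \<Rightarrow> 'a::field"
  assumes add: "\<And>x y. l (x + y) = l x + l y" and scale: "\<And>c x. l (to_ac c * x) = c * l x"
  shows "map2 l (cst c * ac2 v) = cst (l c) * v" "map2 l (u + w) = map2 l u + map2 l w" "map2 l 0 = 0"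
proof -
  have l0: "l 0 = 0" using scale[of 0 0] by simp
  have "l (x * to_ac c) = l x * c" for x c using scale[of c x] by (simp add: mult.commute)
  then show "map2 l (cst c * ac2 v) = cst (l c) * v"
    by (intro cf_eqI) (simp add: cf_map2 cf_cst_mult l0)
  show "map2 l (u + w) = map2 l u + map2 l w"
    by (intro cf_eqI) (simp add: cf_map2 l0 cf_add add)
qed (simp add: map2_def)

context plane_exp
begin

text \<open>The last step chooses \<open>s\<close> over \<open>k\<close> so that its leading coefficient is of minimal degree
  in \<open>f\<close>; a \<open>k\<close>-linear retraction of the algebraic closure onto \<open>k\<close> shows that this degree is
  the same as over the closure, so \<open>s\<close> still generates.\<close>

lemma variable_of_plane_exp:
  assumes Inv: "Inv = range (\<lambda>P. ev P f)" and f: "\<And>c. f \<noteq> cst c" and ntriv: "Inv \<noteq> UNIV"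
    and char: "CHAR('a) > 0"
  shows "\<exists>s. subalgebra2 f s = UNIV"
proof -
  interpret K: exp_map UNIV DK by (rule exp_map_DK)
  obtain lam :: "'a alg_closure \<Rightarrow> 'a alg_closure \<Rightarrow> 'a" where
    lam: "\<And>b x y. lam b (x + y) = lam b x + lam b y"
    "\<And>b c x. lam b (to_ac c * x) = c * lam b x"
    "\<And>x. finite {b. lam b x \<noteq> 0}"
    "\<And>x. (\<Sum>b | lam b x \<noteq> 0. b * to_ac (lam b x)) = x"
    "lam 1 1 = 1"
    by (rule ac_coordinates) blast
  note L = map2_base[of "lam b" for b, OF lam(1,2)]
  have lam0: "lam b 0 = 0" for b using lam(2)[of b 0 0] by simp
  have L_ac2: "map2 (lam 1) (ac2 v) = v" for v
  proof -
    have "map2 (lam 1) (cst 1 * ac2 v) = cst (lam 1 1) * v" by (rule L)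
    then show ?thesis by (simp add: lam)
  qed
  \<comment> \<open>Coordinate functionals commute with the extended map, so an element is invariant
    exactly when all its coordinates are.\<close>
  have L_D: "map2 (lam b) (DK i u) = D i (map2 (lam b) u)" for b i u
    by (induction u rule: ac2_induct) (simp_all add: L DK_add DK_base D_add D_Inv_mult cst_Inv)
  have L_ev: "map2 (lam b) (ev P (ac2 f)) = ev (map_poly (lam b) P) f" for b P
  proof -
    have "map2 (lam b) (ev P (ac2 f) * ac2 v) = ev (map_poly (lam b) P) f * v" for v
    proof (induction P arbitrary: v rule: pCons_induct)
      case (pCons c P)
      have "ev (pCons c P) (ac2 f) * ac2 v = cst c * ac2 v + ev P (ac2 f) * ac2 (f * v)"
        by (simp add: ac2_mult algebra_simps)
      then have "map2 (lam b) (ev (pCons c P) (ac2 f) * ac2 v)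
          = cst (lam b c) * v + ev (map_poly (lam b) P) f * (f * v)"
        by (simp only: L pCons.IH)
      also have "\<dots> = ev (map_poly (lam b) (pCons c P)) f * v"
        using pCons.hyps by (simp add: map_poly_pCons lam0 algebra_simps)
      finally show ?case .
    qed (simp add: L)
    from this[of 1] show ?thesis by simp
  qed
  have expand: "\<exists>I. finite I \<and> u = (\<Sum>b\<in>I. cst b * ac2 (map2 (lam b) u))" for u
  proof -
    let ?I = "\<Union>x\<in>{x. cf u x \<noteq> 0}. {b. lam b (cf u x) \<noteq> 0}"
    have fin: "finite ?I" using finite_cf lam(3) by auto
    have "cf (\<Sum>b\<in>?I. cst b * ac2 (map2 (lam b) u)) x = cf u x" for x
    proof -
      have "cf (\<Sum>b\<in>?I. cst b * ac2 (map2 (lam b) u)) x = (\<Sum>b\<in>?I. b * to_ac (lam b (cf u x)))"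
        by (simp add: cf_sum cf_cst_mult cf_map2 lam0)
      also have "\<dots> = (\<Sum>b | lam b (cf u x) \<noteq> 0. b * to_ac (lam b (cf u x)))"
      proof (rule sum.mono_neutral_right[OF fin])
        have "lam b (cf u x) \<noteq> 0 \<Longrightarrow> cf u x \<noteq> 0" for b by (cases "cf u x = 0") (simp_all add: lam0)
        then show "{b. lam b (cf u x) \<noteq> 0} \<subseteq> ?I" by blast
      qed auto
      finally show ?thesis using lam(4) by simp
    qed
    then have "u = (\<Sum>b\<in>?I. cst b * ac2 (map2 (lam b) u))" by (intro cf_eqI) simp
    then show ?thesis using fin by blast
  qed
  have KInv: "K.Inv = range (\<lambda>P. ev P (ac2 f))"
  proof (intro subset_antisym subsetI)
    fix u assume u: "u \<in> K.Inv"
    have "map2 (lam b) u \<in> Inv" for b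
      using K.InvD(3)[OF u] by (intro InvI) (simp_all add: L flip: L_D)
    then have "\<forall>b. \<exists>P. map2 (lam b) u = ev P f" using Inv by auto
    then obtain P where P: "\<And>b. map2 (lam b) u = ev (P b) f" by metis
    obtain I where "u = (\<Sum>b\<in>I. cst b * ac2 (map2 (lam b) u))" using expand by blast
    also have "\<dots> = ev (\<Sum>b\<in>I. smult b (map_poly to_ac (P b))) (ac2 f)"
      by (simp add: P ac2_ev ev_sum ev_smult)
    finally show "u \<in> range (\<lambda>P. ev P (ac2 f))" by blast
  next
    fix u assume "u \<in> range (\<lambda>P. ev P (ac2 f))"
    then obtain P where P: "u = ev P (ac2 f)" by blast
    have "f = ev [:0, 1:] f" by simp
    then have fI: "f \<in> Inv" using Inv by blast
    have "cst c \<in> K.Inv" for c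
      using DK_base[of _ c 1] InvD(3)[OF Inv_1] by (intro K.InvI) simp_all
    moreover have "ac2 f \<in> K.Inv" using InvD(3)[OF fI] by (intro K.InvI) (simp_all add: DK_ac2)
    ultimately show "u \<in> K.Inv" unfolding P
      by (induction P rule: pCons_induct) simp_all
  qed
  have acf: "ac2 f \<noteq> cst c" for c
  proof
    assume *: "ac2 f = cst c"
    have "f = map2 (lam 1) (cst c * ac2 1)" using L_ac2[of f] * by simp
    also have "\<dots> = cst (lam 1 c) * 1" by (rule L)
    also have "\<dots> = cst (lam 1 c)" by simp
    finally show False using f by blast
  qed
  have Kntriv: "K.Inv \<noteq> UNIV"
  proof
    assume *: "K.Inv = UNIV"
    have "v \<in> Inv" for v
    proof (rule InvI)
      show "D i v = 0" if "i > 0" for i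
        using K.InvD(3)[of "ac2 v" i] * that ac2_inj[of "D i v" 0] by (simp add: DK_ac2)
    qed simp
    then show False using ntriv by blast
  qed
  let ?n = "K.mdeg"
  have n: "?n > 0" using K.mdeg Kntriv by blast
  obtain h P where P: "lead_coeff P = 1" and h: "K.tdeg h = ?n" "DK ?n h = ev P (ac2 f)"
    and gen: "\<And>a. \<exists>q. (\<forall>i. coeff q i \<in> K.Inv) \<and> a = poly q h"
    using generator_over_alg_closed[OF exp_map_DK KInv acf Kntriv] char by auto
  define good where "good C \<longleftrightarrow> C \<noteq> 0 \<and> (\<exists>s. tdeg s \<le> ?n \<and> D ?n s = ev C f)" for C
  \<comment> \<open>The retraction fixes the leading coefficient 1 of P, so \<open>?C\<close> is a
    nonzero competitor of degree at most that of P.\<close>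
  let ?C = "map_poly (lam 1) P"
  have degC: "degree ?C \<le> degree P" by (rule degree_map_poly_le)
  have "coeff ?C (degree P) = 1" using P lam by (simp add: coeff_map_poly lam0)
  then have C0: "?C \<noteq> 0" by auto
  have "tdeg (map2 (lam 1) h) \<le> ?n"
    using K.D_above_tdeg[of h] h by (intro tdeg_leI) (simp_all flip: L_D add: L)
  moreover have "D ?n (map2 (lam 1) h) = ev ?C f" by (simp flip: L_D L_ev add: h)
  ultimately have goodC: "good ?C" using C0 good_def by blast
  then obtain C where "good C" and Cmin: "\<And>C'. good C' \<Longrightarrow> degree C \<le> degree C'"
    using ex_has_least_nat[of good _ degree] by blast
  then obtain s where s: "tdeg s \<le> ?n" "D ?n s = ev C f" and "C \<noteq> 0" unfolding good_def by blast
  have degCP: "degree C \<le> degree P" using Cmin[OF goodC] degC by linarith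
  let ?s = "ac2 s" and ?CK = "map_poly to_ac C"
  have CK: "?CK \<noteq> 0" "degree ?CK = degree C" using \<open>C \<noteq> 0\<close> by (auto simp: map_poly_eq_0_iff degree_map_poly)
  have Ds: "DK ?n ?s = ev ?CK (ac2 f)" by (simp add: DK_ac2 s ac2_ev)
  then have "DK ?n ?s \<noteq> 0" using ev_eq_0_imp[OF acf] CK(1) by metis
  moreover have "K.tdeg ?s \<le> ?n"
    using D_above_tdeg[of s] s by (intro K.tdeg_leI) (simp_all add: DK_ac2)
  ultimately have ts: "K.tdeg ?s = ?n" using K.tdeg_ge[of ?s] by (simp add: antisym)
  \<comment> \<open>Both s and h have degree \<open>K.mdeg\<close>, so s = q0 + q1 h with invariant
    q0 and q1. Comparing leading coefficients gives C = Q1 P; as the degree of C does not exceed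
    that of P, Q1 is a constant, and h is a polynomial in f and s over the closure.\<close>
  obtain Q where Q: "\<forall>i. coeff Q i \<in> K.Inv" "?s = poly Q h" using gen by blast
  have "Q \<noteq> 0" using Q ts n by auto
  then have "?n = ?n * degree Q" using K.tdeg_poly[of h Q] Q h n ts by simp
  then have dQ: "degree Q = 1" using n by simp
  obtain q0 Q' where Q': "Q = pCons q0 Q'" by (cases Q)
  then have "degree Q' = 0" using dQ by (auto split: if_splits)
  then obtain q1 where "Q' = [:q1:]" using degree0_coeffs by blast
  then have "Q = [:q0, q1:]" using Q' by simp
  then have sq: "?s = q0 + q1 * h" and q01: "q0 \<in> K.Inv" "q1 \<in> K.Inv"
    using Q by (auto simp: mult.commute dest: spec[of _ 0] spec[of _ 1])
  obtain Q0 Q1 where Q01: "q0 = ev Q0 (ac2 f)" "q1 = ev Q1 (ac2 f)" using q01 KInv by auto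
  have "DK ?n ?s = q1 * DK ?n h"
    unfolding sq using q01 n by (simp add: K.D_add K.D_Inv_mult K.InvD)
  then have "ev ?CK (ac2 f) = ev (Q1 * P) (ac2 f)" by (simp add: Ds h Q01 ev_mult)
  then have CQ: "?CK = Q1 * P" by (rule ev_inj[OF acf])
  then have "Q1 \<noteq> 0" "P \<noteq> 0" using CK by auto
  then have "degree C = degree Q1 + degree P" using CQ CK degree_mult_eq by metis
  then have "degree Q1 = 0" using degCP by simp
  then obtain u where u: "Q1 = [:u:]" using degree0_coeffs by blast
  then have u0: "u \<noteq> 0" using \<open>Q1 \<noteq> 0\<close> by simp
  have "cst u * h = ?s - ev Q0 (ac2 f)" using sq by (simp add: Q01 u)
  then have hs: "h = cst (inverse u) * (?s - ev Q0 (ac2 f))"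
    using cst_inverse[OF u0] by (metis mult.assoc mult.left_neutral)
  define W where "W = subalgebra2 f s"
  \<comment> \<open>The extension of scalars of W = k[f,s], described by coordinates. It contains h,
    hence every element coming from k[z,t], and the retraction \<open>lam 1\<close> leads back to
    W.\<close>
  define TT where "TT = {u. \<forall>b. map2 (lam b) u \<in> W}"
  have W: "1 \<in> W" "f \<in> W" "s \<in> W" "\<And>a b. a \<in> W \<Longrightarrow> b \<in> W \<Longrightarrow> a + b \<in> W"
    "\<And>a b. a \<in> W \<Longrightarrow> b \<in> W \<Longrightarrow> a * b \<in> W" "\<And>c. cst c \<in> W"
    unfolding W_def by (auto intro: subalgebra2_one subalgebra2_gens subalgebra2_add subalgebra2_mult subalgebra2_cst)
  have base: "cst c * ac2 v \<in> TT" if "v \<in> W" for c v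
    using that W by (simp add: TT_def L)
  have add: "u + v \<in> TT" if "u \<in> TT" "v \<in> TT" for u v
    using that W by (simp add: TT_def L)
  have zero: "0 \<in> TT" using W(6)[of 0] by (simp add: TT_def L)
  have TTsum: "sum F I \<in> TT" if "\<And>i. i \<in> I \<Longrightarrow> F i \<in> TT" for F and I :: "'a alg_closure set"
    using that by (induction I rule: infinite_finite_induct) (auto simp: zero add)
  have mult: "u * v \<in> TT" if u: "u \<in> TT" and v: "v \<in> TT" for u v
  proof -
    obtain I J where I: "u = (\<Sum>b\<in>I. cst b * ac2 (map2 (lam b) u))"
      and J: "v = (\<Sum>b\<in>J. cst b * ac2 (map2 (lam b) v))" using expand by meson
    have "u * v = (\<Sum>b\<in>I. \<Sum>c\<in>J. cst (b * c) * ac2 (map2 (lam b) u * map2 (lam c) v))"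
      by (subst I, subst J) (simp add: sum_product ac2_mult cst_mult mult_ac)
    also have "\<dots> \<in> TT" using u v by (intro TTsum base W) (auto simp: TT_def)
    finally show ?thesis .
  qed
  have TTcst: "cst c \<in> TT" for c using base[of 1 c] W by simp
  have TTev: "ev R (ac2 f) \<in> TT" for R
    using base[of f 1] W by (induction R rule: pCons_induct) (simp_all add: zero add mult TTcst)
  have "h = cst (inverse u) * (cst 1 * ?s + cst (- 1) * ev Q0 (ac2 f))"
    using hs by (simp add: cst_uminus)
  also have "\<dots> \<in> TT" using base[of s 1] W by (intro mult add TTcst TTev) simp_all
  finally have hTT: "h \<in> TT" .
  have "v \<in> W" for v
  proof -
    obtain q where q: "\<forall>i. coeff q i \<in> K.Inv" "ac2 v = poly q h" using gen by blast
    have "coeff q i \<in> TT" for i using q(1) TTev unfolding KInv by (metis rangeE)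
    then have "poly q h \<in> TT"
    proof (induction q rule: pCons_induct)
      case (pCons a q)
      have "a \<in> TT" using pCons.prems[of 0] by simp
      moreover have "coeff q i \<in> TT" for i using pCons.prems[of "Suc i"] by simp
      ultimately show ?case using pCons.IH hTT by (simp add: add mult)
    qed (simp add: zero)
    then have "map2 (lam 1) (ac2 v) \<in> W" using q by (simp add: TT_def)
    then show ?thesis by (simp add: L_ac2)
  qed
  then show ?thesis unfolding W_def by blast
qed

end

section \<open>The Asanuma ring as a graded ring of Laurent polynomials\<close>

type_synonym 'a laurent = "int \<Rightarrow>\<^sub>0 'a poly poly"

abbreviation sg :: "int \<Rightarrow> 'a::comm_ring_1 poly poly \<Rightarrow> 'a laurent" where
  "sg \<equiv> Poly_Mapping.single"

abbreviation lookup :: "'a::comm_ring_1 laurent \<Rightarrow> int \<Rightarrow> 'a poly poly" where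
  "lookup \<equiv> Poly_Mapping.lookup"

abbreviation keys :: "'a::comm_ring_1 laurent \<Rightarrow> int set" where
  "keys \<equiv> Poly_Mapping.keys"

lemma lookup_sg: "lookup (sg i c) j = (if i = j then c else 0)"
  by (simp add: lookup_single when_def)

lemma laurent_expand:
  assumes "finite I" "keys a \<subseteq> I"
  shows "(a :: 'a::field laurent) = (\<Sum>e\<in>I. sg e (lookup a e))"
proof (rule poly_mapping_eqI)
  fix e
  have "lookup (\<Sum>e\<in>I. sg e (lookup a e)) e = (\<Sum>i\<in>I. if i = e then lookup a e else 0)"
    unfolding lookup_sum lookup_sg by (intro sum.cong) auto
  also have "\<dots> = lookup a e" using assms by (auto simp: in_keys_iff)
  finally show "lookup a e = lookup (\<Sum>e\<in>I. sg e (lookup a e)) e" ..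
qed

lemma lookup_sg_mult: "lookup (sg i c * b) e = c * lookup b (e - i)" for b :: "'a::field laurent"
proof -
  have "sg i c * b = sg i c * (\<Sum>j\<in>keys b. sg j (lookup b j))"
    using laurent_expand[of "keys b" b] by simp
  also have "\<dots> = (\<Sum>j\<in>keys b. sg (i + j) (c * lookup b j))"
    by (simp add: sum_distrib_left mult_single)
  also have "lookup \<dots> e = (\<Sum>j\<in>keys b. if j = e - i then c * lookup b (e - i) else 0)"
    unfolding lookup_sum lookup_sg by (intro sum.cong) auto
  also have "\<dots> = c * lookup b (e - i)" by (auto simp: in_keys_iff)
  finally show ?thesis .
qed

lemma laurent_mult_expand:
  "a * b = (\<Sum>i\<in>keys a. \<Sum>j\<in>keys b. sg (i + j) (lookup a i * lookup b j))" for a b :: "'a::field laurent"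
proof -
  have "a * b = (\<Sum>i\<in>keys a. sg i (lookup a i)) * (\<Sum>j\<in>keys b. sg j (lookup b j))"
    using laurent_expand[of "keys a" a] laurent_expand[of "keys b" b] by simp
  then show ?thesis by (simp add: sum_product mult_single)
qed

lemma sg_power: "sg i c ^ n = sg (int n * i) (c ^ n)"
  by (induction n) (simp_all add: mult_single algebra_simps)

abbreviation emb :: "'a::field poly poly \<Rightarrow> 'a laurent" where "emb \<equiv> sg 0"

lemma emb_mult: "emb (a * b) = emb a * emb b" by (simp add: mult_single)

lemma emb_add: "emb (a + b) = emb a + emb b" by (simp add: single_add)

lemma emb_uminus: "emb (- a) = - emb a" by (simp add: single_uminus)

lemma emb_power: "emb (a ^ n) = emb a ^ n" by (simp add: sg_power)

lemma emb_eq_iff [simp]: "emb a = emb b \<longleftrightarrow> a = b"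
  by (metis lookup_single_eq)

text \<open>Specialisation at x = 1; \<open>tot_add\<close> and \<open>tot_mult\<close> make it a
  ring homomorphism.\<close>

definition tot :: "'a::field laurent \<Rightarrow> 'a poly poly" where
  "tot a = (\<Sum>e\<in>keys a. lookup a e)"

lemma tot_superset: "finite I \<Longrightarrow> keys a \<subseteq> I \<Longrightarrow> tot a = (\<Sum>e\<in>I. lookup a e)"
  unfolding tot_def by (intro sum.mono_neutral_left) (auto simp: in_keys_iff)

lemma tot_sg [simp]: "tot (sg e c) = c"
  using tot_superset[of "{e}" "sg e c"] by (simp add: lookup_sg)

lemma tot_add: "tot (a + b) = tot a + tot b"
proof -
  let ?I = "keys a \<union> keys b"
  have "tot (a + b) = (\<Sum>e\<in>?I. lookup (a + b) e)"
    by (rule tot_superset) (auto simp: Poly_Mapping.keys_add)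
  then show ?thesis by (simp add: lookup_add sum.distrib tot_superset[of ?I a] tot_superset[of ?I b])
qed

lemma tot_0 [simp]: "tot 0 = 0" by (simp add: tot_def)

lemma tot_sum: "tot (sum F I) = (\<Sum>i\<in>I. tot (F i))"
  by (induction I rule: infinite_finite_induct) (simp_all add: tot_add)

lemma tot_mult: "tot (a * b) = tot a * tot b"
  unfolding laurent_mult_expand[of a b] tot_sum tot_sg
  by (simp only: tot_def sum_product)

lemma laurent_char: "CHAR('a::field laurent) = CHAR('a)"
proof (rule CHAR_eqI)
  have *: "(of_nat n :: 'a laurent) = emb (of_nat n)" for n
    by (induction n) (simp_all add: emb_add)
  show "of_nat CHAR('a) = (0 :: 'a laurent)" by (simp add: * of_nat_poly)
  fix n assume "of_nat n = (0 :: 'a laurent)"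
  then have "(of_nat n :: 'a poly poly) = 0" unfolding * by (metis emb_eq_iff single_zero)
  then have "CHAR('a poly poly) dvd n" by (simp only: of_nat_eq_0_iff_char_dvd)
  then show "CHAR('a) dvd n" by simp
qed

locale asanuma = line +
  fixes m :: nat
  assumes m_ge_2: "m \<ge> 2"
begin

text \<open>The order -e of the pole divided by m and rounded up; \<open>nat\<close> makes it 0 for
  e \<ge> 0.\<close>

definition pole :: "int \<Rightarrow> nat" where "pole e = nat (- (e div int m))"

text \<open>The image of \<open>k[x,y,z,t]/(x^m y + f)\<close> in \<open>k[z,t][x,1/x]\<close>: since \<open>y = - f / x^m\<close>, a pole of
  order \<open>e > 0\<close> needs a coefficient divisible by \<open>f\<close> to the power \<open>e / m\<close>, rounded up.\<close>

definition A :: "'a laurent set" where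
  "A = {a. \<forall>e. f ^ pole e dvd lookup a e}"

definition x :: "'a laurent" where "x = sg 1 1"
definition y :: "'a laurent" where "y = sg (- int m) (- f)"

lemma pole_add: "pole (i + j) \<le> pole i + pole j"
proof -
  have "i div int m + j div int m \<le> (i + j) div int m"
    unfolding div_add1_eq[of i j] using m_ge_2 pos_imp_zdiv_nonneg_iff[of "int m" "i mod int m + j mod int m"]
    by simp
  then show ?thesis unfolding pole_def by linarith
qed

lemma pole_nonneg [simp]: "e \<ge> 0 \<Longrightarrow> pole e = 0"
  using m_ge_2 by (simp add: pole_def pos_imp_zdiv_nonneg_iff[of "int m"])

lemma pole_multiple: "pole (- (int m * int l)) = l"
  using m_ge_2 by (simp add: pole_def div_minus_right flip: mult_minus_right)

lemma sg_in_A: "sg e c \<in> A \<longleftrightarrow> f ^ pole e dvd c"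
  by (auto simp: A_def lookup_sg)

lemma A_add: "a \<in> A \<Longrightarrow> b \<in> A \<Longrightarrow> a + b \<in> A"
  by (simp add: A_def lookup_add)

lemma A_uminus: "a \<in> A \<Longrightarrow> - a \<in> A"
  by (simp add: A_def)

lemma A_0: "0 \<in> A" by (simp add: A_def)

lemma A_sum: "(\<And>i. i \<in> I \<Longrightarrow> F i \<in> A) \<Longrightarrow> sum F I \<in> A"
  by (induction I rule: infinite_finite_induct) (simp_all add: A_0 A_add)

lemma A_comp: "a \<in> A \<Longrightarrow> sg e (lookup a e) \<in> A"
  by (simp add: A_def lookup_sg)

lemma A_mult:
  assumes "a \<in> A" "b \<in> A"
  shows "a * b \<in> A"
proof -
  show ?thesis
    unfolding laurent_mult_expand[of a b]
  proof (intro A_sum)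
    fix i j
    have "f ^ pole i * f ^ pole j dvd lookup a i * lookup b j"
      using assms by (intro mult_dvd_mono) (simp_all add: A_def)
    then have "f ^ (pole i + pole j) dvd lookup a i * lookup b j" by (simp only: power_add)
    then show "sg (i + j) (lookup a i * lookup b j) \<in> A"
      unfolding sg_in_A by (rule dvd_trans[OF le_imp_power_dvd[OF pole_add]])
  qed
qed

lemma emb_in_A [simp]: "emb c \<in> A" by (simp add: sg_in_A)

lemma A_1: "1 \<in> A" using emb_in_A[of 1] by simp

lemma x_in_A [simp]: "x \<in> A" by (simp add: sg_in_A x_def)

lemma y_in_A [simp]: "y \<in> A" using pole_multiple[of 1] by (simp add: sg_in_A y_def)

lemma A_induct [consumes 1, case_names zero add hom]:
  assumes "a \<in> A" "Q 0" "\<And>a b. a \<in> A \<Longrightarrow> b \<in> A \<Longrightarrow> Q a \<Longrightarrow> Q b \<Longrightarrow> Q (a + b)"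
    "\<And>e c. sg e c \<in> A \<Longrightarrow> Q (sg e c)"
  shows "Q a"
proof -
  have "Q (\<Sum>e\<in>I. sg e (lookup a e))" for I
    using assms by (induction I rule: infinite_finite_induct) (simp_all add: A_sum A_comp)
  from this[of "keys a"] show ?thesis by (simp flip: laurent_expand)
qed

lemma y_power: "y ^ l = sg (- (int m * int l)) ((- f) ^ l)"
  by (simp add: y_def sg_power mult.commute)

text \<open>Euclidean division of e by m: the required power f^l turns into y^l, up to sign, and the
  remainder into x^r. The last clause is what exhibits \<open>y\<close> as a factor of an element
  with a pole.\<close>

lemma sg_decomp:
  assumes "sg e c \<in> A"
  obtains r l c' where "sg e c = x ^ r * y ^ l * emb c'" "e = int r - int m * int l"
    "e < 0 \<Longrightarrow> l > 0"
proof (cases "e \<ge> 0")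
  case True
  then show ?thesis using that[of "nat e" 0 c] by (simp add: x_def sg_power mult_single)
next
  case False
  define l where "l = pole e"
  define r where "r = nat (e mod int m)"
  have m: "int m > 0" using m_ge_2 by simp
  have "e div int m < 0" using False m by (simp add: pos_imp_zdiv_neg_iff[of "int m"])
  then have l: "l > 0" "int l = - (e div int m)" by (simp_all add: l_def pole_def)
  have r: "int r = e mod int m" using m by (simp add: r_def)
  have e: "e = int r - int m * int l" using l r by (simp add: minus_mod_eq_mult_div [symmetric])
  obtain c0 where c0: "c = f ^ l * c0" using assms by (auto simp: sg_in_A l_def)
  have "(- f) ^ l * (- 1) ^ l = f ^ l" by (simp flip: power_mult_distrib)
  then have "(- f) ^ l * ((- 1) ^ l * c0) = c" by (simp only: c0 mult.assoc[symmetric])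
  then have "x ^ r * y ^ l * emb ((- 1) ^ l * c0) = sg (int r - int m * int l) c"
    by (simp add: x_def sg_power y_power mult_single mult.assoc)
  then have "sg e c = x ^ r * y ^ l * emb ((- 1) ^ l * c0)" by (simp add: e)
  then show ?thesis using that l e by blast
qed

lemma x_power_y: "x ^ m * y = - emb f"
  by (simp add: x_def y_def sg_power mult_single single_uminus)

lemma x_neq_0: "x \<noteq> 0" and y_neq_0: "y \<noteq> 0"
  by (auto simp: x_def y_def poly_mapping_eq_iff fun_eq_iff lookup_sg)

text \<open>Filtration by order in x. The index is real because the slope of an exponential map is
  only a quotient of integers.\<close>

definition Fil :: "real \<Rightarrow> 'a laurent set" where
  "Fil r = {a. \<forall>e. lookup a e \<noteq> 0 \<longrightarrow> r \<le> of_int e}"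

definition Fil' :: "real \<Rightarrow> 'a laurent set" where
  "Fil' r = {a. \<forall>e. lookup a e \<noteq> 0 \<longrightarrow> r < of_int e}"

lemma Fil_0 [simp]: "0 \<in> Fil r" and Fil'_0 [simp]: "0 \<in> Fil' r"
  by (simp_all add: Fil_def Fil'_def)

lemma Fil_add: "a \<in> Fil r \<Longrightarrow> b \<in> Fil r \<Longrightarrow> a + b \<in> Fil r"
  unfolding Fil_def mem_Collect_eq lookup_add by (metis add.right_neutral)

lemma Fil'_add: "a \<in> Fil' r \<Longrightarrow> b \<in> Fil' r \<Longrightarrow> a + b \<in> Fil' r"
  unfolding Fil'_def mem_Collect_eq lookup_add by (metis add.right_neutral)

lemma Fil_sum: "(\<And>i. i \<in> I \<Longrightarrow> F i \<in> Fil r) \<Longrightarrow> sum F I \<in> Fil r"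
  by (induction I rule: infinite_finite_induct) (simp_all add: Fil_add)

lemma Fil'_sum: "(\<And>i. i \<in> I \<Longrightarrow> F i \<in> Fil' r) \<Longrightarrow> sum F I \<in> Fil' r"
  by (induction I rule: infinite_finite_induct) (simp_all add: Fil'_add)

lemma Fil_Fil': "a \<in> Fil r \<Longrightarrow> s < r \<Longrightarrow> a \<in> Fil' s"
  by (fastforce simp: Fil_def Fil'_def)

lemma Fil_sg: "sg e c \<in> Fil (of_int e)"
  by (simp add: Fil_def lookup_sg)

text \<open>Degrees shifted along a rational slope may fail to be integers; the component there is
  taken to be 0.\<close>

definition hc :: "real \<Rightarrow> 'a laurent \<Rightarrow> 'a laurent" where
  "hc r a = sg \<lfloor>r\<rfloor> (if of_int \<lfloor>r\<rfloor> = r then lookup a \<lfloor>r\<rfloor> else 0)"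

lemma lookup_hc: "lookup (hc r a) e = (if of_int e = r then lookup a e else 0)"
  by (auto simp: hc_def lookup_sg)

lemma hc_add: "hc r (a + b) = hc r a + hc r b"
  by (rule poly_mapping_eqI) (simp add: lookup_hc lookup_add)

lemma hc_0 [simp]: "hc r 0 = 0" by (simp add: hc_def)

lemma hc_sum: "hc r (sum F I) = (\<Sum>i\<in>I. hc r (F i))"
  by (induction I rule: infinite_finite_induct) (simp_all add: hc_add)

lemma hc_of_nat_mult: "hc r (of_nat n * a) = of_nat n * hc r a"
  by (induction n) (simp_all add: algebra_simps hc_add)

lemma hc_in_A: "a \<in> A \<Longrightarrow> hc r a \<in> A"
  by (simp add: hc_def A_comp A_0)

lemma hc_Fil': "a \<in> Fil' r \<Longrightarrow> hc r a = 0"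
  by (rule poly_mapping_eqI) (fastforce simp: lookup_hc Fil'_def)

lemma Fil_minus_hc: "a \<in> Fil r \<Longrightarrow> a - hc r a \<in> Fil' r"
  by (auto simp: Fil_def Fil'_def lookup_minus lookup_hc order_less_le split: if_splits)

lemma hc_of_int: "hc (of_int i) a = sg i (lookup a i)"
  by (simp add: hc_def)

lemma hc_sg: "hc (of_int e) (sg e c) = sg e c"
  by (simp add: hc_def)

lemma Fil_mult:
  assumes "a \<in> Fil r" "b \<in> Fil s"
  shows "a * b \<in> Fil (r + s)" "hc (r + s) (a * b) = hc r a * hc s b"
proof -
  note exp = laurent_mult_expand
  have ge: "r \<le> of_int i" "s \<le> of_int j" if "i \<in> keys a" "j \<in> keys b" for i j
    using assms that by (auto simp: Fil_def in_keys_iff)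
  have Fil': "c * d \<in> Fil' (r' + s')" if "c \<in> Fil' r'" "d \<in> Fil s'" for c d r' s'
    unfolding exp[of c d]
  proof (intro Fil'_sum)
    fix i j assume "i \<in> keys c" "j \<in> keys d"
    then have "r' < of_int i" "s' \<le> of_int j" using that by (auto simp: Fil_def Fil'_def in_keys_iff)
    then show "sg (i + j) (lookup c i * lookup d j) \<in> Fil' (r' + s')"
      by (intro Fil_Fil'[OF Fil_sg]) simp
  qed
  show "a * b \<in> Fil (r + s)"
    unfolding exp[of a b]
  proof (intro Fil_sum)
    fix i j assume "i \<in> keys a" "j \<in> keys b"
    then have "r + s \<le> of_int (i + j)" using ge[of i j] by simp
    then show "sg (i + j) (lookup a i * lookup b j) \<in> Fil (r + s)" by (auto simp: Fil_def lookup_sg)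
  qed
  have hb: "hc s b \<in> Fil s" by (auto simp: Fil_def lookup_hc)
  have hr: "hc r a \<in> Fil r" by (auto simp: Fil_def lookup_hc)
  have eq: "a * b = (a - hc r a) * b + (b - hc s b) * hc r a + hc r a * hc s b"
    by (simp add: algebra_simps)
  have "(a - hc r a) * b \<in> Fil' (r + s)" using Fil'[OF Fil_minus_hc] assms by blast
  then have 1: "hc (r + s) ((a - hc r a) * b) = 0" by (rule hc_Fil')
  have "(b - hc s b) * hc r a \<in> Fil' (s + r)" using Fil'[OF Fil_minus_hc] assms hr by blast
  then have "(b - hc s b) * hc r a \<in> Fil' (r + s)" by (subst add.commute)
  then have 2: "hc (r + s) ((b - hc s b) * hc r a) = 0" by (rule hc_Fil')
  have 3: "hc (r + s) (hc r a * hc s b) = hc r a * hc s b"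
  proof (cases "of_int \<lfloor>r\<rfloor> = r \<and> of_int \<lfloor>s\<rfloor> = s")
    case True
    then obtain i j where ij: "r = of_int i" "s = of_int j" by metis
    show ?thesis unfolding ij of_int_add[symmetric] hc_of_int mult_single by (simp add: lookup_sg)
  next
    case False
    then have "hc r a = 0 \<or> hc s b = 0" unfolding hc_def by (metis single_zero)
    then show ?thesis by (metis hc_0 mult_zero_left mult_zero_right)
  qed
  have "hc (r + s) (a * b) = hc (r + s) ((a - hc r a) * b) + hc (r + s) ((b - hc s b) * hc r a)
      + hc (r + s) (hc r a * hc s b)"
    by (subst eq) (simp only: hc_add)
  then show "hc (r + s) (a * b) = hc r a * hc s b" by (simp only: 1 2 3 add_0)
qed

end

section \<open>Passing to the associated graded exponential map\<close>

context asanuma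
begin

text \<open>Homogeneity of the exponential map when T is given the weight \<rho>.\<close>

definition homogeneous_exp :: "(nat \<Rightarrow> 'a laurent \<Rightarrow> 'a laurent) \<Rightarrow> bool" where
  "homogeneous_exp G \<longleftrightarrow> (\<exists>\<rho>::real. \<forall>i e c e'. sg e c \<in> A \<longrightarrow>
     lookup (G i (sg e c)) e' \<noteq> 0 \<longrightarrow> of_int e' = of_int e - of_nat i * \<rho>)"

lemma emb_induct:
  assumes "\<And>p c. Q (emb p) \<Longrightarrow> Q (emb c) \<Longrightarrow> Q (emb (p + c))"
    "\<And>p c. Q (emb p) \<Longrightarrow> Q (emb c) \<Longrightarrow> Q (emb (p * c))"
    "\<And>k. Q (emb (cst k))" "Q (emb [:0, 1:])" "Q (emb [:[:0, 1:]:])"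
  shows "Q (emb c)"
proof -
  have inner: "Q (emb [:p:])" for p
  proof (induction p rule: pCons_induct)
    case 0
    then show ?case using assms(3)[of 0] by simp
  next
    case (pCons a p)
    have "Q (emb (cst a + [:[:0, 1:]:] * [:p:]))" using assms pCons.IH by blast
    then show ?case by (simp add: cst_def)
  qed
  show ?thesis
  proof (induction c rule: pCons_induct)
    case 0
    then show ?case using assms(3)[of 0] by simp
  next
    case (pCons p c)
    have "Q (emb ([:p:] + [:0, 1:] * c))" using assms inner pCons.IH by blast
    then show ?case by simp
  qed
qed

text \<open>The degree is passed to \<open>Q\<close> separately because the zero element has no
  degree of its own.\<close>

lemma sg_induct:
  assumes "sg e c \<in> A"
    and "\<And>p c. Q 0 (emb p) \<Longrightarrow> Q 0 (emb c) \<Longrightarrow> Q 0 (emb (p + c))"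
    "\<And>d d' e e'. sg d e \<in> A \<Longrightarrow> sg d' e' \<in> A \<Longrightarrow> Q d (sg d e) \<Longrightarrow> Q d' (sg d' e') \<Longrightarrow> Q (d + d') (sg d e * sg d' e')"
    "\<And>k. Q 0 (emb (cst k))" "Q 0 (emb [:0, 1:])" "Q 0 (emb [:[:0, 1:]:])" "Q 1 x" "Q (- int m) y"
  shows "Q e (sg e c)"
proof -
  have mult: "Q 0 (emb (p * c))" if "Q 0 (emb p)" "Q 0 (emb c)" for p c
    using assms(3)[of 0 p 0 c] that by (simp add: emb_mult)
  have emb: "Q 0 (emb c)" for c
    by (rule emb_induct[of "Q 0"]) (use assms mult in auto)
  have xp: "Q (int r) (x ^ r)" for r
  proof (induction r)
    case 0
    then show ?case using emb[of 1] by simp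
  next
    case (Suc r)
    have xr: "x ^ r = sg (int r) 1" by (simp add: x_def sg_power)
    show ?case using assms(3)[of 1 1 "int r" 1] assms(7) Suc by (simp add: xr sg_in_A) (simp add: x_def)
  qed
  have yp: "Q (- (int m * int l)) (y ^ l)" for l
  proof (induction l)
    case 0
    then show ?case using emb[of 1] by simp
  next
    case (Suc l)
    have "y ^ l \<in> A" by (induction l) (simp_all add: A_1 A_mult)
    then show ?case using assms(3)[of "- int m" "- f" "- (int m * int l)" "(- f) ^ l"] assms(8) Suc y_in_A[unfolded y_def]
      by (simp add: y_power) (simp add: y_def algebra_simps)
  qed
  obtain r l c' where d: "sg e c = x ^ r * y ^ l * emb c'" "e = int r - int m * int l"
    using sg_decomp[OF assms(1)] by metis
  have yl: "y ^ l \<in> A" "x ^ r \<in> A" by (induction l) (induction r, simp_all add: A_1 A_mult)+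
  have xr: "x ^ r = sg (int r) 1" by (simp add: x_def sg_power)
  have "Q (int r + - (int m * int l)) (x ^ r * y ^ l)"
    using assms(3)[of "int r" 1 "- (int m * int l)" "(- f) ^ l"] xp[of r] yp[of l] yl
    by (simp add: xr y_power)
  moreover have xy: "x ^ r * y ^ l = sg (int r + - (int m * int l)) ((- f) ^ l)"
    by (simp add: xr y_power mult_single)
  moreover have "x ^ r * y ^ l \<in> A" using yl A_mult by blast
  ultimately have "Q (int r + - (int m * int l) + 0) (x ^ r * y ^ l * emb c')"
    using assms(3)[of "int r + - (int m * int l)" "(- f) ^ l" 0 c'] emb[of c'] by simp
  then show ?thesis using d by simp
qed

end

locale asanuma_exp = asanuma + exp_map A D for D +
  assumes emb_cst_Inv: "emb (cst c) \<in> Inv"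
begin

text \<open>Lower bounds on orders add up under the product rule for \<open>D\<close>, so they need
  only be known on the generators x, y, z and t.\<close>

lemma D_filtered:
  assumes gens: "\<And>r e i. (r, e) \<in> {(x, 1), (y, - int m), (emb [:0, 1:], 0), (emb [:[:0, 1:]:], 0)} \<Longrightarrow>
      D i r \<in> Fil (of_int e - of_nat i * \<rho>)"
    and "sg e c \<in> A"
  shows "D i (sg e c) \<in> Fil (of_int e - of_nat i * \<rho>)"
proof -
  define Q where "Q e a \<longleftrightarrow> (\<forall>i. D i a \<in> Fil (of_int e - of_nat i * \<rho>))" for e :: int and a
  have "Q e (sg e c)"
  proof (rule sg_induct[OF assms(2)])
    show "Q 0 (emb (p + c))" if "Q 0 (emb p)" "Q 0 (emb c)" for p c
      using that by (simp add: Q_def emb_add D_add Fil_add)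
    show "Q (d + d') (sg d e * sg d' e')"
      if "sg d e \<in> A" "sg d' e' \<in> A" "Q d (sg d e)" "Q d' (sg d' e')" for d d' e e'
      unfolding Q_def
    proof
      fix i
      show "D i (sg d e * sg d' e') \<in> Fil (of_int (d + d') - of_nat i * \<rho>)"
        unfolding D_mult[OF that(1,2)]
      proof (rule Fil_sum)
        fix j assume j: "j \<in> {..i}"
        have "D j (sg d e) * D (i - j) (sg d' e')
          \<in> Fil ((of_int d - of_nat j * \<rho>) + (of_int d' - of_nat (i - j) * \<rho>))"
          using that by (intro Fil_mult) (auto simp: Q_def)
        also have "(of_int d - of_nat j * \<rho>) + (of_int d' - of_nat (i - j) * \<rho>)
            = of_int (d + d') - of_nat i * \<rho>"
          using j by (simp add: of_nat_diff algebra_simps)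
        finally show "D j (sg d e) * D (i - j) (sg d' e') \<in> Fil (of_int (d + d') - of_nat i * \<rho>)" .
      qed
    qed
    show "Q 0 (emb (cst k))" for k
      unfolding Q_def
    proof
      fix i
      show "D i (emb (cst k)) \<in> Fil (of_int 0 - of_nat i * \<rho>)"
        using InvD(3)[OF emb_cst_Inv[of k], of i] Fil_sg[of 0 "cst k"] by (cases "i = 0") auto
    qed
    show "Q 0 (emb [:0, 1:])" "Q 0 (emb [:[:0, 1:]:])" "Q 1 x" "Q (- int m) y"
      unfolding Q_def by (blast intro: gens)+
  qed
  then show ?thesis by (simp add: Q_def)
qed

text \<open>The associated graded map of \<open>D\<close> for the filtration \<open>Fil\<close>,
  with T of weight \<rho>.\<close>

definition grD :: "real \<Rightarrow> nat \<Rightarrow> 'a laurent \<Rightarrow> 'a laurent" where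
  "grD \<rho> i a = (\<Sum>e\<in>keys a. hc (of_int e - of_nat i * \<rho>) (D i (sg e (lookup a e))))"

lemma grD_superset:
  assumes "finite I" "keys a \<subseteq> I"
  shows "grD \<rho> i a = (\<Sum>e\<in>I. hc (of_int e - of_nat i * \<rho>) (D i (sg e (lookup a e))))"
  unfolding grD_def using assms by (intro sum.mono_neutral_left) (auto simp: in_keys_iff)

lemma grD_sg: "grD \<rho> i (sg e c) = hc (of_int e - of_nat i * \<rho>) (D i (sg e c))"
  by (subst grD_superset[of "{e}"]) (auto simp: lookup_sg)

lemma grD_0 [simp]: "grD \<rho> i 0 = 0" by (simp add: grD_def)

lemma grD_add:
  assumes "a \<in> A" "b \<in> A"
  shows "grD \<rho> i (a + b) = grD \<rho> i a + grD \<rho> i b"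
proof -
  let ?I = "keys a \<union> keys b"
  have I: "finite ?I" "keys (a + b) \<subseteq> ?I" "keys a \<subseteq> ?I" "keys b \<subseteq> ?I"
    using Poly_Mapping.keys_add[of a b] by auto
  show ?thesis
    unfolding grD_superset[OF I(1,2)] grD_superset[OF I(1,3)] grD_superset[OF I(1,4)]
    using assms by (simp add: lookup_add single_add D_add A_comp hc_add sum.distrib)
qed

lemma grD_hc: "grD \<rho> i (hc r a) = hc (r - of_nat i * \<rho>) (D i (hc r a))"
proof (cases "of_int \<lfloor>r\<rfloor> = r")
  case True
  then obtain j where "r = of_int j" by metis
  then show ?thesis by (simp add: hc_of_int grD_sg)
next
  case False
  then have "hc r a = 0" unfolding hc_def by simp
  then show ?thesis by simp
qed

text \<open>Terms of order above r stay above order r - i \<rho>; this is why leading parts depend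
  only on leading components.\<close>

lemma hc_D_Fil':
  assumes fil: "\<And>i e c. sg e c \<in> A \<Longrightarrow> D i (sg e c) \<in> Fil (of_int e - of_nat i * \<rho>)"
    and "a \<in> A" "a \<in> Fil' r"
  shows "hc (r - of_nat i * \<rho>) (D i a) = 0"
proof (rule hc_Fil')
  have "D i a = D i (\<Sum>e\<in>keys a. sg e (lookup a e))" using laurent_expand[of "keys a" a] by simp
  also have "\<dots> = (\<Sum>e\<in>keys a. D i (sg e (lookup a e)))" using assms by (simp add: D_sum A_comp)
  also have "\<dots> \<in> Fil' (r - of_nat i * \<rho>)"
  proof (rule Fil'_sum)
    fix e assume "e \<in> keys a"
    then have "r < of_int e" using assms(3) by (auto simp: Fil'_def in_keys_iff)
    then show "D i (sg e (lookup a e)) \<in> Fil' (r - of_nat i * \<rho>)"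
      by (intro Fil_Fil'[OF fil] A_comp assms) simp
  qed
  finally show "D i a \<in> Fil' (r - of_nat i * \<rho>)" .
qed

lemma exp_map_grD:
  assumes fil: "\<And>i e c. sg e c \<in> A \<Longrightarrow> D i (sg e c) \<in> Fil (of_int e - of_nat i * \<rho>)"
  shows "exp_map A (grD \<rho>)"
proof
  show "grD \<rho> i a \<in> A" if "a \<in> A" for i a
    unfolding grD_def using that by (intro A_sum hc_in_A D_in A_comp)
  show "grD \<rho> i (a + b) = grD \<rho> i a + grD \<rho> i b" if "a \<in> A" "b \<in> A" for i a b
    using that by (rule grD_add)
  show "grD \<rho> i (a * b) = (\<Sum>j\<le>i. grD \<rho> j a * grD \<rho> (i - j) b)" if "a \<in> A" "b \<in> A" for i a b
    using that(1)
  proof (induction a rule: A_induct)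
    case (hom e c)
    show ?case using that(2)
    proof (induction b rule: A_induct)
      case hom': (hom e' c')
      have "grD \<rho> i (sg e c * sg e' c')
          = hc (of_int e + of_int e' - of_nat i * \<rho>) (D i (sg e c * sg e' c'))"
        by (simp add: mult_single grD_sg)
      also have "\<dots> = (\<Sum>j\<le>i. hc (of_int e + of_int e' - of_nat i * \<rho>) (D j (sg e c) * D (i - j) (sg e' c')))"
        using hom hom' by (simp add: D_mult hc_sum)
      also have "\<dots> = (\<Sum>j\<le>i. grD \<rho> j (sg e c) * grD \<rho> (i - j) (sg e' c'))"
      proof (intro sum.cong refl)
        fix j assume "j \<in> {..i}"
        then have eq: "of_int e + of_int e' - of_nat i * \<rho>
            = (of_int e - of_nat j * \<rho>) + (of_int e' - of_nat (i - j) * \<rho>)"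
          by (simp add: of_nat_diff algebra_simps)
        show "hc (of_int e + of_int e' - of_nat i * \<rho>) (D j (sg e c) * D (i - j) (sg e' c'))
            = grD \<rho> j (sg e c) * grD \<rho> (i - j) (sg e' c')"
          unfolding eq grD_sg by (intro Fil_mult fil hom hom')
      qed
      finally show ?case .
    qed (use hom in \<open>simp_all add: distrib_left grD_add A_mult sum.distrib\<close>)
  qed (use that in \<open>simp_all add: distrib_right grD_add A_mult sum.distrib\<close>)
  show "grD \<rho> 0 a = a" if "a \<in> A" for a
    using that by (induction a rule: A_induct) (simp_all add: grD_add grD_sg hc_sg)
  show "grD \<rho> i (grD \<rho> j a) = of_nat (i + j choose i) * grD \<rho> (i + j) a" if "a \<in> A" for i j a
    using that
  proof (induction a rule: A_induct)
    case (add a b)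
    have "grD \<rho> j c \<in> A" if "c \<in> A" for c
      unfolding grD_def using that by (intro A_sum hc_in_A D_in A_comp)
    then show ?case using add by (simp add: grD_add algebra_simps)
  next
    case (hom e c)
    define r where "r = of_int e - of_nat j * \<rho>"
    define b where "b = D j (sg e c)"
    have b: "b \<in> Fil r" "b \<in> A" using fil hom by (auto simp: b_def r_def)
    have "grD \<rho> i (grD \<rho> j (sg e c)) = hc (r - of_nat i * \<rho>) (D i (hc r b))"
      by (simp add: grD_sg grD_hc r_def b_def)
    \<comment> \<open>The inner value b may be replaced by its leading component, since the
      difference has order above r and drops out by \<open>hc_D_Fil'\<close>. What remains is the
      coaction property of \<open>D\<close>.\<close>
    also have "D i (hc r b) = D i b - D i (b - hc r b)"
      using b by (simp add: D_diff hc_in_A)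
    also have "hc (r - of_nat i * \<rho>) (D i b - D i (b - hc r b))
        = hc (r - of_nat i * \<rho>) (D i b) - hc (r - of_nat i * \<rho>) (D i (b - hc r b))"
      using hc_add[of _ "D i b - D i (b - hc r b)" "D i (b - hc r b)"] by simp
    also have "hc (r - of_nat i * \<rho>) (D i (b - hc r b)) = 0"
      using b by (intro hc_D_Fil' fil Fil_minus_hc) (simp_all add: hc_in_A)
    also have "hc (r - of_nat i * \<rho>) (D i b) = of_nat (i + j choose i) * hc (r - of_nat i * \<rho>) (D (i + j) (sg e c))"
      using hom by (simp add: b_def D_D hc_of_nat_mult)
    also have "r - of_nat i * \<rho> = of_int e - of_nat (i + j) * \<rho>"
      by (simp add: r_def algebra_simps)
    finally show ?case by (simp add: grD_sg)
  qed simp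
  show "\<exists>N. \<forall>i>N. grD \<rho> i a = 0" if "a \<in> A" for a
    using that
  proof (induction a rule: A_induct)
    case (add a b)
    then obtain N M where "\<forall>i>N. grD \<rho> i a = 0" "\<forall>i>M. grD \<rho> i b = 0" by blast
    then show ?case using add by (intro exI[of _ "max N M"]) (simp add: grD_add)
  next
    case (hom e c)
    obtain N where "\<forall>i>N. D i (sg e c) = 0" using D_finite[OF hom] by blast
    then show ?case by (intro exI[of _ N]) (simp add: grD_sg)
  qed simp
qed (simp_all add: A_1 A_add A_mult A_uminus)

text \<open>The slope \<open>\<rho>\<close> is the largest rate at which \<open>D\<close> lowers the order in \<open>x\<close> of a generator; it
  is attained, so the leading part of \<open>D\<close> is a non-trivial exponential map.\<close>

lemma graded_exp_exists:
  assumes ntriv: "\<not> A \<subseteq> Inv" and u: "u \<in> Inv" "e < 0" "lookup u e \<noteq> 0"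
  shows "\<exists>G. exp_map A G \<and> homogeneous_exp G \<and> \<not> A \<subseteq> exp_map.Inv A G \<and>
      (\<forall>c. emb (cst c) \<in> exp_map.Inv A G) \<and> y \<in> exp_map.Inv A G"
proof -
  define gens where "gens = {(x, 1), (y, - int m), (emb [:0, 1:], 0), (emb [:[:0, 1:]:], 0)}"
  have gA: "r \<in> A" "r = sg e (lookup r e)" if "(r, e) \<in> gens" for r e
    using that by (auto simp: gens_def x_def y_def sg_in_A pole_multiple[of 1, simplified])
  \<comment> \<open>The rates at which coefficients of \<open>D\<close> change the order of a
    generator; a finite set, and non-empty because some generator is not invariant.\<close>
  define slopes where "slopes = (\<Union>(r, e)\<in>gens. \<Union>i\<in>{1..tdeg r}. (\<lambda>e'. (of_int e - of_int e') / of_nat i) ` keys (D i r) :: real set)"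
  have fin: "finite slopes" unfolding slopes_def by (auto simp: gens_def)
  have "\<exists>(r, e)\<in>gens. r \<notin> Inv"
  proof (rule ccontr)
    assume "\<not> ?thesis"
    then have g: "x \<in> Inv" "y \<in> Inv" "emb [:0, 1:] \<in> Inv" "emb [:[:0, 1:]:] \<in> Inv" by (auto simp: gens_def)
    have *: "sg e c \<in> Inv" if "sg e c \<in> A" for e c
      using sg_induct[OF that, of "\<lambda>_ a. a \<in> Inv"] g emb_cst_Inv by (simp add: emb_add)
    have "a \<in> Inv" if "a \<in> A" for a
      using that by (induction a rule: A_induct) (simp_all add: *)
    then show False using ntriv by blast
  qed
  then obtain r0 e0 where r0: "(r0, e0) \<in> gens" "r0 \<notin> Inv" by blast
  have "tdeg r0 \<ge> 1" using tdeg_pos[of r0] gA r0 by force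
  moreover have "r0 \<noteq> 0" using r0 by auto
  then have "keys (D (tdeg r0) r0) \<noteq> {}" using lead_neq_0[of r0] gA r0 by auto
  ultimately have "slopes \<noteq> {}" unfolding slopes_def using r0(1) by fastforce
  define \<rho> where "\<rho> = Max slopes"
  have "\<rho> \<in> slopes" using fin \<open>slopes \<noteq> {}\<close> by (simp add: \<rho>_def)
  then obtain r e1 i e' where r: "(r, e1) \<in> gens" "i \<ge> 1" "e' \<in> keys (D i r)"
    "\<rho> = (of_int e1 - of_int e') / of_nat i" by (auto simp: slopes_def)
  have gfil: "D i r \<in> Fil (of_int e - of_nat i * \<rho>)" if re: "(r, e) \<in> gens" for r e i
    unfolding Fil_def
  proof (safe)
    fix e' assume nz: "lookup (D i r) e' \<noteq> 0"
    show "of_int e - of_nat i * \<rho> \<le> of_int e'"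
    proof (cases "i = 0")
      case True
      have "lookup (sg e (lookup r e)) e' \<noteq> 0" using nz True gA[OF re] by simp
      then have "e' = e" by (auto simp: lookup_sg split: if_splits)
      then show ?thesis using True by simp
    next
      case False
      have "i \<le> tdeg r" using nz gA[OF re] by (intro tdeg_ge) auto
      then have "(of_int e - of_int e') / of_nat i \<in> slopes"
        unfolding slopes_def using False re nz by (force simp: in_keys_iff)
      then have "(of_int e - of_int e') / of_nat i \<le> \<rho>" using fin by (simp add: \<rho>_def)
      then show ?thesis using False by (simp add: field_simps)
    qed
  qed
  have fil: "D i (sg e c) \<in> Fil (of_int e - of_nat i * \<rho>)" if "sg e c \<in> A" for i e c
    using D_filtered[OF _ that, of \<rho> i] gfil unfolding gens_def by blast
  interpret G: exp_map A "grD \<rho>" by (rule exp_map_grD[OF fil])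
  have "homogeneous_exp (grD \<rho>)"
    unfolding homogeneous_exp_def by (intro exI[of _ \<rho>]) (auto simp: grD_sg lookup_hc split: if_splits)
  \<comment> \<open>The maximum is attained at degree e' in the i-th coefficient of the generator r,
    and exactly this component survives in the leading part.\<close>
  moreover have "\<not> A \<subseteq> G.Inv"
  proof
    assume *: "A \<subseteq> G.Inv"
    have "r \<in> G.Inv" using * gA r by blast
    then have "grD \<rho> i r = 0" using r(2) G.InvD(3) by simp
    then have "hc (of_int e1 - of_nat i * \<rho>) (D i r) = 0"
      using gA(2)[OF r(1)] grD_sg[of \<rho> i e1 "lookup r e1"] by simp
    then have "lookup (hc (of_int e1 - of_nat i * \<rho>) (D i r)) e' = 0" by simp
    moreover have "of_int e' = of_int e1 - of_nat i * \<rho>" using r(2,4) by (simp add: field_simps)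
    ultimately show False using r(3) by (simp add: lookup_hc in_keys_iff)
  qed
  moreover have "emb (cst c) \<in> G.Inv" for c
    using InvD(3)[OF emb_cst_Inv] by (intro G.InvI) (simp_all add: grD_sg)
  moreover have "y \<in> G.Inv"
  proof -
    \<comment> \<open>The lowest component of u is invariant under the leading part. Its degree is
      negative, so y is one of its factors, and invariants are closed under factors.\<close>
    define e0 where "e0 = Min (keys u)"
    have ne: "keys u \<noteq> {}" using u(3) by (auto simp: in_keys_iff)
    have e0: "e0 \<in> keys u" "e0 \<le> e" using u(3) Min_in[OF finite_keys ne] by (auto simp: e0_def in_keys_iff)
    have uA: "u \<in> A" using u InvD by blast
    let ?s = "sg e0 (lookup u e0)"
    have sA: "?s \<in> A" using uA by (rule A_comp)
    have uF: "u \<in> Fil (of_int e0)" by (auto simp: Fil_def e0_def in_keys_iff)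
    have hcu: "hc (of_int e0) u = ?s" by (simp add: hc_def)
    have sI: "?s \<in> G.Inv"
    proof (rule G.InvI[OF sA])
      fix i :: nat assume "i > 0"
      have "D i ?s = D i u - D i (u - ?s)" using uA sA by (simp add: D_diff)
      also have "D i u = 0" using u(1) \<open>i > 0\<close> InvD by blast
      finally have "grD \<rho> i ?s = hc (of_int e0 - of_nat i * \<rho>) (D i (- (u - ?s)))"
        using uA sA by (simp add: grD_sg D_uminus D_diff)
      also have "\<dots> = 0"
      proof (rule hc_D_Fil'[OF fil])
        have "u - ?s \<in> Fil' (of_int e0)" using Fil_minus_hc[OF uF] hcu by simp
        then show "- (u - ?s) \<in> Fil' (of_int e0)" by (simp add: Fil'_def lookup_minus)
      qed (use uA sA in auto)
      finally show "grD \<rho> i ?s = 0" .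
    qed
    obtain r l c' where d: "?s = x ^ r * y ^ l * emb c'" "e0 < 0 \<Longrightarrow> l > 0"
      using sg_decomp[OF sA] by metis
    then obtain l' where l: "l = Suc l'" using e0(2) u(2) by (cases l) auto
    have "?s = y * (x ^ r * y ^ l' * emb c')" by (simp add: d(1) l mult_ac)
    moreover have "?s \<noteq> 0" using e0(1) by (auto simp: in_keys_iff poly_mapping_eq_iff lookup_sg fun_eq_iff)
    ultimately show ?thesis using sI by (intro G.Inv_factor[of y "x ^ r * y ^ l' * emb c'"]) auto
  qed
  ultimately show ?thesis using G.exp_map_axioms by blast
qed

end

section \<open>A non-trivial exponential map moves \<open>f\<close> to a coordinate\<close>

lemma in_subring_poly:
  fixes q :: "'r::comm_ring_1 poly"
  assumes "\<And>i. coeff q i \<in> S" "s \<in> S" "0 \<in> S"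
    "\<And>a b. a \<in> S \<Longrightarrow> b \<in> S \<Longrightarrow> a + b \<in> S" "\<And>a b. a \<in> S \<Longrightarrow> b \<in> S \<Longrightarrow> a * b \<in> S"
  shows "poly q s \<in> S"
  using assms(1)
proof (induction q rule: pCons_induct)
  case (pCons a q)
  have "a \<in> S" using pCons.prems[of 0] by simp
  moreover have "coeff q i \<in> S" for i using pCons.prems[of "Suc i"] by simp
  ultimately show ?case using pCons.IH assms by simp
qed (use assms in simp)

locale graded_exp = asanuma + exp_map A G for G +
  assumes hom: "homogeneous_exp G" and ntriv: "\<not> A \<subseteq> Inv"
    and emb_cst: "emb (cst c) \<in> Inv" and y_Inv: "y \<in> Inv" and char: "CHAR('a) > 0"
begin

lemma char_laurent: "CHAR('a laurent) > 0"
  using char by (simp add: laurent_char)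

text \<open>A homogeneous map sends different degrees to different degrees, so the images of the
  components cannot cancel. This makes the ring of invariants graded.\<close>

lemma lookup_G_comp:
  obtains \<rho> :: real where
    "\<And>a i e e'. a \<in> A \<Longrightarrow> lookup (G i (sg e (lookup a e))) e' =
      (if of_int e' = of_int e - of_nat i * \<rho> then lookup (G i a) e' else 0)"
proof -
  obtain \<rho> :: real where \<rho>: "\<And>i e c e'. sg e c \<in> A \<Longrightarrow> lookup (G i (sg e c)) e' \<noteq> 0 \<Longrightarrow>
      of_int e' = of_int e - of_nat i * \<rho>"
    using hom unfolding homogeneous_exp_def by metis
  show ?thesis
  proof (rule that)
    fix a i e e' assume a: "a \<in> A"
    show "lookup (G i (sg e (lookup a e))) e' =
      (if of_int e' = of_int e - of_nat i * \<rho> then lookup (G i a) e' else 0)"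
    proof (cases "of_int e' = of_int e - of_nat i * \<rho>")
      case True
      let ?I = "insert e (keys a)"
      have "a = (\<Sum>d\<in>?I. sg d (lookup a d))" by (rule laurent_expand) auto
      then have "G i a = G i (\<Sum>d\<in>?I. sg d (lookup a d))" by simp
      also have "\<dots> = (\<Sum>d\<in>?I. G i (sg d (lookup a d)))" using a by (intro D_sum) (simp add: A_comp)
      finally have "lookup (G i a) e' = (\<Sum>d\<in>?I. lookup (G i (sg d (lookup a d))) e')"
        by (simp only: lookup_sum)
      also have "\<dots> = (\<Sum>d\<in>?I. if d = e then lookup (G i (sg e (lookup a e))) e' else 0)"
      proof (intro sum.cong refl)
        fix d
        show "lookup (G i (sg d (lookup a d))) e' = (if d = e then lookup (G i (sg e (lookup a e))) e' else 0)"
        proof (cases "d = e")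
          case False
          then have "of_int e' \<noteq> of_int d - of_nat i * \<rho>" unfolding True by simp
          then have "lookup (G i (sg d (lookup a d))) e' = 0" using \<rho>[OF A_comp[OF a]] by blast
          then show ?thesis using False by simp
        qed simp
      qed
      finally show ?thesis using True by simp
    next
      case False
      then have "lookup (G i (sg e (lookup a e))) e' = 0" using \<rho>[OF A_comp[OF a]] by blast
      then show ?thesis using False by simp
    qed
  qed
qed

lemma G_comp_eq_0: "a \<in> A \<Longrightarrow> G i a = 0 \<Longrightarrow> G i (sg e (lookup a e)) = 0"
proof -
  assume a: "a \<in> A" "G i a = 0"
  obtain \<rho> :: real where \<rho>: "\<And>a i e e'. a \<in> A \<Longrightarrow> lookup (G i (sg e (lookup a e))) e' =
      (if of_int e' = of_int e - of_nat i * \<rho> then lookup (G i a) e' else 0)"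
    by (rule lookup_G_comp) blast
  show ?thesis by (rule poly_mapping_eqI) (simp add: \<rho>[OF a(1)] a(2))
qed

lemma G_homogeneous:
  assumes "sg e c \<in> A"
  obtains d b where "G i (sg e c) = sg d b"
proof -
  obtain \<rho> :: real where \<rho>: "\<And>i e c e'. sg e c \<in> A \<Longrightarrow> lookup (G i (sg e c)) e' \<noteq> 0 \<Longrightarrow>
      of_int e' = of_int e - of_nat i * \<rho>"
    using hom unfolding homogeneous_exp_def by metis
  show ?thesis
  proof (cases "G i (sg e c) = 0")
    case True
    then show ?thesis using that[of 0 0] by simp
  next
    case False
    then obtain d where d: "lookup (G i (sg e c)) d \<noteq> 0" by (metis poly_mapping_eqI lookup_zero)
    have "G i (sg e c) = sg d (lookup (G i (sg e c)) d)"
    proof (rule poly_mapping_eqI)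
      fix e'
      show "lookup (G i (sg e c)) e' = lookup (sg d (lookup (G i (sg e c)) d)) e'"
      proof (cases "e' = d")
        case ne: False
        then have "lookup (G i (sg e c)) e' = 0" using \<rho>[OF assms d] \<rho>[OF assms, of i e'] by force
        then show ?thesis using ne by (simp add: lookup_sg)
      qed (simp add: lookup_sg)
    qed
    then show ?thesis using that by blast
  qed
qed

lemma Inv_comp: "a \<in> Inv \<Longrightarrow> sg e (lookup a e) \<in> Inv"
  by (intro InvI) (auto simp: A_comp G_comp_eq_0 InvD)

lemma sg_neq_0: "c \<noteq> 0 \<Longrightarrow> sg e c \<noteq> 0"
  by (metis lookup_single_eq lookup_zero)

lemma y_power_Inv: "y ^ l \<in> Inv" using y_Inv by simp

definition G0 :: "'a poly poly set" where "G0 = {c. emb c \<in> Inv}"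

text \<open>Both directions come from x^m y = - f, as y is invariant and invariants are closed under
  products and factors.\<close>

lemma f_in_G0_iff: "f \<in> G0 \<longleftrightarrow> x \<in> Inv"
proof
  assume "f \<in> G0"
  then have "- emb f \<in> Inv" by (simp add: G0_def)
  then have I: "x ^ m * y \<in> Inv" by (simp add: x_power_y)
  have "x * (x ^ (m - 1) * y) = x ^ m * y"
    using m_ge_2 by (cases m) (simp_all add: mult.assoc)
  then have "x * (x ^ (m - 1) * y) \<in> Inv" using I by metis
  moreover have "x * (x ^ (m - 1) * y) \<noteq> 0" using x_neq_0 y_neq_0 by simp
  ultimately show "x \<in> Inv" by (intro Inv_factor[of x "x ^ (m - 1) * y"]) simp_all
next
  assume "x \<in> Inv"
  then have "- (x ^ m * y) \<in> Inv" using y_Inv by simp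
  then show "f \<in> G0" by (simp add: x_power_y G0_def)
qed

text \<open>In the decomposition x^r y^l c' every factor of an invariant is invariant, so r = 0. In
  particular nonzero homogeneous invariants have degrees divisible by m when x is moved.\<close>

lemma Inv_homogeneous:
  assumes "x \<notin> Inv" "sg e c \<in> Inv" "c \<noteq> 0"
  shows "\<exists>l c'. e = - (int m * int l) \<and> c' \<in> G0 \<and> c = (- f) ^ l * c'"
proof -
  have sA: "sg e c \<in> A" using assms InvD by blast
  obtain r l c' where d: "sg e c = x ^ r * y ^ l * emb c'" "e = int r - int m * int l"
    using sg_decomp[OF sA] by metis
  have nz: "x ^ r * (y ^ l * emb c') \<noteq> 0" using sg_neq_0[OF assms(3)] d(1) by (metis mult.assoc)
  have I: "x ^ r * (y ^ l * emb c') \<in> Inv" using assms d by (simp add: mult.assoc)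
  have "r = 0"
  proof (rule ccontr)
    assume "r \<noteq> 0"
    then have "x ^ r = x * x ^ (r - 1)" by (cases r) auto
    then have "x \<in> Inv" using I nz by (intro Inv_factor[of x "x ^ (r - 1) * (y ^ l * emb c')"]) (auto simp: mult.assoc)
    then show False using assms by simp
  qed
  moreover have "emb c' \<in> Inv" using I nz \<open>r = 0\<close> by (intro Inv_factor2[of "y ^ l" "emb c'"]) auto
  moreover have "c = (- f) ^ l * c'"
    using d \<open>r = 0\<close> by (simp add: y_power mult_single) (metis lookup_single_eq)
  ultimately show ?thesis using d by (auto simp: G0_def)
qed

text \<open>Once \<open>x\<close> has least positive degree, \<open>slice\<close> writes each
  element of k[z,t], up to a power of the leading coefficient of x, as a polynomial in x over the
  invariants. In a suitable degree only powers of x^m survive, and x^m y = - f turns them into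
  powers of f over \<open>G0\<close>.\<close>

lemma variable_if_x_not_Inv:
  assumes xI: "x \<notin> Inv"
  shows "\<exists>g. subalgebra2 f g = UNIV"
proof (rule variable_if_coordinate_over_subring[of G0])
  show "cst c \<in> G0" for c using emb_cst by (simp add: G0_def)
  show "a + b \<in> G0" if "a \<in> G0" "b \<in> G0" for a b using that by (simp add: G0_def emb_add)
  show G0_mult: "a * b \<in> G0" if "a \<in> G0" "b \<in> G0" for a b using that by (simp add: G0_def emb_mult)
  show "a \<in> G0" if "a * b \<in> G0" "a * b \<noteq> 0" for a b
    using that Inv_factor[of "emb a" "emb b"] sg_neq_0[of "a * b" 0] by (simp add: G0_def emb_mult)
  show "f \<notin> G0" using xI f_in_G0_iff by simp
  have mdeg_pos: "mdeg > 0" using mdeg ntriv by blast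
  have tx: "tdeg x \<ge> mdeg" using tdeg_pos xI by (intro mdeg_le) auto
  obtain a where a: "a \<in> A" "tdeg a = mdeg" using mdeg(2)[OF ntriv] by blast
  \<comment> \<open>Passage to a homogeneous component: some component of a is moved, and its degree
    in T is again minimal.\<close>
  have "\<exists>e. sg e (lookup a e) \<notin> Inv"
  proof (rule ccontr)
    assume "\<not> ?thesis"
    then have "(\<Sum>e\<in>keys a. sg e (lookup a e)) \<in> Inv" by (intro Inv_sum) auto
    then have "a \<in> Inv" by (simp flip: laurent_expand)
    then show False using a mdeg_pos InvD by force
  qed
  then obtain e where e: "sg e (lookup a e) \<notin> Inv" by blast
  let ?s = "sg e (lookup a e)"
  have sA: "?s \<in> A" using a A_comp by blast
  have "tdeg ?s \<le> mdeg"
    using a by (intro tdeg_leI sA G_comp_eq_0) (simp_all add: D_above_tdeg)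
  then have ts: "tdeg ?s = mdeg" using mdeg_le[OF sA] tdeg_pos[OF sA e] by simp
  obtain r l c where d: "?s = x ^ r * y ^ l * emb c"
    using sg_decomp[OF sA] by metis
  have "?s \<noteq> 0" using e by auto
  then have nz: "x ^ r \<noteq> 0" "y ^ l \<noteq> 0" "x ^ r * y ^ l \<noteq> 0" "emb c \<noteq> 0" unfolding d by auto
  have "tdeg ?s = tdeg (x ^ r * y ^ l) + tdeg (emb c)" unfolding d using nz by (intro tdeg_mult) auto
  also have "tdeg (x ^ r * y ^ l) = tdeg (x ^ r) + tdeg (y ^ l)" using nz by (intro tdeg_mult) auto
  also have "tdeg (x ^ r) = r * tdeg x" using x_neq_0 by (intro tdeg_power) auto
  also have "tdeg (y ^ l) = 0" using y_power_Inv InvD by blast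
  finally have sum: "mdeg = r * tdeg x + tdeg (emb c)" using ts by simp
  have supp: "int m dvd e" if "a \<in> Inv" "lookup a e \<noteq> 0" for a e
    using Inv_homogeneous[OF xI Inv_comp[OF that(1)] that(2)] by auto
  \<comment> \<open>If x does not have minimal degree, the factor c in k[z,t] does. By
    \<open>slice\<close> for c, the element \<open>?t ^ k * x\<close> would be a polynomial in c
    over the invariants, hence supported in degrees divisible by m; but x shifts degrees by 1, and m
    \<ge> 2.\<close>
  have tdx: "tdeg x = mdeg"
  proof (rule ccontr)
    assume ne: "tdeg x \<noteq> mdeg"
    then have "r = 0"
      using sum tx by (cases r) auto
    then have tc: "tdeg (emb c) = mdeg" using sum by simp
    define S where "S = {b :: 'a laurent. \<forall>e. lookup b e \<noteq> 0 \<longrightarrow> int m dvd e}"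
    have S: "0 \<in> S" "emb c \<in> S" "\<And>a. a \<in> Inv \<Longrightarrow> a \<in> S"
      by (auto simp: S_def lookup_sg supp)
    have Sadd: "a + b \<in> S" if "a \<in> S" "b \<in> S" for a b
      using that unfolding S_def mem_Collect_eq lookup_add by (metis add.right_neutral)
    have Ssum: "sum F I \<in> S" if "\<And>i. i \<in> I \<Longrightarrow> F i \<in> S" for F and I :: "int set"
      using that by (induction I rule: infinite_finite_induct) (auto simp: S Sadd)
    have Smult: "a * b \<in> S" if "a \<in> S" "b \<in> S" for a b
    proof -
      have "sg (i + j) c \<in> S" if "i \<in> keys a" "j \<in> keys b" for i j c
        using that \<open>a \<in> S\<close> \<open>b \<in> S\<close> by (auto simp: S_def in_keys_iff lookup_sg)
      then show ?thesis unfolding laurent_mult_expand[of a b] by (intro Ssum)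
    qed
    let ?t = "G mdeg (emb c)"
    obtain k q where q: "\<forall>i. coeff q i \<in> Inv" "?t ^ k * x = poly q (emb c)"
      using slice[OF char_laurent emb_in_A tc ntriv x_in_A] by blast
    have "poly q (emb c) \<in> S" using q S Sadd Smult by (intro in_subring_poly) auto
    then have tkx: "?t ^ k * x \<in> S" using q by simp
    have tI: "?t \<in> Inv" using tc by (intro lead_in_Inv) auto
    have "emb c \<noteq> 0" using nz by auto
    then have "?t \<noteq> 0" using lead_neq_0[of "emb c"] tc by simp
    then have "?t ^ k \<noteq> 0" by simp
    then obtain d where dn: "lookup (?t ^ k) d \<noteq> 0" by (metis poly_mapping_eqI lookup_zero)
    then have "int m dvd d" using supp[of "?t ^ k" d] tI by simp
    moreover have "lookup (?t ^ k * x) (d + 1) = lookup (?t ^ k) d"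
      using lookup_sg_mult[of 1 1 "?t ^ k" "d + 1"] by (simp add: x_def mult.commute)
    then have "int m dvd d + 1" using tkx dn by (auto simp: S_def)
    ultimately have "int m dvd 1" by (simp add: dvd_add_right_iff)
    then show False using m_ge_2 by simp
  qed
  fix a :: "'a poly poly"
  let ?t = "G mdeg x"
  obtain k q where q: "\<forall>i. coeff q i \<in> Inv" "?t ^ k * emb a = poly q x"
    using slice[OF char_laurent x_in_A tdx ntriv emb_in_A] by blast
  have tI: "?t \<in> Inv" using tdx by (intro lead_in_Inv) auto
  have t0: "?t \<noteq> 0" using lead_neq_0[of x] tdx x_neq_0 by simp
  have "sg 1 1 \<in> A" using x_in_A by (simp add: x_def)
  then obtain d b where tdb: "?t = sg d b" unfolding x_def by (rule G_homogeneous)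
  have "b \<noteq> 0" using t0 tdb by auto
  then obtain j b' where j: "d = - (int m * int j)" "b' \<in> G0" "b = (- f) ^ j * b'"
    using Inv_homogeneous[OF xI, of d b] tI tdb by auto
  \<comment> \<open>The degree of \<open>?t ^ k\<close>. In it, the coefficient of x^i contributes
    through its component of degree ?e - i, which vanishes unless m divides i; this component
    carries (- f)^(j k + i div m), from which (- f)^(j k) cancels.\<close>
  let ?e = "- (int m * int (j * k))"
  have "?t ^ k = sg (int k * d) (b ^ k)" by (simp add: tdb sg_power)
  also have "int k * d = ?e" by (simp add: j)
  finally have tk: "?t ^ k = sg ?e (b ^ k)" .
  have "lookup (?t ^ k * emb a) ?e = b ^ k * a" unfolding tk by (simp add: mult_single)
  also have "b ^ k = (- f) ^ (j * k) * b' ^ k" by (simp add: j power_mult_distrib power_mult)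
  finally have lhs: "lookup (poly q x) ?e = (- f) ^ (j * k) * (b' ^ k * a)" using q by (simp add: mult.assoc)
  have "\<exists>g\<in>G0. lookup (coeff q i) (- (int m * int n)) = (- f) ^ n * g" for i n
  proof (cases "lookup (coeff q i) (- (int m * int n)) = 0")
    case True
    then show ?thesis by (intro bexI[of _ 0]) (auto simp: G0_def)
  next
    case False
    then show ?thesis
      using Inv_homogeneous[OF xI Inv_comp False, of] q(1) m_ge_2 by fastforce
  qed
  then obtain g where g: "\<And>i n. g i n \<in> G0" "\<And>i n. lookup (coeff q i) (- (int m * int n)) = (- f) ^ n * g i n"
    by metis
  have summand: "lookup (coeff q i * x ^ i) ?e = (if m dvd i then (- f) ^ (j * k) * ((- f) ^ (i div m) * g i (j * k + i div m)) else 0)" for i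
  proof -
    have "lookup (coeff q i * x ^ i) ?e = lookup (coeff q i) (?e - int i)"
      using lookup_sg_mult[of "int i" 1 "coeff q i" ?e] by (simp add: x_def sg_power mult.commute)
    also have "\<dots> = (if m dvd i then (- f) ^ (j * k) * ((- f) ^ (i div m) * g i (j * k + i div m)) else 0)"
    proof (cases "m dvd i")
      case True
      then have eqn: "?e - int i = - (int m * int (j * k + i div m))"
        by (auto elim!: dvdE simp: algebra_simps)
      show ?thesis using True unfolding eqn g(2) by (simp add: power_add mult.assoc)
    next
      case False
      have "lookup (coeff q i) (?e - int i) = 0"
      proof (rule ccontr)
        assume "lookup (coeff q i) (?e - int i) \<noteq> 0"
        then have "int m dvd ?e - int i" using supp q(1) by blast
        then have "int m dvd int i" by (simp add: dvd_diff_right_iff)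
        then show False using False by simp
      qed
      then show ?thesis using False by simp
    qed
    finally show ?thesis .
  qed
  let ?h = "\<lambda>i. if m dvd i then (- f) ^ (i div m) * g i (j * k + i div m) else 0"
  have "(- f) ^ (j * k) * (b' ^ k * a) = (- f) ^ (j * k) * (\<Sum>i\<le>degree q. ?h i)"
    unfolding lhs[symmetric] poly_altdef[of q x] lookup_sum summand sum_distrib_left
    by (intro sum.cong) auto
  then have "b' ^ k * a = (\<Sum>i\<le>degree q. ?h i)" by simp
  also have "\<dots> = poly (\<Sum>i\<le>degree q. if m dvd i then monom ((- 1) ^ (i div m) * g i (j * k + i div m)) (i div m) else 0) f"
    unfolding poly_sum by (intro sum.cong refl) (simp add: poly_monom power_minus[of f] mult_ac)
  finally have eq: "b' ^ k * a = poly (\<Sum>i\<le>degree q. if m dvd i then monom ((- 1) ^ (i div m) * g i (j * k + i div m)) (i div m) else 0) f"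
    (is "_ = poly ?P f") .
  have G0z: "0 \<in> G0" by (simp add: G0_def)
  have G0sum: "sum F I \<in> G0" if "\<And>i. i \<in> I \<Longrightarrow> F i \<in> G0" for F and I :: "nat set"
    using that by (induction I rule: infinite_finite_induct) (auto simp: G0_def emb_add)
  have G0pow: "h ^ n \<in> G0" if "h \<in> G0" for h n using that by (simp add: G0_def emb_power)
  have "- 1 \<in> G0" by (simp add: G0_def emb_uminus)
  then have "coeff ?P i \<in> G0" for i
    unfolding coeff_sum by (intro G0sum) (auto simp: G0z intro!: G0_mult G0pow g)
  moreover have "b' ^ k \<in> G0" using j G0pow by blast
  moreover have "b' ^ k \<noteq> 0" using j \<open>b \<noteq> 0\<close> by auto
  ultimately show "\<exists>d P. d \<in> G0 \<and> d \<noteq> 0 \<and> (\<forall>i. coeff P i \<in> G0) \<and> d * a = poly P f"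
    using eq by blast
qed

lemma variable_if_x_Inv:
  assumes xI: "x \<in> Inv"
  shows "\<exists>g. subalgebra2 f g = UNIV"
proof -
  define D where "D i c = tot (G i (emb c))" for i c
  \<comment> \<open>A homogeneous element and its value at x = 1 differ by a power of x, which is
    invariant and becomes 1 under \<open>tot\<close>.\<close>
  have hom': "tot (G i (emb (tot b))) = tot (G i b)" if "b \<in> A" "b = sg e d" for i b e d
  proof (cases "e \<ge> 0")
    case True
    then have "b = x ^ nat e * emb d" using that by (simp add: x_def sg_power mult_single)
    then have "G i b = x ^ nat e * G i (emb d)" using xI by (simp add: D_Inv_mult)
    then show ?thesis using that by (simp add: tot_mult x_def sg_power)
  next
    case False
    then have "x ^ nat (- e) * b = emb d" using that by (simp add: x_def sg_power mult_single)
    then have "G i (emb d) = x ^ nat (- e) * G i b" using xI that D_Inv_mult[of "x ^ nat (- e)" b i] by simp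
    then show ?thesis using that by (simp add: tot_mult x_def sg_power)
  qed
  have Gemb: "\<exists>d b. G i (emb c) = sg d b" for i c by (rule G_homogeneous[of 0 c i]) auto
  have "exp_map UNIV D"
  proof
    show "D i (a + b) = D i a + D i b" for i a b by (simp add: D_def emb_add D_add tot_add)
    show "D i (a * b) = (\<Sum>j\<le>i. D j a * D (i - j) b)" for i a b
      by (simp add: D_def emb_mult D_mult tot_sum tot_mult)
    show "D 0 a = a" for a by (simp add: D_def)
    show "D i (D j a) = of_nat (i + j choose i) * D (i + j) a" for i j a
    proof -
      obtain d b where "G j (emb a) = sg d b" using Gemb by blast
      moreover have "G j (emb a) \<in> A" by simp
      ultimately have "D i (D j a) = tot (G i (G j (emb a)))" unfolding D_def by (intro hom') auto
      also have "\<dots> = tot (of_nat (i + j choose i) * G (i + j) (emb a))" by (simp add: D_D)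
      also have "\<dots> = tot (of_nat (i + j choose i)) * D (i + j) a" by (simp add: tot_mult D_def)
      also have "tot (of_nat n) = of_nat n" for n
      proof (induction n)
        case (Suc n)
        then show ?case using tot_sg[of 0 1] by (simp add: tot_add)
      qed simp
      finally show ?thesis .
    qed
    show "\<exists>N. \<forall>i>N. D i a = 0" for a
    proof -
      obtain N where "\<forall>i>N. G i (emb a) = 0" using D_finite[OF emb_in_A[of a]] by blast
      then show ?thesis by (intro exI[of _ N]) (simp add: D_def)
    qed
  qed simp_all
  then interpret D: exp_map UNIV D .
  have Dcst: "cst c \<in> D.Inv" for c
    using InvD(3)[OF emb_cst[of c]] by (intro D.InvI) (simp_all add: D_def)
  interpret D: plane_exp D by unfold_locales (rule Dcst)
  have "f \<in> G0" using xI f_in_G0_iff by simp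
  then have fI: "f \<in> D.Inv" using InvD(3)[of "emb f"] by (intro D.InvI) (simp_all add: D_def G0_def)
  have nt: "D.Inv \<noteq> UNIV"
  proof
    assume U: "D.Inv = UNIV"
    \<comment> \<open>A homogeneous element that vanishes at x = 1 is zero, so trivial
      \<open>D\<close> forces \<open>G\<close> to fix k[z,t]; with x and y invariant it would fix
      all of A.\<close>
    have emb: "emb c \<in> Inv" for c
    proof (rule InvI)
      fix i :: nat assume "i > 0"
      obtain d b where db: "G i (emb c) = sg d b" using Gemb by blast
      have "D i c = 0" using U D.InvD(3)[of c i] \<open>i > 0\<close> by simp
      then show "G i (emb c) = 0" by (simp add: D_def db)
    qed simp
    have hom: "sg e c \<in> Inv" if sA: "sg e c \<in> A" for e c
    proof -
      obtain r l c' where d: "sg e c = x ^ r * y ^ l * emb c'" using sg_decomp[OF sA] by metis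
      show ?thesis unfolding d using emb xI y_Inv by simp
    qed
    have "a \<in> Inv" if "a \<in> A" for a using that by (induction a rule: A_induct) (simp_all add: hom)
    then show False using ntriv by blast
  qed
  have ncst: "f \<noteq> cst c" for c using msize_f_pos msize_cst[of c] by auto
  have "D.Inv = range (\<lambda>P. ev P f)"
  proof (intro subset_antisym subsetI)
    fix h assume "h \<in> D.Inv"
    then show "h \<in> range (\<lambda>P. ev P f)"
      using invariants_of_exp_fixing_line[OF D.exp_map_axioms fI Dcst nt] by blast
  next
    fix h assume "h \<in> range (\<lambda>P. ev P f)"
    then obtain P where "h = ev P f" by blast
    moreover have "ev P f \<in> D.Inv" using Dcst fI by (induction P rule: pCons_induct) simp_all
    ultimately show "h \<in> D.Inv" by simp
  qed
  then show ?thesis using D.variable_of_plane_exp[OF _ ncst nt char] by blast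
qed

end

theorem (in asanuma_exp) variable_if_invariant_with_pole:
  assumes "CHAR('a) > 0" "\<not> A \<subseteq> Inv" "u \<in> Inv" "e < 0" "lookup u e \<noteq> 0"
  shows "\<exists>g. subalgebra2 f g = UNIV"
proof -
  obtain G where "exp_map A G" "homogeneous_exp G" "\<not> A \<subseteq> exp_map.Inv A G"
    "\<And>c. emb (cst c) \<in> exp_map.Inv A G" "y \<in> exp_map.Inv A G"
    using graded_exp_exists[OF assms(2-5)] by blast
  then have "graded_exp f \<psi> q m G"
    using assms(1) asanuma_axioms by (simp add: graded_exp_def graded_exp_axioms_def)
  from graded_exp.variable_if_x_Inv[OF this] graded_exp.variable_if_x_not_Inv[OF this]
  show ?thesis by metis
qed

section \<open>Algebraic independence by counting monomials\<close>

type_synonym triple = "nat \<times> nat \<times> nat"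

definition mon3 :: "'r::comm_ring_1 \<Rightarrow> 'r \<Rightarrow> 'r \<Rightarrow> triple \<Rightarrow> 'r" where
  "mon3 u v w e = u ^ fst e * v ^ fst (snd e) * w ^ snd (snd e)"

definition indep3 :: "('a::field \<Rightarrow> 'r::comm_ring_1) \<Rightarrow> 'r \<Rightarrow> 'r \<Rightarrow> 'r \<Rightarrow> bool" where
  "indep3 sc u v w \<longleftrightarrow> (\<forall>F k. finite F \<longrightarrow> (\<Sum>e\<in>F. sc (k e) * mon3 u v w e) = 0 \<longrightarrow> (\<forall>e\<in>F. k e = 0))"

definition tadd :: "triple \<Rightarrow> triple \<Rightarrow> triple" where
  "tadd d e = (fst d + fst e, fst (snd d) + fst (snd e), snd (snd d) + snd (snd e))"

definition tle :: "triple \<Rightarrow> triple \<Rightarrow> bool" where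
  "tle d e \<longleftrightarrow> fst d \<le> fst e \<and> fst (snd d) \<le> fst (snd e) \<and> snd (snd d) \<le> snd (snd e)"

lemma mon3_tadd: "mon3 u v w (tadd d e) = mon3 u v w d * mon3 u v w e"
  by (simp add: mon3_def tadd_def power_add mult_ac)

lemma tle_obtain: "tle d e \<Longrightarrow> \<exists>c. e = tadd c d"
  by (intro exI[of _ "(fst e - fst d, fst (snd e) - fst (snd d), snd (snd e) - snd (snd d))"])
     (simp add: tle_def tadd_def prod_eq_iff)

text \<open>Exponents read as digits in base N. For N above the first two exponents in play, the
  weight separates monomials, and it is additive, so it serves as a monomial order for one finite
  relation.\<close>

definition twt :: "nat \<Rightarrow> triple \<Rightarrow> nat" where
  "twt N e = fst e + N * (fst (snd e) + N * snd (snd e))"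

lemma twt_tadd: "twt N (tadd d e) = twt N d + twt N e"
  by (simp add: twt_def tadd_def algebra_simps)

lemma twt_inj:
  assumes "fst d < N" "fst (snd d) < N" "fst e < N" "fst (snd e) < N" "twt N d = twt N e"
  shows "d = e"
proof -
  have "twt N d mod N = fst d" "twt N e mod N = fst e" using assms(1-4) by (simp_all add: twt_def)
  then have 1: "fst d = fst e" using assms(5) by metis
  then have 2: "fst (snd d) + N * snd (snd d) = fst (snd e) + N * snd (snd e)"
    using assms by (simp add: twt_def)
  moreover have "(fst (snd d) + N * snd (snd d)) mod N = fst (snd d)"
    "(fst (snd e) + N * snd (snd e)) mod N = fst (snd e)" using assms by simp_all
  ultimately have 3: "fst (snd d) = fst (snd e)" by metis
  then have "snd (snd d) = snd (snd e)" using 2 assms by simp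
  then show ?thesis using 1 3 by (simp add: prod_eq_iff)
qed

lemma twt_bound:
  assumes "N \<ge> 1"
  shows "fst e \<le> twt N e" "fst (snd e) \<le> twt N e" "snd (snd e) \<le> twt N e"
proof -
  have "1 * (fst (snd e) + 1 * snd (snd e)) \<le> N * (fst (snd e) + N * snd (snd e))"
    using assms by (intro mult_le_mono add_le_mono) auto
  then show "fst e \<le> twt N e" "fst (snd e) \<le> twt N e" "snd (snd e) \<le> twt N e"
    by (simp_all add: twt_def)
qed

text \<open>The number of monomials of weight at most \<open>L\<close> that are not divisible by a fixed monomial
  grows quadratically in \<open>L\<close>, while \<open>indep3\<close> elements produce cubically many.\<close>

lemma indep3D:
  "indep3 sc u v w \<Longrightarrow> finite F \<Longrightarrow> (\<Sum>e\<in>F. sc (k e) * mon3 u v w e) = 0 \<Longrightarrow> e \<in> F \<Longrightarrow> k e = 0"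
  by (simp add: indep3_def)

lemma indep3_of_generators:
  fixes sc :: "'a::field \<Rightarrow> 'r::idom"
  assumes sc: "sc 1 = 1" "\<And>a b. sc (a + b) = sc a + sc b" "\<And>a b. sc (a * b) = sc a * sc b"
    and gen: "\<And>W. range sc \<subseteq> W \<Longrightarrow> u \<in> W \<Longrightarrow> v \<in> W \<Longrightarrow> w \<in> W \<Longrightarrow>
      (\<And>a b. a \<in> W \<Longrightarrow> b \<in> W \<Longrightarrow> a + b \<in> W) \<Longrightarrow> (\<And>a b. a \<in> W \<Longrightarrow> b \<in> W \<Longrightarrow> a * b \<in> W) \<Longrightarrow>
      x1 \<in> W \<and> x2 \<in> W \<and> x3 \<in> W"
    and ind: "indep3 sc x1 x2 x3"
  shows "indep3 sc u v w"
proof (rule ccontr)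
  interpret vs: vector_space "\<lambda>c a. sc c * a"
    by unfold_locales (simp_all add: sc algebra_simps)
  have sc0: "sc 0 = 0" using sc(2)[of 0 0] by (simp only: add_0 add_cancel_right_right)
  let ?mon = "mon3 u v w"
  assume "\<not> indep3 sc u v w"
  then obtain F0 k where F0: "finite F0" "(\<Sum>e\<in>F0. sc (k e) * ?mon e) = 0" "\<exists>e\<in>F0. k e \<noteq> 0"
    by (auto simp: indep3_def)
  define F where "F = {e \<in> F0. k e \<noteq> 0}"
  have F: "finite F" "F \<noteq> {}" "\<And>e. e \<in> F \<Longrightarrow> k e \<noteq> 0" using F0 by (auto simp: F_def)
  have Fsum: "(\<Sum>e\<in>F. sc (k e) * ?mon e) = 0"
    using F0(2) unfolding F_def
    by (subst sum.mono_neutral_left[of F0]) (use F0 in \<open>auto simp: sc0\<close>)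
  define N where "N = Suc (\<Sum>e\<in>F. fst e + fst (snd e))"
  have N: "N \<ge> 1" by (simp add: N_def)
  have lt: "fst e < N" "fst (snd e) < N" if "e \<in> F" for e
    using member_le_sum[of e F "\<lambda>e. fst e + fst (snd e)"] that F by (auto simp: N_def)
  let ?wt = "twt N"
  obtain \<mu> where \<mu>: "\<mu> \<in> F" "\<And>e. e \<in> F \<Longrightarrow> ?wt e \<le> ?wt \<mu>"
  proof -
    have "Max (?wt ` F) \<in> ?wt ` F" using F by (intro Max_in) auto
    then obtain \<mu> where \<mu>: "\<mu> \<in> F" "Max (?wt ` F) = ?wt \<mu>" by blast
    have "?wt e \<le> ?wt \<mu>" if "e \<in> F" for e
      unfolding \<mu>(2)[symmetric] using that F by (intro Max_ge) auto
    then show ?thesis using that \<mu>(1) by blast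
  qed
  have less: "?wt e < ?wt \<mu>" if "e \<in> F - {\<mu>}" for e
  proof -
    have e: "e \<in> F" "e \<noteq> \<mu>" using that by auto
    then have "?wt e \<noteq> ?wt \<mu>" using twt_inj[OF lt(1,2)[OF e(1)] lt(1,2)[OF \<mu>(1)]] by blast
    then show ?thesis using \<mu>(2)[OF e(1)] by simp
  qed
  \<comment> \<open>The relation solved for its heaviest monomial; all others are strictly
    lighter.\<close>
  have top: "?mon \<mu> = (\<Sum>e\<in>F - {\<mu>}. sc (- (inverse (k \<mu>) * k e)) * ?mon e)"
  proof -
    have neg: "sc (- a) = - sc a" for a using sc(2)[of "- a" a] sc0 by (simp add: eq_neg_iff_add_eq_0)
    have "sc (k \<mu>) * ?mon \<mu> + (\<Sum>e\<in>F - {\<mu>}. sc (k e) * ?mon e) = 0"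
      using Fsum F \<mu> by (simp add: sum.remove)
    then have "sc (k \<mu>) * ?mon \<mu> = - (\<Sum>e\<in>F - {\<mu>}. sc (k e) * ?mon e)"
      by (simp add: eq_neg_iff_add_eq_0)
    then have "sc (inverse (k \<mu>)) * (sc (k \<mu>) * ?mon \<mu>)
        = sc (inverse (k \<mu>)) * - (\<Sum>e\<in>F - {\<mu>}. sc (k e) * ?mon e)"
      by (simp only:)
    moreover have "sc (inverse (k \<mu>)) * sc (k \<mu>) = 1" using F(3)[OF \<mu>(1)] by (simp flip: sc)
    ultimately show ?thesis
      by (simp add: neg sc(3) sum_distrib_left sum_negf mult.assoc[symmetric])
  qed
  define R where "R L = {e. ?wt e \<le> L \<and> \<not> tle \<mu> e}" for L
  define V where "V L = vs.span (?mon ` {e. ?wt e \<le> L})" for L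
  have Rmono: "vs.span (?mon ` R L) \<subseteq> vs.span (?mon ` R L')" if "L \<le> L'" for L L'
    using that by (intro vs.span_mono image_mono) (auto simp: R_def)
  \<comment> \<open>Replacing a factor \<mu> by lighter monomials lowers the weight, so by induction
    the monomials not divisible by \<mu> span.\<close>
  have red: "?mon e \<in> vs.span (?mon ` R (?wt e))" for e
  proof (induction "?wt e" arbitrary: e rule: less_induct)
    case less
    show ?case
    proof (cases "tle \<mu> e")
      case False
      then show ?thesis by (intro vs.span_base imageI) (simp add: R_def)
    next
      case True
      then obtain c where c: "e = tadd c \<mu>" using tle_obtain by blast
      have "?mon e = (\<Sum>d\<in>F - {\<mu>}. sc (- (inverse (k \<mu>) * k d)) * ?mon (tadd c d))"
        unfolding c mon3_tadd top sum_distrib_left by (intro sum.cong) (simp_all add: mult_ac)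
      also have "\<dots> \<in> vs.span (?mon ` R (?wt e))"
      proof (intro vs.span_sum vs.span_scale)
        fix d assume "d \<in> F - {\<mu>}"
        then have "?wt (tadd c d) < ?wt e" using less c by (simp add: twt_tadd \<open>\<And>e. e \<in> F - {\<mu>} \<Longrightarrow> ?wt e < ?wt \<mu>\<close>)
        then show "?mon (tadd c d) \<in> vs.span (?mon ` R (?wt e))"
          using less.hyps[of "tadd c d"] Rmono[of "?wt (tadd c d)" "?wt e"] by auto
      qed
      finally show ?thesis .
    qed
  qed
  have VR: "V L \<subseteq> vs.span (?mon ` R L)" for L
    unfolding V_def
  proof (rule vs.span_minimal)
    show "?mon ` {e. ?wt e \<le> L} \<subseteq> vs.span (?mon ` R L)"
    proof safe
      fix e assume "?wt e \<le> L"
      from subsetD[OF Rmono[OF this] red] show "?mon e \<in> vs.span (?mon ` R L)" .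
    qed
  qed simp
  have Vmono: "V L \<subseteq> V L'" if "L \<le> L'" for L L'
    unfolding V_def using that by (intro vs.span_mono image_mono) auto
  have Vmult: "a * b \<in> V (L + L')" if a: "a \<in> V L" and b: "b \<in> V L'" for a b L L'
  proof -
    have 1: "?mon d * b \<in> V (L + L')" if d: "?wt d \<le> L" for d
      using b unfolding V_def
    proof (induction rule: vs.span_induct_alt)
      case (step c b' y)
      then obtain e where e: "b' = ?mon e" "?wt e \<le> L'" by blast
      have "?mon (tadd d e) \<in> vs.span (?mon ` {e. ?wt e \<le> L + L'})"
        using d e by (intro vs.span_base imageI) (simp add: twt_tadd)
      then have "sc c * ?mon (tadd d e) + ?mon d * y \<in> vs.span (?mon ` {e. ?wt e \<le> L + L'})"
        using step by (intro vs.span_add vs.span_scale)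
      then show ?case by (simp add: e mon3_tadd algebra_simps)
    qed (simp add: vs.span_zero)
    from a show ?thesis unfolding V_def
    proof (induction rule: vs.span_induct_alt)
      case (step c a' y)
      then obtain d where d: "a' = ?mon d" "?wt d \<le> L" by blast
      have "sc c * (?mon d * b) + y * b \<in> vs.span (?mon ` {e. ?wt e \<le> L + L'})"
        using step 1[OF d(2)] unfolding V_def by (intro vs.span_add vs.span_scale)
      then show ?case by (simp add: d algebra_simps)
    qed (simp add: vs.span_zero)
  qed
  have monV: "?mon e \<in> V (?wt e)" for e
    unfolding V_def by (intro vs.span_base imageI) simp
  define W where "W = (\<Union>L. V L)"
  have one: "1 \<in> V L" for L
    using subsetD[OF Vmono[of 0 L] monV[of "(0, 0, 0)", unfolded twt_def, simplified]] by (simp add: mon3_def)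
  have "x1 \<in> W \<and> x2 \<in> W \<and> x3 \<in> W"
  proof (rule gen)
    have "sc c * ?mon (0, 0, 0) \<in> V 0" for c
      unfolding V_def by (intro vs.span_scale vs.span_base imageI) (simp add: twt_def)
    then have "sc c \<in> W" for c unfolding W_def by (auto simp: mon3_def)
    then show "range sc \<subseteq> W" by blast
    have monW: "?mon e \<in> W" for e unfolding W_def using monV by (rule UN_I[OF UNIV_I])
    show "u \<in> W" "v \<in> W" "w \<in> W"
      using monW[of "(1, 0, 0)"] monW[of "(0, 1, 0)"] monW[of "(0, 0, 1)"] by (simp_all add: mon3_def)
    fix a b assume "a \<in> W" "b \<in> W"
    then obtain L L' where L: "a \<in> V L" "b \<in> V L'" by (auto simp: W_def)
    from Vmult[OF this] show "a * b \<in> W" unfolding W_def by (rule UN_I[OF UNIV_I])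
    have "a \<in> V (max L L')" "b \<in> V (max L L')"
      using L subsetD[OF Vmono[of L "max L L'"]] subsetD[OF Vmono[of L' "max L L'"]] by simp_all
    then have "a + b \<in> V (max L L')" unfolding V_def by (rule vs.span_add)
    then show "a + b \<in> W" unfolding W_def by (rule UN_I[OF UNIV_I])
  qed
  then obtain r1 r2 r3 where "x1 \<in> V r1" "x2 \<in> V r2" "x3 \<in> V r3" by (auto simp: W_def)
  moreover define r where "r = r1 + r2 + r3"
  ultimately have x: "x1 \<in> V r" "x2 \<in> V r" "x3 \<in> V r"
    using subsetD[OF Vmono[of r1 r]] subsetD[OF Vmono[of r2 r]] subsetD[OF Vmono[of r3 r]] by simp_all
  have pow: "a ^ i \<in> V (i * r)" if "a \<in> V r" for a i
  proof (induction i)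
    case (Suc i)
    then show ?case using Vmult[OF that Suc] by simp
  qed (use one[of 0] in simp)
  define C where "C = fst \<mu> + fst (snd \<mu>) + snd (snd \<mu>)"
  \<comment> \<open>With L = 3 n r, which bounds the weight of the monomials in x1, x2, x3 with
    exponents up to n, this choice gives C (L + 1)^2 \<le> C (3 r + 1)^2 (n + 1)^2 = n (n + 1)^2,
    less than the number (n + 1)^3 of these monomials.\<close>
  define n where "n = C * (3 * r + 1) ^ 2"
  define L where "L = 3 * (n * r)"
  define E where "E = {..n} \<times> {..n} \<times> {..n}"
  let ?X = "mon3 x1 x2 x3"
  have E: "finite E" "card E = (n + 1) ^ 3" by (simp_all add: E_def card_cartesian_product power3_eq_cube)
  have XV: "?X e \<in> vs.span (?mon ` R L)" if "e \<in> E" for e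
  proof -
    have "fst e * r \<le> n * r" "fst (snd e) * r \<le> n * r" "snd (snd e) * r \<le> n * r"
      using that by (auto simp: E_def)
    then have "fst e * r + fst (snd e) * r + snd (snd e) * r \<le> L" unfolding L_def by linarith
    moreover have "?X e \<in> V (fst e * r + fst (snd e) * r + snd (snd e) * r)"
      unfolding mon3_def by (intro Vmult pow x)
    ultimately show ?thesis using subsetD[OF VR subsetD[OF Vmono]] by metis
  qed
  have inj: "inj_on ?X E"
  proof (rule inj_onI)
    fix d e assume de: "?X d = ?X e"
    show "d = e"
    proof (rule ccontr)
      assume ne: "d \<noteq> e"
      define k' where "k' a = (if a = d then 1 else - 1 :: 'a)" for a
      have "sc (- 1) = - 1" using sc(2)[of "- 1" 1] sc sc0 by (simp add: eq_neg_iff_add_eq_0)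
      then have "(\<Sum>a\<in>{d, e}. sc (k' a) * ?X a) = 0" using ne de sc by (simp add: k'_def)
      then have "k' d = 0" by (intro indep3D[OF ind, of "{d, e}"]) simp_all
      then show False by (simp add: k'_def)
    qed
  qed
  have indep: "vs.independent (?X ` E)"
  proof (rule vs.independent_if_scalars_zero)
    show "finite (?X ` E)" using E by simp
    fix g a assume g: "(\<Sum>a\<in>?X ` E. sc (g a) * a) = 0" "a \<in> ?X ` E"
    have "(\<Sum>e\<in>E. sc (g (?X e)) * ?X e) = 0" using g(1) by (simp add: sum.reindex[OF inj])
    then have "\<forall>e\<in>E. g (?X e) = 0"
      using indep3D[OF ind E(1), of "\<lambda>e. g (?X e)"] by simp
    then show "g a = 0" using g(2) by auto
  qed
  \<comment> \<open>Not being divisible by \<mu> means that some exponent is below that of \<mu>: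
    three slabs of fixed thickness.\<close>
  have Rsub: "R L \<subseteq> ({..<fst \<mu>} \<times> {..L} \<times> {..L}) \<union> ({..L} \<times> {..<fst (snd \<mu>)} \<times> {..L})
      \<union> ({..L} \<times> {..L} \<times> {..<snd (snd \<mu>)})" (is "_ \<subseteq> ?U")
  proof
    fix e assume "e \<in> R L"
    then have "?wt e \<le> L" "\<not> tle \<mu> e" by (auto simp: R_def)
    moreover have "fst e \<le> L" "fst (snd e) \<le> L" "snd (snd e) \<le> L"
      using twt_bound[OF N, of e] \<open>?wt e \<le> L\<close> by auto
    ultimately show "e \<in> ?U" by (cases e) (auto simp: tle_def)
  qed
  have "finite ?U" by simp
  then have Rfin: "finite (R L)" by (rule finite_subset[OF Rsub])
  have "card (R L) \<le> card ?U" by (rule card_mono[OF \<open>finite ?U\<close> Rsub])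
  also have "\<dots> \<le> fst \<mu> * (L + 1) ^ 2 + fst (snd \<mu>) * (L + 1) ^ 2 + snd (snd \<mu>) * (L + 1) ^ 2"
    by (intro order_trans[OF card_Un_le] add_le_mono)
       (simp_all add: card_cartesian_product power2_eq_square algebra_simps)
  also have "\<dots> = C * (L + 1) ^ 2" by (simp add: C_def algebra_simps)
  finally have cR: "card (R L) \<le> C * (L + 1) ^ 2" .
  have "card (?X ` E) \<le> card (?mon ` R L)"
    using vs.independent_span_bound[of "?mon ` R L" "?X ` E"] indep Rfin XV by blast
  then have "(n + 1) ^ 3 \<le> C * (L + 1) ^ 2"
    using E card_image[OF inj] card_image_le[OF Rfin, of ?mon] cR by simp
  also have "\<dots> \<le> C * ((3 * r + 1) * (n + 1)) ^ 2"
    by (intro mult_le_mono2 power_mono) (simp_all add: L_def algebra_simps)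
  also have "\<dots> = n * (n + 1) ^ 2" by (simp only: power_mult_distrib mult.assoc n_def)
  finally have "(n + 1) * (n + 1) ^ 2 \<le> n * (n + 1) ^ 2" by (simp only: power3_eq_cube power2_eq_square mult.assoc)
  then have "n + 1 \<le> n" by (rule mult_le_cancel2[THEN iffD1, THEN mp]) simp
  then show False by simp
qed

section \<open>Hasse derivatives\<close>

text \<open>The coefficient of T^i in P(X + T), where \<open>[:[:0, 1:], 1:]\<close> is X + T with T
  outermost. Taylor coefficients involve no division by factorials and make sense in every
  characteristic.\<close>

definition hasse :: "nat \<Rightarrow> 'r::comm_ring_1 poly \<Rightarrow> 'r poly" where
  "hasse i P = coeff (poly (map_poly (\<lambda>c. [:[:c:]:]) P) [:[:0, 1:], 1:]) i"

lemma hasse_0 [simp]: "hasse i 0 = 0" by (simp add: hasse_def)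

lemma hasse_taylor_pCons:
  "poly (map_poly (\<lambda>c. [:[:c:]:]) (pCons c P)) [:[:0, 1:], 1:]
    = [:[:c:]:] + [:[:0, 1:], 1:] * poly (map_poly (\<lambda>c. [:[:c:]:]) P) [:[:0, 1 :: 'r::comm_ring_1:], 1:]"
  by (cases "c = 0 \<and> P = 0") (auto simp: map_poly_pCons)

lemma hasse_taylor_mult:
  fixes P Q :: "'r::comm_ring_1 poly"
  defines "T \<equiv> \<lambda>P. poly (map_poly (\<lambda>c. [:[:c:]:]) P) [:[:0, 1 :: 'r:], 1:]"
  shows "T (P + Q) = T P + T Q" "T (P * Q) = T P * T Q"
proof -
  define Z where "Z = [:[:0, 1 :: 'r:], 1:]"
  have pC: "T (pCons c P) = [:[:c:]:] + Z * T P" for c P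
    unfolding T_def Z_def by (rule hasse_taylor_pCons)
  have T0: "T 0 = 0" by (simp add: T_def)
  have c_add: "[:[:a + b:]:] = [:[:a:]:] + [:[:b:]:]" and c_mult: "[:[:a * b:]:] = [:[:a:]:] * [:[:b:]:]" for a b :: 'r
    by simp_all
  have add: "T (P + Q) = T P + T Q" for P Q
  proof (induction P arbitrary: Q rule: pCons_induct)
    case (pCons a P)
    obtain b Q' where "Q = pCons b Q'" by (cases Q)
    then show ?case by (simp only: add_pCons pC pCons.IH c_add distrib_left add_ac)
  qed (simp add: T0)
  have smult: "T (smult c P) = [:[:c:]:] * T P" for c P
  proof (induction P rule: pCons_induct)
    case (pCons a P)
    then show ?case by (simp only: smult_pCons pC c_mult distrib_left mult.left_commute)
  qed (simp add: T0)
  show "T (P + Q) = T P + T Q" by (rule add)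
  show "T (P * Q) = T P * T Q"
  proof (induction P rule: pCons_induct)
    case (pCons a P)
    have "pCons a P * Q = smult a Q + pCons 0 (P * Q)" by simp
    then have "T (pCons a P * Q) = [:[:a:]:] * T Q + ([:[:0:]:] + Z * (T P * T Q))"
      by (simp only: add smult pC pCons.IH)
    also have "\<dots> = T (pCons a P) * T Q" by (simp only: pC) (simp add: algebra_simps)
    finally show ?case .
  qed (simp add: T0)
qed

lemma hasse_add: "hasse i (P + Q) = hasse i P + hasse i Q"
  unfolding hasse_def hasse_taylor_mult by simp

lemma hasse_mult: "hasse i (P * Q) = (\<Sum>j\<le>i. hasse j P * hasse (i - j) Q)"
  unfolding hasse_def hasse_taylor_mult coeff_mult ..

lemma coeff_hasse: "coeff (hasse i P) n = of_nat (n + i choose i) * coeff P (n + i)"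
proof (induction P arbitrary: i n rule: pCons_induct)
  case (pCons c P)
  have *: "hasse i (pCons c P) = (if i = 0 then [:c:] else 0) + pCons 0 (hasse i P) + (if i = 0 then 0 else hasse (i - 1) P)"
    unfolding hasse_def hasse_taylor_pCons
    by (cases i) simp_all
  show ?case
  proof (cases i)
    case 0
    then show ?thesis unfolding * using pCons.IH[of 0] by (cases n) simp_all
  next
    case (Suc j)
    show ?thesis
    proof (cases n)
      case 0
      then show ?thesis unfolding * using Suc pCons.IH[of j 0] by simp
    next
      case (Suc n')
      have "coeff (hasse i (pCons c P)) n = of_nat (n' + i choose i) * coeff P (n' + i) + of_nat (n + j choose j) * coeff P (n + j)"
        unfolding * using Suc \<open>i = Suc j\<close> by (simp add: pCons.IH)
      also have "n + j = n' + i" using Suc \<open>i = Suc j\<close> by simp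
      also have "of_nat (n' + i choose i) * coeff P (n' + i) + of_nat (n' + i choose j) * coeff P (n' + i)
          = of_nat (n + i choose i) * coeff P (n' + i)"
        using Suc \<open>i = Suc j\<close> by (simp add: algebra_simps)
      finally show ?thesis using Suc by simp
    qed
  qed
qed simp

text \<open>The identity binom(n+i+j, j) binom(n+i, i) = binom(n+i+j, i+j) binom(i+j, i) is the
  coaction property of translations.\<close>

lemma hasse_hasse: "hasse i (hasse j P) = of_nat (i + j choose i) * hasse (i + j) P"
proof (rule poly_eqI)
  fix n
  have "(n + i + j choose j) * (n + i choose i) = (n + (i + j) choose (i + j)) * (i + j choose i)"
    using choose_mult[of j "i + j" "n + (i + j)"] binomial_symmetric[of i "i + j"]
    by (simp add: add_ac mult_ac)
  then have "of_nat (n + i choose i) * of_nat (n + i + j choose j)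
      = (of_nat (i + j choose i) * of_nat (n + (i + j) choose (i + j)) :: 'a)"
    by (metis mult.commute of_nat_mult)
  then show "coeff (hasse i (hasse j P)) n = coeff (of_nat (i + j choose i) * hasse (i + j) P) n"
    by (simp add: coeff_hasse of_nat_poly add_ac flip: mult.assoc)
qed

lemma hasse_id [simp]: "hasse 0 P = P"
  by (rule poly_eqI) (simp add: coeff_hasse)

lemma hasse_large: "i > degree P \<Longrightarrow> hasse i P = 0"
  by (rule poly_eqI) (simp add: coeff_hasse coeff_eq_0)

lemma hasse_const: "i > 0 \<Longrightarrow> hasse i [:c:] = 0"
  by (rule hasse_large) simp

section \<open>Translations of a polynomial ring\<close>

definition rhom :: "('a::comm_ring_1 \<Rightarrow> 'b::comm_ring_1) \<Rightarrow> bool" where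
  "rhom h \<longleftrightarrow> h 1 = 1 \<and> (\<forall>a b. h (a + b) = h a + h b) \<and> (\<forall>a b. h (a * b) = h a * h b)"

lemma rhomD: "rhom h \<Longrightarrow> h 1 = 1" "rhom h \<Longrightarrow> h (a + b) = h a + h b"
  "rhom h \<Longrightarrow> h (a * b) = h a * h b"
  by (simp_all add: rhom_def)

lemma rhom_0: "rhom h \<Longrightarrow> h 0 = 0"
  using rhomD(2)[of h 0 0] by (simp only: add_0 add_cancel_right_right)

lemma rhom_of_nat: "rhom h \<Longrightarrow> h (of_nat n) = of_nat n"
  by (induction n) (simp_all add: rhom_0 rhomD)

lemma rhom_sum: "rhom h \<Longrightarrow> h (sum F I) = (\<Sum>i\<in>I. h (F i))"
  by (induction I rule: infinite_finite_induct) (simp_all add: rhom_0 rhomD)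

definition evh :: "('a::comm_ring_1 \<Rightarrow> 'b::comm_ring_1) \<Rightarrow> 'b \<Rightarrow> 'a poly \<Rightarrow> 'b" where
  "evh h a P = poly (map_poly h P) a"

lemma evh_0 [simp]: "evh h a 0 = 0" by (simp add: evh_def)

lemma evh_pCons: "rhom h \<Longrightarrow> evh h a (pCons c P) = h c + a * evh h a P"
  by (cases "c = 0 \<and> P = 0") (auto simp: evh_def map_poly_pCons rhom_0)

lemma rhom_evh:
  assumes h: "rhom h"
  shows "rhom (evh h a)"
proof -
  have add: "evh h a (P + Q) = evh h a P + evh h a Q" for P Q
  proof (induction P arbitrary: Q rule: pCons_induct)
    case (pCons c P)
    obtain d Q' where "Q = pCons d Q'" by (cases Q)
    then show ?case by (simp add: evh_pCons h pCons.IH rhomD algebra_simps)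
  qed simp
  have smult: "evh h a (smult c P) = h c * evh h a P" for c P
    by (induction P rule: pCons_induct) (simp_all add: evh_pCons h rhomD algebra_simps)
  have "evh h a (P * Q) = evh h a P * evh h a Q" for P Q
    by (induction P rule: pCons_induct) (simp_all add: add smult evh_pCons h rhom_0 algebra_simps)
  moreover have "evh h a 1 = 1"
    using evh_pCons[OF h, of a 1 0] h by (simp add: rhomD)
  ultimately show ?thesis using add by (simp add: rhom_def)
qed

lemma evh_sum:
  assumes "rhom h" "degree P \<le> n"
  shows "evh h a P = (\<Sum>i\<le>n. h (coeff P i) * a ^ i)"
proof -
  have "degree (map_poly h P) \<le> n" using assms degree_map_poly_le order_trans by blast
  then have "evh h a P = (\<Sum>i\<le>n. coeff (map_poly h P) i * a ^ i)"
    unfolding evh_def poly_altdef by (intro sum.mono_neutral_left) (auto simp: coeff_eq_0)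
  then show ?thesis using assms by (simp add: coeff_map_poly rhom_0)
qed

lemma evh_in_subring:
  assumes "rhom h" "range h \<subseteq> S" "a \<in> S"
    "\<And>a b. a \<in> S \<Longrightarrow> b \<in> S \<Longrightarrow> a + b \<in> S" "\<And>a b. a \<in> S \<Longrightarrow> b \<in> S \<Longrightarrow> a * b \<in> S"
  shows "evh h a P \<in> S"
proof (induction P rule: pCons_induct)
  case 0
  have "h 0 \<in> S" using assms by blast
  then show ?case using assms by (simp add: rhom_0)
next
  case (pCons c P)
  have "h c \<in> S" using assms by blast
  then show ?case using assms(3-5) pCons.IH by (simp add: evh_pCons[OF assms(1)])
qed

text \<open>The nesting puts \<open>v\<close> outermost, so that Hasse derivatives act in
  \<open>v\<close> with \<open>u\<close> and \<open>w\<close> as constants. Injectivity is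
  \<open>indep3\<close> applied to all coefficients up to a common degree bound.\<close>

lemma evh3_inj:
  fixes h :: "'a::field \<Rightarrow> 'r::comm_ring_1"
  assumes h: "rhom h" and ind: "indep3 h u v w" and P: "evh (evh (evh h w) u) v P = 0"
  shows "P = 0"
proof -
  define B where "B p = degree p + (\<Sum>j\<le>degree p. degree (coeff p j))" for p :: "'a poly poly"
  define n where "n = degree P + (\<Sum>i\<le>degree P. B (coeff P i))"
  have Bp: "degree p \<le> B p" "degree (coeff p j) \<le> B p" for p j
  proof -
    show "degree (coeff p j) \<le> B p"
    proof (cases "j \<le> degree p")
      case True
      then show ?thesis using member_le_sum[of j "{..degree p}" "\<lambda>j. degree (coeff p j)"] by (simp add: B_def)
    qed (simp add: coeff_eq_0)
  qed (simp add: B_def)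
  have Bn: "B (coeff P i) \<le> n" for i
  proof (cases "i \<le> degree P")
    case True
    then show ?thesis using member_le_sum[of i "{..degree P}" "\<lambda>i. B (coeff P i)"] by (simp add: n_def)
  qed (simp add: coeff_eq_0 B_def)
  have n: "degree P \<le> n" "degree (coeff P i) \<le> n" "degree (coeff (coeff P i) j) \<le> n" for i j
    using order_trans[OF Bp(1) Bn] order_trans[OF Bp(2) Bn] by (simp_all add: n_def)
  have h1: "rhom (evh h w)" by (rule rhom_evh[OF h])
  then have h2: "rhom (evh (evh h w) u)" by (rule rhom_evh)
  let ?k = "\<lambda>e. coeff (coeff (coeff P (fst (snd e))) (fst e)) (snd (snd e))"
  let ?E = "{..n} \<times> {..n} \<times> {..n}"
  have "0 = (\<Sum>i\<le>n. (\<Sum>j\<le>n. (\<Sum>l\<le>n. h (?k (j, i, l)) * w ^ l) * u ^ j) * v ^ i)"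
    using P by (simp add: evh_sum[OF h2 n(1)] evh_sum[OF h1 n(2)] evh_sum[OF h n(3)])
  also have "\<dots> = (\<Sum>i\<le>n. \<Sum>j\<le>n. \<Sum>l\<le>n. h (?k (j, i, l)) * mon3 u v w (j, i, l))"
    by (simp add: sum_distrib_right sum_distrib_left mon3_def mult_ac)
  also have "\<dots> = (\<Sum>j\<le>n. \<Sum>i\<le>n. \<Sum>l\<le>n. h (?k (j, i, l)) * mon3 u v w (j, i, l))"
    by (rule sum.swap)
  also have "\<dots> = (\<Sum>e\<in>?E. h (?k e) * mon3 u v w e)"
    by (simp add: sum.cartesian_product split_def)
  finally have "\<And>e. e \<in> ?E \<Longrightarrow> ?k e = 0"
    using indep3D[OF ind, of ?E ?k] by simp
  then have z: "coeff (coeff (coeff P i) j) l = 0" if "i \<le> n" "j \<le> n" "l \<le> n" for i j l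
    using that by force
  have "coeff (coeff (coeff P i) j) l = 0" for i j l
  proof (cases "i \<le> n \<and> j \<le> n \<and> l \<le> n")
    case False
    then show ?thesis
      using n(1) n(2)[of i] n(3)[of i j] coeff_eq_0[of P i] coeff_eq_0[of "coeff P i" j]
        coeff_eq_0[of "coeff (coeff P i) j" l] by fastforce
  qed (use z in blast)
  then show ?thesis by (simp add: poly_eq_iff)
qed

context asanuma
begin

definition sc :: "'a \<Rightarrow> 'a laurent" where "sc c = emb (cst c)"

lemma rhom_sc: "rhom sc"
  by (simp add: rhom_def sc_def cst_add cst_mult emb_add emb_mult)

text \<open>The partial translation \<open>v \<mapsto> v + T\<close> of \<open>A = k[u,v,w]\<close>.\<close>

lemma variable_if_polynomial_ring:
  assumes char: "CHAR('a) > 0" and uvw: "u \<in> A" "v \<in> A" "w \<in> A"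
    and gen: "\<And>W. range sc \<subseteq> W \<Longrightarrow> u \<in> W \<Longrightarrow> v \<in> W \<Longrightarrow> w \<in> W \<Longrightarrow>
      (\<And>a b. a \<in> W \<Longrightarrow> b \<in> W \<Longrightarrow> a + b \<in> W) \<Longrightarrow> (\<And>a b. a \<in> W \<Longrightarrow> b \<in> W \<Longrightarrow> a * b \<in> W) \<Longrightarrow> A \<subseteq> W"
    and ind: "indep3 sc u v w" and pole: "e < 0" "lookup u e \<noteq> 0"
  shows "\<exists>g. subalgebra2 f g = UNIV"
proof -
  let ?E = "evh (evh (evh sc w) u) v"
  have h1: "rhom (evh sc w)" by (rule rhom_evh[OF rhom_sc])
  then have h2: "rhom (evh (evh sc w) u)" by (rule rhom_evh)
  then have h3: "rhom ?E" by (rule rhom_evh)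
  have inj: "P = Q" if "?E P = ?E Q" for P Q
  proof -
    have "?E (P + (- Q)) = ?E P + ?E (- Q)" by (rule rhomD[OF h3])
    also have "\<dots> = ?E (Q + (- Q))" using that rhomD(2)[OF h3, of Q "- Q"] by simp
    finally have "?E (P + (- Q)) = 0" by simp
    then have "P + (- Q) = 0" by (rule evh3_inj[OF rhom_sc ind])
    then show ?thesis by simp
  qed
  have scA: "range sc \<subseteq> A" by (auto simp: sc_def)
  have EA: "?E P \<in> A" for P
  proof -
    have "range (evh sc w) \<subseteq> A"
      using evh_in_subring[OF rhom_sc scA uvw(3)] A_add A_mult by blast
    then have "range (evh (evh sc w) u) \<subseteq> A"
      using evh_in_subring[OF h1 _ uvw(1)] A_add A_mult by blast
    then show ?thesis using evh_in_subring[OF h2 _ uvw(2)] A_add A_mult by blast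
  qed
  have E_c: "?E [:[:[:c:]:]:] = sc c" for c
    by (simp add: evh_pCons h1 h2 rhom_sc)
  have E_u: "?E [:[:0, 1:]:] = u" and E_v: "?E [:0, 1:] = v" and E_w: "?E [:[:[:0, 1:]:]:] = w"
    using rhomD(1)[OF h1] rhomD(1)[OF h2] rhomD(1)[OF h3] rhomD(1)[OF rhom_sc]
    by (simp_all add: evh_pCons h1 h2 rhom_sc rhom_0)
  have "A \<subseteq> range ?E"
  proof (rule gen)
    show "range sc \<subseteq> range ?E" using E_c by (metis image_subsetI rangeI)
    show "u \<in> range ?E" "v \<in> range ?E" "w \<in> range ?E"
      using E_u E_v E_w by (metis rangeI)+
    fix a b assume "a \<in> range ?E" "b \<in> range ?E"
    then obtain P Q where "a = ?E P" "b = ?E Q" by blast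
    then have "a + b = ?E (P + Q)" "a * b = ?E (P * Q)" by (simp_all add: rhomD[OF h3])
    then show "a + b \<in> range ?E" "a * b \<in> range ?E" by blast+
  qed
  then have surj: "\<exists>P. a = ?E P" if "a \<in> A" for a using that by blast
  define D where "D i a = ?E (hasse i (inv_into UNIV ?E a))" for i a
  have DE: "D i (?E P) = ?E (hasse i P)" for i P
    unfolding D_def using inj by (simp add: inv_f_f injI)
  have exp: "exp_map A D"
  proof
    show "D i a \<in> A" for i a unfolding D_def by (rule EA)
    fix a assume "a \<in> A"
    then obtain P where P: "a = ?E P" using surj by blast
    show "D 0 a = a" unfolding P DE by simp
    show "D i (D j a) = of_nat (i + j choose i) * D (i + j) a" for i j
      unfolding P DE by (simp add: hasse_hasse rhomD[OF h3] rhom_of_nat[OF h3])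
    show "\<exists>N. \<forall>i>N. D i a = 0"
      unfolding P DE by (intro exI[of _ "degree P"]) (simp add: hasse_large)
    fix b assume "b \<in> A"
    then obtain Q where Q: "b = ?E Q" using surj by blast
    show "D i (a + b) = D i a + D i b" for i
      unfolding P Q rhomD(2)[OF h3, symmetric] DE by (simp add: hasse_add)
    show "D i (a * b) = (\<Sum>j\<le>i. D j a * D (i - j) b)" for i
      unfolding P Q rhomD(3)[OF h3, symmetric] DE by (simp add: hasse_mult rhom_sum[OF h3])
  qed (simp_all add: A_1 A_add A_mult A_uminus)
  interpret E: exp_map A D by (rule exp)
  have const: "?E [:c:] \<in> E.Inv" for c
    by (intro E.InvI EA) (simp add: DE hasse_const)
  have ex: "asanuma_exp f \<psi> q m D"
  proof unfold_locales
    show "emb (cst c) \<in> E.Inv" for c using const[of "[:[:c:]:]"] E_c by (simp add: sc_def)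
  qed
  have "u \<in> E.Inv" using const[of "[:0, 1:]"] E_u by simp
  moreover have "\<not> A \<subseteq> E.Inv"
  proof
    assume "A \<subseteq> E.Inv"
    then have "D 1 v = 0" using uvw(2) E.InvD(3)[of v 1] by auto
    then have "?E (hasse 1 [:0, 1:]) = ?E 0" using DE[of 1 "[:0, 1:]"] E_v by simp
    then have "hasse 1 [:0, 1 :: 'a poly poly:] = 0" by (rule inj)
    then have "coeff (hasse 1 [:0, 1 :: 'a poly poly:]) 0 = 0" by simp
    then show False by (simp add: coeff_hasse)
  qed
  ultimately show ?thesis
    using asanuma_exp.variable_if_invariant_with_pole[OF ex char _ _ pole] by blast
qed

end

section \<open>Positive gradings\<close>

text \<open>Finite sums of products of two elements; this is the square of M as soon as M is an
  ideal.\<close>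

inductive_set ideal_square :: "'r::comm_ring_1 set \<Rightarrow> 'r set" for M where
  zero [intro]: "0 \<in> ideal_square M"
| step: "p \<in> M \<Longrightarrow> q \<in> M \<Longrightarrow> s \<in> ideal_square M \<Longrightarrow> p * q + s \<in> ideal_square M"

lemma ideal_square_mult: "p \<in> M \<Longrightarrow> q \<in> M \<Longrightarrow> p * q \<in> ideal_square M"
  using ideal_square.step[OF _ _ ideal_square.zero] by simp

lemma ideal_square_add: "a \<in> ideal_square M \<Longrightarrow> b \<in> ideal_square M \<Longrightarrow> a + b \<in> ideal_square M"
  by (induction a rule: ideal_square.induct) (simp_all add: add.assoc ideal_square.step)

context asanuma
begin

definition xz :: "'a laurent" where "xz = emb [:0, 1:]"
definition xt :: "'a laurent" where "xt = emb [:[:0, 1:]:]"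

lemma sc_add: "sc (a + b) = sc a + sc b" and sc_mult: "sc (a * b) = sc a * sc b"
  and sc_diff: "sc (a - b) = sc a - sc b" and sc_0 [simp]: "sc 0 = 0" and sc_1 [simp]: "sc 1 = 1" and sc_uminus: "sc (- a) = - sc a"
  using rhomD[OF rhom_sc] rhom_0[OF rhom_sc] by (simp_all add: sc_def cst_uminus emb_uminus cst_diff single_diff)

lemma sc_eq_0_iff [simp]: "sc a = 0 \<longleftrightarrow> a = 0"
proof
  assume "sc a = 0"
  then have "lookup (sc a) 0 = 0" by simp
  then show "a = 0" by (simp add: sc_def)
qed simp

lemma sc_in_A [simp]: "sc a \<in> A" by (simp add: sc_def)

lemma mon3_x_z_t: "mon3 x xz xt e = sg (int (fst e)) (mono (snd e))"
proof -
  have 1: "[:[:0, 1 :: 'a:]:] ^ n = [:monom 1 n:]" for n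
    by (induction n) (simp_all add: monom_Suc)
  have 2: "[:0, 1 :: 'a poly:] ^ n = monom 1 n" for n
    by (induction n) (simp_all add: monom_Suc)
  have "[:0, 1 :: 'a poly:] ^ i * [:[:0, 1:]:] ^ j = mono (i, j)" for i j
    unfolding 1 2 by (simp add: mono_def smult_monom)
  then show ?thesis
    by (cases e) (simp add: mon3_def x_def xz_def xt_def sg_power mult_single)
qed

lemma indep3_x_z_t: "indep3 sc x xz xt"
  unfolding indep3_def
proof (intro allI impI ballI)
  fix F k e
  assume F: "finite F" "(\<Sum>e\<in>F. sc (k e) * mon3 x xz xt e) = 0" and e: "e \<in> F"
  have "0 = cf (lookup (\<Sum>e\<in>F. sc (k e) * mon3 x xz xt e) (int (fst e))) (snd e)"
    using F(2) by simp
  also have "\<dots> = (\<Sum>d\<in>F. if d = e then k e else 0)"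
    unfolding lookup_sum cf_sum
    by (intro sum.cong refl)
       (auto simp: mon3_x_z_t sc_def mult_single lookup_sg cf_cst_mult cf_mono prod_eq_iff)
  also have "\<dots> = k e" using F e by simp
  finally show "k e = 0" ..
qed

lemma A_subset_if_gens:
  assumes "range sc \<subseteq> W" "x \<in> W" "y \<in> W" "xz \<in> W" "xt \<in> W"
    and add: "\<And>a b. a \<in> W \<Longrightarrow> b \<in> W \<Longrightarrow> a + b \<in> W" and mult: "\<And>a b. a \<in> W \<Longrightarrow> b \<in> W \<Longrightarrow> a * b \<in> W"
  shows "A \<subseteq> W"
proof
  fix a assume a: "a \<in> A"
  have scW: "sc c \<in> W" for c using assms(1) by blast
  have sg: "sg e c \<in> W" if "sg e c \<in> A" for e c
    by (rule sg_induct[OF that, of "\<lambda>_ a. a \<in> W"])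
       (use assms scW in \<open>simp_all add: emb_add sc_def xz_def xt_def\<close>)
  show "a \<in> W" using a by (induction a rule: A_induct) (use scW[of 0] sg add in auto)
qed

text \<open>The generators are independent since they reach the independent elements x, z, t. One of
  them has a pole: otherwise they would generate only elements without negative powers of x, and not
  y. They enter symmetrically, so the one with the pole may take the place of
  \<open>u\<close>.\<close>

lemma variable_if_generators:
  assumes char: "CHAR('a) > 0" and uvw: "u \<in> A" "v \<in> A" "w \<in> A"
    and gen: "\<And>W. range sc \<subseteq> W \<Longrightarrow> u \<in> W \<Longrightarrow> v \<in> W \<Longrightarrow> w \<in> W \<Longrightarrow>
      (\<And>a b. a \<in> W \<Longrightarrow> b \<in> W \<Longrightarrow> a + b \<in> W) \<Longrightarrow> (\<And>a b. a \<in> W \<Longrightarrow> b \<in> W \<Longrightarrow> a * b \<in> W) \<Longrightarrow> A \<subseteq> W"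
  shows "\<exists>g. subalgebra2 f g = UNIV"
proof -
  have main: "\<exists>g. subalgebra2 f g = UNIV"
    if pole: "e < 0" "lookup u' e \<noteq> 0" and uvw': "u' \<in> A" "v' \<in> A" "w' \<in> A"
      and gen': "\<And>W. range sc \<subseteq> W \<Longrightarrow> u' \<in> W \<Longrightarrow> v' \<in> W \<Longrightarrow> w' \<in> W \<Longrightarrow>
      (\<And>a b. a \<in> W \<Longrightarrow> b \<in> W \<Longrightarrow> a + b \<in> W) \<Longrightarrow> (\<And>a b. a \<in> W \<Longrightarrow> b \<in> W \<Longrightarrow> a * b \<in> W) \<Longrightarrow> A \<subseteq> W"
    for u' v' w' e
  proof (rule variable_if_polynomial_ring[OF char uvw' _ _ pole])
    show "A \<subseteq> W" if "range sc \<subseteq> W" "u' \<in> W" "v' \<in> W" "w' \<in> W"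
      "\<And>a b. a \<in> W \<Longrightarrow> b \<in> W \<Longrightarrow> a + b \<in> W" "\<And>a b. a \<in> W \<Longrightarrow> b \<in> W \<Longrightarrow> a * b \<in> W" for W
      using that by (rule gen')
    have "x \<in> W \<and> xz \<in> W \<and> xt \<in> W" if "range sc \<subseteq> W" "u' \<in> W" "v' \<in> W" "w' \<in> W"
      "\<And>a b. a \<in> W \<Longrightarrow> b \<in> W \<Longrightarrow> a + b \<in> W" "\<And>a b. a \<in> W \<Longrightarrow> b \<in> W \<Longrightarrow> a * b \<in> W" for W
    proof -
      have "A \<subseteq> W" using that by (rule gen')
      moreover have "xz \<in> A" "xt \<in> A" by (simp_all add: xz_def xt_def)
      ultimately show ?thesis using x_in_A by blast
    qed
    then show "indep3 sc u' v' w'"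
      by (intro indep3_of_generators[OF _ _ _ _ indep3_x_z_t]) (simp_all add: sc_add sc_mult)
  qed
  have "\<exists>e<0. lookup u e \<noteq> 0 \<or> lookup v e \<noteq> 0 \<or> lookup w e \<noteq> 0"
  proof (rule ccontr)
    assume no: "\<not> ?thesis"
    define W where "W = {a :: 'a laurent. \<forall>e<0. lookup a e = 0}"
    have "A \<subseteq> W"
    proof (rule gen)
      show "range sc \<subseteq> W" "u \<in> W" "v \<in> W" "w \<in> W"
        using no by (auto simp: W_def sc_def lookup_sg)
      show "a + b \<in> W" if "a \<in> W" "b \<in> W" for a b using that by (simp add: W_def lookup_add)
      show "a * b \<in> W" if "a \<in> W" "b \<in> W" for a b
      proof -
        have "i + j \<ge> 0" if "i \<in> keys a" "j \<in> keys b" for i j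
        proof -
          have "i \<ge> 0" "j \<ge> 0"
            using \<open>a \<in> W\<close> \<open>b \<in> W\<close> that by (auto simp: W_def in_keys_iff not_less[symmetric])
          then show ?thesis by simp
        qed
        then show ?thesis
          unfolding W_def mem_Collect_eq laurent_mult_expand[of a b] lookup_sum lookup_sg
          by (intro allI impI sum.neutral ballI) force
      qed
    qed
    then have "y \<in> W" using y_in_A by blast
    then have "lookup y (- int m) = 0" using m_ge_2 by (simp add: W_def)
    then show False by (simp add: y_def)
  qed
  then obtain e where e: "e < 0" "lookup u e \<noteq> 0 \<or> lookup v e \<noteq> 0 \<or> lookup w e \<noteq> 0" by blast
  from e(2) show ?thesis
  proof (elim disjE)
    assume p: "lookup u e \<noteq> 0"
    show ?thesis by (rule main[OF e(1) p uvw(1,2,3)]) (rule gen)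
  next
    assume p: "lookup v e \<noteq> 0"
    show ?thesis by (rule main[OF e(1) p uvw(2,1,3)]) (rule gen)
  next
    assume p: "lookup w e \<noteq> 0"
    show ?thesis by (rule main[OF e(1) p uvw(3,1,2)]) (rule gen)
  qed
qed

end

text \<open>\<open>c i\<close> is the projection of \<open>A\<close> to the homogeneous component of degree \<open>i\<close>.\<close>

locale graded_asanuma = asanuma +
  fixes B :: "int \<Rightarrow> 'a laurent set" and c :: "int \<Rightarrow> 'a laurent \<Rightarrow> 'a laurent"
  assumes B_A: "a \<in> B i \<Longrightarrow> a \<in> A" and B_0: "0 \<in> B i"
    and B_mult: "a \<in> B i \<Longrightarrow> b \<in> B j \<Longrightarrow> a * b \<in> B (i + j)"
    and B_neg: "i < 0 \<Longrightarrow> B i = {0}" and B_const: "B 0 = range sc"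
    and c_B: "a \<in> A \<Longrightarrow> c i a \<in> B i"
    and c_finite: "a \<in> A \<Longrightarrow> finite {i. c i a \<noteq> 0}"
    and c_sum_eq: "a \<in> A \<Longrightarrow> a = (\<Sum>i | c i a \<noteq> 0. c i a)"
    and c_add: "a \<in> A \<Longrightarrow> b \<in> A \<Longrightarrow> c i (a + b) = c i a + c i b"
    and c_hom: "a \<in> B j \<Longrightarrow> c i a = (if i = j then a else 0)"
begin

lemma c_A: "a \<in> A \<Longrightarrow> c i a \<in> A" using c_B B_A by blast

lemma c_zero [simp]: "c i 0 = 0" using c_hom[OF B_0[of i], of i] by simp

lemma c_neg: "a \<in> A \<Longrightarrow> i < 0 \<Longrightarrow> c i a = 0" using c_B[of a i] B_neg[of i] by simp

lemma A_diff: "a \<in> A \<Longrightarrow> b \<in> A \<Longrightarrow> a - b \<in> A"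
  using A_add[OF _ A_uminus, of a b] by simp

lemma c_diff: "a \<in> A \<Longrightarrow> b \<in> A \<Longrightarrow> c i (a - b) = c i a - c i b"
  using c_add[of "a - b" b i] by (simp add: A_diff)

lemma c_sum: "(\<And>j. j \<in> I \<Longrightarrow> F j \<in> A) \<Longrightarrow> c i (sum F I) = (\<Sum>j\<in>I. c i (F j))"
  by (induction I rule: infinite_finite_induct) (simp_all add: c_add A_sum)

lemma c_mult:
  assumes "a \<in> A" "b \<in> A"
  shows "c n (a * b) = (\<Sum>i | c i a \<noteq> 0. \<Sum>j | c j b \<noteq> 0. if n = i + j then c i a * c j b else 0)"
proof -
  have "a * b = (\<Sum>i | c i a \<noteq> 0. \<Sum>j | c j b \<noteq> 0. c i a * c j b)"
    by (subst c_sum_eq[OF assms(1)], subst c_sum_eq[OF assms(2)], rule sum_product)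
  then have "c n (a * b) = c n (\<Sum>i | c i a \<noteq> 0. \<Sum>j | c j b \<noteq> 0. c i a * c j b)" by simp
  also have "\<dots> = (\<Sum>i | c i a \<noteq> 0. \<Sum>j | c j b \<noteq> 0. c n (c i a * c j b))"
    using assms by (subst c_sum, (intro A_sum A_mult c_A; simp), intro sum.cong refl c_sum A_mult c_A) auto
  also have "\<dots> = (\<Sum>i | c i a \<noteq> 0. \<Sum>j | c j b \<noteq> 0. if n = i + j then c i a * c j b else 0)"
    by (intro sum.cong refl c_hom B_mult c_B assms)
  finally show ?thesis .
qed

definition M where "M = {a \<in> A. c 0 a = 0}"

lemma M_A: "a \<in> M \<Longrightarrow> a \<in> A" by (simp add: M_def)

lemma M_add: "a \<in> M \<Longrightarrow> b \<in> M \<Longrightarrow> a + b \<in> M" by (simp add: M_def A_add c_add)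

lemma M_0: "0 \<in> M" by (simp add: M_def A_0)

lemma M_diff: "a \<in> M \<Longrightarrow> b \<in> M \<Longrightarrow> a - b \<in> M"
  by (simp add: M_def A_diff c_diff)

lemma M_mult: "a \<in> M \<Longrightarrow> b \<in> A \<Longrightarrow> a * b \<in> M"
proof -
  assume a: "a \<in> M" and b: "b \<in> A"
  have "c 0 (a * b) = 0"
    unfolding c_mult[OF M_A[OF a] b]
  proof (intro sum.neutral ballI)
    fix i j assume ij: "i \<in> {i. c i a \<noteq> 0}" "j \<in> {j. c j b \<noteq> 0}"
    then have "i \<ge> 0" "j \<ge> 0" using c_neg M_A[OF a] b by (auto simp: not_less[symmetric])
    moreover have "i \<noteq> 0" using ij(1) a by (auto simp: M_def)
    ultimately show "(if 0 = i + j then c i a * c j b else 0) = 0" by auto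
  qed
  then show ?thesis using M_A[OF a] b by (simp add: M_def A_mult)
qed

lemma sc_in_M_iff: "sc k \<in> M \<longleftrightarrow> k = 0"
proof -
  have "sc k \<in> B 0" using B_const by blast
  then show ?thesis using c_hom[of "sc k" 0 0] by (auto simp: M_def)
qed

lemma const_part:
  assumes "a \<in> A"
  obtains k where "a - sc k \<in> M"
proof -
  obtain k where k: "c 0 a = sc k" using c_B[OF assms, of 0] B_const by auto
  have "sc k \<in> B 0" using B_const by blast
  then have "a - sc k \<in> M" using assms k c_hom[of "sc k" 0 0] by (simp add: M_def A_diff c_diff)
  then show ?thesis by (rule that)
qed

lemma ideal_square_M: "a \<in> ideal_square M \<Longrightarrow> a \<in> M"
  by (induction rule: ideal_square.induct) (auto simp: M_0 M_add M_mult M_A)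

lemma ideal_square_ideal: "a \<in> ideal_square M \<Longrightarrow> b \<in> A \<Longrightarrow> a * b \<in> ideal_square M"
proof (induction rule: ideal_square.induct)
  case (step p q' s)
  have "p * (q' * b) + s * b \<in> ideal_square M" using step by (intro ideal_square.step M_mult) auto
  then show ?case by (simp add: algebra_simps)
qed (simp add: ideal_square.zero)

text \<open>For elements of M, the preimage of the span of their classes in M / M^2, described
  without forming the quotient.\<close>

definition Vs where
  "Vs e1 e2 e3 = {sc k1 * e1 + sc k2 * e2 + sc k3 * e3 + \<mu> | k1 k2 k3 \<mu>. \<mu> \<in> ideal_square M}"

lemma VsI: "\<mu> \<in> ideal_square M \<Longrightarrow> sc k1 * e1 + sc k2 * e2 + sc k3 * e3 + \<mu> \<in> Vs e1 e2 e3"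
  by (auto simp: Vs_def)

lemma Vs_add:
  assumes "a \<in> Vs e1 e2 e3" "b \<in> Vs e1 e2 e3"
  shows "a + b \<in> Vs e1 e2 e3"
proof -
  obtain k1 k2 k3 \<mu> l1 l2 l3 \<nu> where
    a: "a = sc k1 * e1 + sc k2 * e2 + sc k3 * e3 + \<mu>" "\<mu> \<in> ideal_square M" and
    b: "b = sc l1 * e1 + sc l2 * e2 + sc l3 * e3 + \<nu>" "\<nu> \<in> ideal_square M"
    using assms by (auto simp: Vs_def)
  have "a + b = sc (k1 + l1) * e1 + sc (k2 + l2) * e2 + sc (k3 + l3) * e3 + (\<mu> + \<nu>)"
    by (simp add: a b sc_add algebra_simps)
  also have "\<dots> \<in> Vs e1 e2 e3" using a b by (intro VsI ideal_square_add)
  finally show ?thesis .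
qed

lemma Vs_scale:
  assumes "a \<in> Vs e1 e2 e3"
  shows "sc k * a \<in> Vs e1 e2 e3"
proof -
  obtain k1 k2 k3 \<mu> where a: "a = sc k1 * e1 + sc k2 * e2 + sc k3 * e3 + \<mu>" "\<mu> \<in> ideal_square M"
    using assms by (auto simp: Vs_def)
  have "sc k * a = sc (k * k1) * e1 + sc (k * k2) * e2 + sc (k * k3) * e3 + \<mu> * sc k"
    by (simp add: a sc_mult algebra_simps)
  also have "\<dots> \<in> Vs e1 e2 e3" using a by (intro VsI ideal_square_ideal sc_in_A)
  finally show ?thesis .
qed

lemma Vs_uminus: "a \<in> Vs e1 e2 e3 \<Longrightarrow> - a \<in> Vs e1 e2 e3"
  using Vs_scale[of a e1 e2 e3 "- 1"] by (simp add: sc_uminus)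

lemma Vs_diff: "a \<in> Vs e1 e2 e3 \<Longrightarrow> b \<in> Vs e1 e2 e3 \<Longrightarrow> a - b \<in> Vs e1 e2 e3"
  using Vs_add[OF _ Vs_uminus, of a e1 e2 e3 b] by simp

lemma ideal_square_Vs: "\<mu> \<in> ideal_square M \<Longrightarrow> \<mu> \<in> Vs e1 e2 e3"
  using VsI[of \<mu> 0 e1 0 e2 0 e3] by simp

lemma Vs_gens: "e1 \<in> Vs e1 e2 e3" "e2 \<in> Vs e1 e2 e3" "e3 \<in> Vs e1 e2 e3"
  using VsI[OF ideal_square.zero, of 1 e1 0 e2 0 e3] VsI[OF ideal_square.zero, of 0 e1 1 e2 0 e3]
    VsI[OF ideal_square.zero, of 0 e1 0 e2 1 e3] by simp_all

lemma Vs_sum: "(\<And>i. i \<in> I \<Longrightarrow> F i \<in> Vs e1 e2 e3) \<Longrightarrow> sum F I \<in> Vs e1 e2 e3"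
  by (induction I rule: infinite_finite_induct) (auto simp: Vs_add ideal_square_Vs ideal_square.zero)

lemma Vs_subset:
  assumes "e1 \<in> Vs g1 g2 g3" "e2 \<in> Vs g1 g2 g3" "e3 \<in> Vs g1 g2 g3"
  shows "Vs e1 e2 e3 \<subseteq> Vs g1 g2 g3"
proof
  fix a assume "a \<in> Vs e1 e2 e3"
  then obtain k1 k2 k3 \<mu> where a: "a = sc k1 * e1 + sc k2 * e2 + sc k3 * e3 + \<mu>" "\<mu> \<in> ideal_square M"
    by (auto simp: Vs_def)
  show "a \<in> Vs g1 g2 g3" unfolding a(1) by (intro Vs_add Vs_scale assms ideal_square_Vs[OF a(2)])
qed

lemma Vs_M: "e1 \<in> M \<Longrightarrow> e2 \<in> M \<Longrightarrow> e3 \<in> M \<Longrightarrow> a \<in> Vs e1 e2 e3 \<Longrightarrow> a \<in> M"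
proof -
  assume e: "e1 \<in> M" "e2 \<in> M" "e3 \<in> M" and "a \<in> Vs e1 e2 e3"
  then obtain k1 k2 k3 \<mu> where a: "a = sc k1 * e1 + sc k2 * e2 + sc k3 * e3 + \<mu>" "\<mu> \<in> ideal_square M"
    by (auto simp: Vs_def)
  have sc: "sc k * b \<in> M" if "b \<in> M" for k b using M_mult[OF that sc_in_A[of k]] by (simp add: mult.commute)
  then show "a \<in> M" unfolding a(1) by (intro M_add sc e ideal_square_M[OF a(2)])
qed

text \<open>The cotangent space at the vertex is at most three-dimensional: this uses that the line
  \<open>f = 0\<close> is smooth, through the parameter \<open>q\<close>, and \<open>m \<ge> 2\<close>.\<close>

lemma cotangent_generators:
  "\<exists>e1 e2 e3. e1 \<in> M \<and> e2 \<in> M \<and> e3 \<in> M \<and> M \<subseteq> Vs e1 e2 e3"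
proof -
  \<comment> \<open>k + Vs is closed under products, because the product of two elements of M lies
    in M^2; so it is enough to reach the generators x, y, z and t of A.\<close>
  have crit: "M \<subseteq> Vs e1 e2 e3" if e: "e1 \<in> M" "e2 \<in> M" "e3 \<in> M"
    and g: "\<And>Z. range sc \<subseteq> Z \<Longrightarrow> (\<And>a b. a \<in> Z \<Longrightarrow> b \<in> Z \<Longrightarrow> a + b \<in> Z) \<Longrightarrow>
      (\<And>a b. a \<in> Z \<Longrightarrow> b \<in> Z \<Longrightarrow> a * b \<in> Z) \<Longrightarrow> (\<And>a k. a - sc k \<in> Vs e1 e2 e3 \<Longrightarrow> a \<in> Z) \<Longrightarrow>
      (\<And>a k. a \<in> Z \<Longrightarrow> a - sc k \<in> M \<Longrightarrow> a - sc k \<in> Vs e1 e2 e3) \<Longrightarrow>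
      x \<in> Z \<and> y \<in> Z \<and> xz \<in> Z \<and> xt \<in> Z" for e1 e2 e3
  proof -
    define Z where "Z = {a. \<exists>k. a - sc k \<in> Vs e1 e2 e3}"
    have VM: "a \<in> M" if "a \<in> Vs e1 e2 e3" for a using Vs_M[OF e that] .
    have ZM: "a - sc k \<in> Vs e1 e2 e3" if "a \<in> Z" "a - sc k \<in> M" for a k
    proof -
      obtain l where l: "a - sc l \<in> Vs e1 e2 e3" using \<open>a \<in> Z\<close> by (auto simp: Z_def)
      have "(a - sc k) - (a - sc l) \<in> M" by (rule M_diff[OF that(2) VM[OF l]])
      then have "sc (l - k) \<in> M" by (simp add: sc_diff)
      then have "l - k = 0" by (simp only: sc_in_M_iff)
      then show ?thesis using l by simp
    qed
    have Zadd: "a + b \<in> Z" if ab: "a \<in> Z" "b \<in> Z" for a b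
    proof -
      obtain k l where "a - sc k \<in> Vs e1 e2 e3" "b - sc l \<in> Vs e1 e2 e3" using ab by (auto simp: Z_def)
      then have "(a - sc k) + (b - sc l) \<in> Vs e1 e2 e3" by (rule Vs_add)
      also have "(a - sc k) + (b - sc l) = a + b - sc (k + l)" by (simp add: sc_add)
      finally show ?thesis by (auto simp: Z_def)
    qed
    have Zmult: "a * b \<in> Z" if ab: "a \<in> Z" "b \<in> Z" for a b
    proof -
      obtain k l where kl: "a - sc k \<in> Vs e1 e2 e3" "b - sc l \<in> Vs e1 e2 e3" using ab by (auto simp: Z_def)
      then have "sc k * (b - sc l) + sc l * (a - sc k) + (a - sc k) * (b - sc l) \<in> Vs e1 e2 e3"
        by (intro Vs_add Vs_scale ideal_square_Vs[OF ideal_square_mult[OF VM[OF kl(1)] VM[OF kl(2)]]])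
      also have "sc k * (b - sc l) + sc l * (a - sc k) + (a - sc k) * (b - sc l) = a * b - sc (k * l)"
        by (simp add: sc_mult algebra_simps)
      finally show ?thesis by (auto simp: Z_def)
    qed
    have "sc k - sc k \<in> Vs e1 e2 e3" for k using ideal_square_Vs[OF ideal_square.zero] by simp
    then have Zc: "range sc \<subseteq> Z" unfolding Z_def by blast
    have "x \<in> Z \<and> y \<in> Z \<and> xz \<in> Z \<and> xt \<in> Z"
      by (rule g[OF Zc Zadd Zmult _ ZM]) (auto simp: Z_def)
    then have "A \<subseteq> Z" by (intro A_subset_if_gens Zc Zadd Zmult) blast+
    show ?thesis
    proof
      fix a assume "a \<in> M"
      then show "a \<in> Vs e1 e2 e3" using ZM[of a 0] M_A[of a] \<open>A \<subseteq> Z\<close> by auto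
    qed
  qed
  have xzA: "xz \<in> A" "xt \<in> A" by (simp_all add: xz_def xt_def)
  show ?thesis
  proof (cases "x \<in> M")
    case False
    obtain kx where kx: "x - sc kx \<in> M" by (rule const_part[OF x_in_A])
    obtain ky where ky: "y - sc ky \<in> M" by (rule const_part[OF y_in_A])
    obtain kz where kz: "xz - sc kz \<in> M" by (rule const_part[OF xzA(1)])
    obtain kt where kt: "xt - sc kt \<in> M" by (rule const_part[OF xzA(2)])
    note k = kx ky kz kt
    \<comment> \<open>The value kx of x at the vertex is nonzero here, so differentiating x^m y = -
      f expresses the class of y through those of x, z and t.\<close>
    have "M \<subseteq> Vs (x - sc kx) (xz - sc kz) (xt - sc kt)"
    proof (rule crit)
      fix Z assume Z: "range sc \<subseteq> Z" "\<And>a b. a \<in> Z \<Longrightarrow> b \<in> Z \<Longrightarrow> a + b \<in> Z"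
        "\<And>a b. a \<in> Z \<Longrightarrow> b \<in> Z \<Longrightarrow> a * b \<in> Z"
        "\<And>a k. a - sc k \<in> Vs (x - sc kx) (xz - sc kz) (xt - sc kt) \<Longrightarrow> a \<in> Z"
        "\<And>a k. a \<in> Z \<Longrightarrow> a - sc k \<in> M \<Longrightarrow> a - sc k \<in> Vs (x - sc kx) (xz - sc kz) (xt - sc kt)"
      let ?V = "Vs (x - sc kx) (xz - sc kz) (xt - sc kt)"
      have g: "x \<in> Z" "xz \<in> Z" "xt \<in> Z" using Z(4) Vs_gens by blast+
      have scZ: "sc a \<in> Z" for a using Z(1) by blast
      have embZ: "emb a \<in> Z" for a
        by (rule emb_induct[of "\<lambda>a. a \<in> Z"])
           (use Z(2,3) g scZ in \<open>simp_all add: emb_add emb_mult sc_def xz_def xt_def\<close>)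
      have "x ^ n \<in> Z" for n by (induction n) (use g Z(3) scZ[of 1] in simp_all)
      then have xmZ: "x ^ m \<in> Z" .
      have xA: "x ^ n \<in> A" for n by (induction n) (simp_all add: A_1 A_mult)
      obtain k1 where k1: "x ^ m - sc k1 \<in> M" using const_part[OF xA] by blast
      have k1V: "x ^ m - sc k1 \<in> ?V" by (rule Z(5)[OF xmZ k1])
      have kx0: "kx \<noteq> 0" using k(1) False by auto
      have xpow: "x ^ n - sc (kx ^ n) \<in> M" for n
      proof (induction n)
        case (Suc n)
        have "(x - sc kx) * x ^ n + (x ^ n - sc (kx ^ n)) * sc kx \<in> M"
          using k(1) Suc xA by (intro M_add M_mult) simp_all
        then show ?case by (simp add: sc_mult algebra_simps)
      qed (simp add: M_0)
      have "(x ^ m - sc (kx ^ m)) - (x ^ m - sc k1) \<in> M" by (intro M_diff xpow k1)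
      then have "sc (k1 - kx ^ m) \<in> M" by (simp add: sc_diff)
      then have "k1 - kx ^ m = 0" by (simp only: sc_in_M_iff)
      then have k10: "k1 \<noteq> 0" using kx0 by auto
      have "emb (- f) \<in> A" by simp
      then obtain k2 where k2: "emb (- f) - sc k2 \<in> M" using const_part by blast
      have k2V: "emb (- f) - sc k2 \<in> ?V" by (rule Z(5)[OF embZ k2])
      have rel: "emb (- f) = x ^ m * y" by (simp add: x_power_y emb_uminus)
      \<comment> \<open>Expansion of x^m y = - f at the vertex: the last product lies in M^2, and
        the constant on the left must vanish because all other terms lie in M.\<close>
      have eq: "sc k1 * (y - sc ky) - sc (k2 - k1 * ky) = (emb (- f) - sc k2) - sc ky * (x ^ m - sc k1)
          - (x ^ m - sc k1) * (y - sc ky)"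
        unfolding rel by (simp add: sc_diff sc_mult algebra_simps)
      have rhs: "(emb (- f) - sc k2) - sc ky * (x ^ m - sc k1) - (x ^ m - sc k1) * (y - sc ky) \<in> ?V"
        by (intro Vs_diff Vs_scale k1V k2V ideal_square_Vs[OF ideal_square_mult[OF k1 k(2)]])
      have "sc k1 * (y - sc ky) \<in> M" using M_mult[OF k(2) sc_in_A[of k1]] by (simp add: mult.commute)
      moreover have "sc k1 * (y - sc ky) - sc (k2 - k1 * ky) \<in> M"
        unfolding eq by (rule Vs_M[OF k(1,3,4) rhs])
      ultimately have "sc k1 * (y - sc ky) - (sc k1 * (y - sc ky) - sc (k2 - k1 * ky)) \<in> M"
        by (rule M_diff)
      then have "sc (k2 - k1 * ky) \<in> M" by simp
      then have "k2 - k1 * ky = 0" by (simp only: sc_in_M_iff)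
      then have "sc k1 * (y - sc ky) \<in> ?V" using eq rhs by simp
      then have "sc (inverse k1) * (sc k1 * (y - sc ky)) \<in> ?V" by (rule Vs_scale)
      also have "sc (inverse k1) * (sc k1 * (y - sc ky)) = y - sc ky"
        using k10 by (simp flip: mult.assoc sc_mult)
      finally have "y \<in> Z" by (rule Z(4))
      then show "x \<in> Z \<and> y \<in> Z \<and> xz \<in> Z \<and> xt \<in> Z" using g by blast
    qed (fact k)+
    then show ?thesis using k(1,3,4) by (intro exI conjI)
  next
    case True
    obtain ky where ky: "y - sc ky \<in> M" by (rule const_part[OF y_in_A])
    obtain kq where kq: "emb q - sc kq \<in> M" by (rule const_part[OF emb_in_A])
    note k = ky kq
    \<comment> \<open>Here f = - x^m y lies in M^2 because m \<ge> 2, so modulo M^2 every element of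
      k[z,t] is a polynomial in q, and one parameter replaces both z and t.\<close>
    have "M \<subseteq> Vs x (y - sc ky) (emb q - sc kq)"
    proof (rule crit)
      fix Z assume Z: "range sc \<subseteq> Z" "\<And>a b. a \<in> Z \<Longrightarrow> b \<in> Z \<Longrightarrow> a + b \<in> Z"
        "\<And>a b. a \<in> Z \<Longrightarrow> b \<in> Z \<Longrightarrow> a * b \<in> Z"
        "\<And>a k. a - sc k \<in> Vs x (y - sc ky) (emb q - sc kq) \<Longrightarrow> a \<in> Z"
      have "x - sc 0 \<in> Vs x (y - sc ky) (emb q - sc kq)" using Vs_gens(1) by simp
      then have xZ: "x \<in> Z" by (rule Z(4))
      have g: "y \<in> Z" "emb q \<in> Z" using Z(4) Vs_gens by blast+
      have scZ: "sc a \<in> Z" for a using Z(1) by blast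
      have evZ: "emb (ev P q) \<in> Z" for P
        by (induction P rule: pCons_induct)
           (use Z(2,3) g scZ scZ[of 0] in \<open>auto simp: emb_add emb_mult simp flip: sc_def\<close>)
      have embZ: "emb a \<in> Z" for a
      proof -
        have "f dvd a - ev (\<psi> a) q" by (simp flip: \<psi>_eq_0_iff add: \<psi>_diff \<psi>_ev)
        then obtain \<alpha> where \<alpha>: "a - ev (\<psi> a) q = f * \<alpha>" by blast
        have xA: "x ^ n \<in> A" for n by (induction n) (simp_all add: A_1 A_mult)
        have m': "m = Suc (Suc (m - 2))" using m_ge_2 by simp
        have "emb (f * \<alpha>) = - (x ^ m * y * emb \<alpha>)"
          unfolding x_power_y by (simp add: emb_mult)
        also have "\<dots> = x * (x * (sc (- 1) * (x ^ (m - 2) * y * emb \<alpha>)))"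
          by (subst m') (simp add: sc_uminus mult_ac)
        also have "\<dots> \<in> ideal_square M"
          using True xA by (intro ideal_square_mult M_mult A_mult) simp_all
        finally have "emb (f * \<alpha>) - sc 0 \<in> Vs x (y - sc ky) (emb q - sc kq)" by (simp add: ideal_square_Vs)
        then have "emb (f * \<alpha>) \<in> Z" by (rule Z(4))
        then have "emb (ev (\<psi> a) q) + emb (f * \<alpha>) \<in> Z" by (rule Z(2)[OF evZ])
        also have "emb (ev (\<psi> a) q) + emb (f * \<alpha>) = emb a"
          unfolding \<alpha>[symmetric] by (simp flip: emb_add)
        finally show ?thesis .
      qed
      show "x \<in> Z \<and> y \<in> Z \<and> xz \<in> Z \<and> xt \<in> Z"
        using xZ g embZ by (simp add: xz_def xt_def)
    qed (fact k True)+
    then show ?thesis using k True by (intro exI conjI)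
  qed
qed

definition homog where "homog h \<longleftrightarrow> (\<exists>i>0. h \<in> B i)"

lemma homog_M: "homog h \<Longrightarrow> h \<in> M"
  using c_hom B_A by (force simp: homog_def M_def)

text \<open>Exchange argument: a homogeneous component of \<open>e1\<close> that involves
  \<open>e1\<close> modulo the other two and M^2 can replace it. If there is none, \<open>e1\<close>
  is redundant as the sum of its components, and 0 takes its place, being homogeneous of every
  degree.\<close>

lemma replace_by_homogeneous:
  assumes M: "e1 \<in> M" "e2 \<in> M" "e3 \<in> M" and V: "M \<subseteq> Vs e1 e2 e3"
  shows "\<exists>h. homog h \<and> M \<subseteq> Vs h e2 e3"
proof (cases "\<exists>i k1 k2 k3 \<mu>. i > 0 \<and> k1 \<noteq> 0 \<and> \<mu> \<in> ideal_square M \<and> c i e1 = sc k1 * e1 + sc k2 * e2 + sc k3 * e3 + \<mu>")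
  case True
  then obtain i k1 k2 k3 \<mu> where i: "i > 0" "k1 \<noteq> 0" "\<mu> \<in> ideal_square M"
    "c i e1 = sc k1 * e1 + sc k2 * e2 + sc k3 * e3 + \<mu>" by blast
  let ?h = "c i e1"
  have hom: "homog ?h" unfolding homog_def using i(1) c_B[OF M_A[OF M(1)]] by blast
  have "sc k1 * e1 = ?h - (sc k2 * e2 + sc k3 * e3 + \<mu>)" using i(4) by simp
  also have "\<dots> \<in> Vs ?h e2 e3"
    by (intro Vs_diff Vs_add Vs_scale Vs_gens ideal_square_Vs[OF i(3)])
  finally have "sc (inverse k1) * (sc k1 * e1) \<in> Vs ?h e2 e3" by (rule Vs_scale)
  then have "e1 \<in> Vs ?h e2 e3" using i(2) by (simp flip: mult.assoc sc_mult)
  then have "Vs e1 e2 e3 \<subseteq> Vs ?h e2 e3" by (intro Vs_subset Vs_gens)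
  then show ?thesis using hom V by blast
next
  case False
  have comp: "c i e1 \<in> Vs 0 e2 e3" if "c i e1 \<noteq> 0" for i
  proof -
    have e1A: "e1 \<in> A" using M M_A by blast
    have "\<not> i < 0" "i \<noteq> 0" using that c_neg[OF e1A, of i] M(1) by (auto simp: M_def)
    then have "i > 0" by simp
    then have "homog (c i e1)" using c_B[OF e1A] by (auto simp: homog_def)
    then have "c i e1 \<in> Vs e1 e2 e3" using V homog_M by blast
    then obtain k1 k2 k3 \<mu> where *: "c i e1 = sc k1 * e1 + sc k2 * e2 + sc k3 * e3 + \<mu>" "\<mu> \<in> ideal_square M"
      by (auto simp: Vs_def)
    then have "k1 = 0" using False \<open>i > 0\<close> by blast
    then have "c i e1 = sc 0 * 0 + sc k2 * e2 + sc k3 * e3 + \<mu>" using *(1) by simp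
    then show ?thesis using VsI[OF *(2)] by metis
  qed
  have "(\<Sum>i | c i e1 \<noteq> 0. c i e1) \<in> Vs 0 e2 e3" by (intro Vs_sum comp) simp
  then have "e1 \<in> Vs 0 e2 e3" by (simp only: c_sum_eq[OF M_A[OF M(1)], symmetric])
  then have "Vs e1 e2 e3 \<subseteq> Vs 0 e2 e3" by (intro Vs_subset Vs_gens)
  moreover have "homog 0" using B_0[of 1] by (auto simp: homog_def intro!: exI[of _ 1])
  ultimately show ?thesis using V by blast
qed

lemma homogeneous_cotangent_generators:
  "\<exists>u v w. homog u \<and> homog v \<and> homog w \<and> M \<subseteq> Vs u v w"
proof -
  have rot: "Vs e1 e2 e3 \<subseteq> Vs e2 e3 e1" for e1 e2 e3 by (intro Vs_subset Vs_gens)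
  obtain e1 e2 e3 where e: "e1 \<in> M" "e2 \<in> M" "e3 \<in> M" "M \<subseteq> Vs e1 e2 e3"
    using cotangent_generators by blast
  obtain u where u: "homog u" "M \<subseteq> Vs u e2 e3" using replace_by_homogeneous[OF e] by blast
  have "M \<subseteq> Vs e2 e3 u" using u(2) rot by blast
  then obtain v where v: "homog v" "M \<subseteq> Vs v e3 u"
    using replace_by_homogeneous[OF e(2,3) homog_M[OF u(1)]] by blast
  have "M \<subseteq> Vs e3 u v" using v(2) rot by blast
  then obtain w where w: "homog w" "M \<subseteq> Vs w u v"
    using replace_by_homogeneous[OF e(3) homog_M[OF u(1)] homog_M[OF v(1)]] by blast
  then show ?thesis using u v by blast
qed

text \<open>Graded Nakayama: the degree n component of an element of M^2 is a sum of products of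
  components of positive degrees below n, which the generators reach by induction; the remaining
  part is in their linear span. The induction starts because degree 0 is k.\<close>

theorem variable_if_positively_graded:
  assumes char: "CHAR('a) > 0"
  shows "\<exists>g. subalgebra2 f g = UNIV"
proof -
  obtain u v w where h: "homog u" "homog v" "homog w" and V: "M \<subseteq> Vs u v w"
    using homogeneous_cotangent_generators by blast
  have hA: "u \<in> A" "v \<in> A" "w \<in> A" using h homog_M M_A by blast+
  show ?thesis
  proof (rule variable_if_generators[OF char hA])
    fix W assume W: "range sc \<subseteq> W" "u \<in> W" "v \<in> W" "w \<in> W"
      "\<And>a b. a \<in> W \<Longrightarrow> b \<in> W \<Longrightarrow> a + b \<in> W" "\<And>a b. a \<in> W \<Longrightarrow> b \<in> W \<Longrightarrow> a * b \<in> W"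
    have scW: "sc k \<in> W" for k using W(1) by blast
    have W0: "0 \<in> W" using scW[of 0] by simp
    have Wsum: "sum F I \<in> W" if "\<And>i. i \<in> I \<Longrightarrow> F i \<in> W" for F and I :: "int set"
      using that by (induction I rule: infinite_finite_induct) (auto simp: W0 W(5))
    have lin: "c i (sc k * b) \<in> W" if hb: "homog b" "b \<in> W" for i k b
    proof -
      obtain j where "b \<in> B j" using hb(1) unfolding homog_def by blast
      moreover have "sc k \<in> B 0" using B_const by blast
      ultimately have "sc k * b \<in> B j" using B_mult[of "sc k" 0 b j] by simp
      then show ?thesis using c_hom[of "sc k * b" j i] hb scW W0 W(6) by simp
    qed
    have comp: "c (int n) a \<in> W" if "a \<in> A" for n a
      using that
    proof (induction n arbitrary: a rule: less_induct)
      case (less n)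
      show ?case
      proof (cases "n = 0")
        case True
        then show ?thesis using c_B[OF less.prems, of 0] B_const W(1) by auto
      next
        case False
        let ?h = "c (int n) a"
        have hB: "?h \<in> B (int n)" using c_B less.prems by blast
        then have "homog ?h" using False by (auto simp: homog_def intro!: exI[of _ "int n"])
        then obtain k1 k2 k3 \<mu> where e: "?h = sc k1 * u + sc k2 * v + sc k3 * w + \<mu>" "\<mu> \<in> ideal_square M"
        proof -
          have "?h \<in> Vs u v w" using V homog_M[OF \<open>homog ?h\<close>] by blast
          then show ?thesis using that unfolding Vs_def by blast
        qed
        have mmW: "c (int n) s \<in> W" if "s \<in> ideal_square M" for s
          using that
        proof (induction rule: ideal_square.induct)
          case (step p q' s)
          have pq: "p \<in> A" "q' \<in> A" "s \<in> A" "p * q' \<in> A" using step ideal_square_M M_A A_mult by blast+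
          have "c (int n) (p * q') \<in> W"
            unfolding c_mult[OF pq(1,2)]
          proof (intro Wsum)
            fix i j assume ij: "i \<in> {i. c i p \<noteq> 0}" "j \<in> {j. c j q' \<noteq> 0}"
            have "\<not> i < 0" "i \<noteq> 0" using ij(1) c_neg[OF pq(1), of i] step(1) by (auto simp: M_def)
            moreover have "\<not> j < 0" "j \<noteq> 0" using ij(2) c_neg[OF pq(2), of j] step(2) by (auto simp: M_def)
            ultimately have "c i p * c j q' \<in> W" if "int n = i + j"
              using that less.IH[of "nat i" p] less.IH[of "nat j" q'] pq W(6) by simp
            then show "(if int n = i + j then c i p * c j q' else 0) \<in> W" using W0 by simp
          qed
          then show ?case using step pq W(5) by (simp add: c_add)
        qed (simp add: W0)
        have muA: "\<mu> \<in> A" "sc k1 * u \<in> A" "sc k2 * v \<in> A" "sc k3 * w \<in> A"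
          using e(2) ideal_square_M M_A hA A_mult by auto
        have "?h = c (int n) ?h" using c_hom[OF hB, of "int n"] by simp
        also have "\<dots> = c (int n) (sc k1 * u) + c (int n) (sc k2 * v) + c (int n) (sc k3 * w) + c (int n) \<mu>"
          unfolding e(1) using muA by (simp add: c_add A_add)
        also have "\<dots> \<in> W" using lin h W mmW[OF e(2)] by simp
        finally show ?thesis .
      qed
    qed
    show "A \<subseteq> W"
    proof
      fix a assume a: "a \<in> A"
      have "c i a \<in> W" if "c i a \<noteq> 0" for i
        using comp[OF a, of "nat i"] c_neg[OF a, of i] that by (cases "i < 0") auto
      then have "(\<Sum>i | c i a \<noteq> 0. c i a) \<in> W" by (intro Wsum) auto
      then show "a \<in> W" by (simp only: c_sum_eq[OF a, symmetric])
    qed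
  qed
qed

end

section \<open>Isomorphisms onto subrings of a factorial domain\<close>

text \<open>If every non-unit is a product of primes, an irreducible element is associated to one of
  its prime factors and so is prime itself; uniqueness of factorisation follows.\<close>

lemma (in comm_monoid_cancel) factorial_monoidI_primes:
  assumes ex: "\<And>a. a \<in> carrier G \<Longrightarrow> a \<notin> Units G \<Longrightarrow>
    \<exists>ps. set ps \<subseteq> carrier G \<and> (\<forall>p\<in>set ps. prime G p) \<and> foldr (\<otimes>) ps \<one> \<sim> a"
  shows "factorial_monoid G"
proof -
  interpret primeness_condition_monoid G
  proof
    fix a assume a: "a \<in> carrier G" "irreducible G a"
    obtain ps where ps: "set ps \<subseteq> carrier G" "\<forall>p\<in>set ps. prime G p" "foldr (\<otimes>) ps \<one> \<sim> a"
      using ex[OF a(1)] a(2) by (auto simp: irreducible_def)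
    have "ps \<noteq> []"
      using ps(3) a Units_cong[of \<one> a] by (auto simp: irreducible_def)
    then obtain p qs where pq: "ps = p # qs" by (cases ps) auto
    have p: "p \<in> carrier G" "prime G p" using ps by (auto simp: pq)
    have "p divides foldr (\<otimes>) ps \<one>" using ps(1) by (auto simp: pq intro!: divides_prod_r)
    then have "p divides a" using ps(3) p(1) a(1) divides_cong_r by blast
    moreover have "\<not> Divisibility.properfactor G p a" using a p by (auto simp: irreducible_def prime_def)
    ultimately have "p \<sim> a" by (auto simp: Divisibility.properfactor_def associated_def)
    then show "prime G a" using p a(1) prime_cong by blast
  qed
  show ?thesis
  proof (rule factorial_monoidI)
    fix a assume "a \<in> carrier G" "a \<notin> Units G"
    then obtain ps where "set ps \<subseteq> carrier G" "\<forall>p\<in>set ps. prime G p" "foldr (\<otimes>) ps \<one> \<sim> a"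
      using ex by blast
    then show "\<exists>fs. set fs \<subseteq> carrier G \<and> wfactors G fs a"
      using prime_irreducible by (auto simp: wfactors_def intro!: exI[of _ ps])
  qed (rule wfactors_unique)
qed

definition ring_on :: "'r::comm_ring_1 set \<Rightarrow> 'r ring" where
  "ring_on S = \<lparr>carrier = S, monoid.mult = (*), one = 1, ring.zero = 0, add = (+)\<rparr>"

lemma ring_on_simps [simp]:
  "carrier (ring_on S) = S" "monoid.mult (ring_on S) = (*)" "one (ring_on S) = 1"
  "ring.zero (ring_on S) = 0" "add (ring_on S) = (+)"
  by (simp_all add: ring_on_def)

text \<open>Cofactors are taken from \<open>S\<close>, since divisibility in the ambient ring is
  weaker than divisibility in the subring.\<close>

definition prime_on :: "'r::comm_ring_1 set \<Rightarrow> 'r \<Rightarrow> bool" where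
  "prime_on S p \<longleftrightarrow> p \<in> S \<and> p \<noteq> 0 \<and> (\<forall>c\<in>S. p * c \<noteq> 1) \<and>
    (\<forall>a\<in>S. \<forall>b\<in>S. \<forall>c\<in>S. a * b = p * c \<longrightarrow> (\<exists>d\<in>S. a = p * d) \<or> (\<exists>d\<in>S. b = p * d))"

locale ring_embedding = cring R for R (structure) +
  fixes h :: "'a \<Rightarrow> 's::idom" and S :: "'s set"
  assumes iso: "h \<in> ring_iso R (ring_on S)"
begin

lemma h_in [simp]: "a \<in> carrier R \<Longrightarrow> h a \<in> S"
  and h_add: "a \<in> carrier R \<Longrightarrow> b \<in> carrier R \<Longrightarrow> h (a \<oplus> b) = h a + h b"
  and h_mult: "a \<in> carrier R \<Longrightarrow> b \<in> carrier R \<Longrightarrow> h (a \<otimes> b) = h a * h b"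
  and h_1 [simp]: "h \<one> = 1"
  using ring_iso_memE[OF iso] by simp_all

lemma h_inj: "a \<in> carrier R \<Longrightarrow> b \<in> carrier R \<Longrightarrow> h a = h b \<longleftrightarrow> a = b"
  using ring_iso_memE(5)[OF iso] by (auto simp: bij_betw_def inj_on_def)

lemma h_surj: "c \<in> S \<Longrightarrow> \<exists>a\<in>carrier R. h a = c"
  using ring_iso_memE(5)[OF iso] by (auto simp: bij_betw_def)

lemma h_0 [simp]: "h \<zero> = 0"
  using h_add[of \<zero> \<zero>] by (simp only: zero_closed l_zero add_cancel_right_right)

lemma h_eq_0_iff [simp]: "a \<in> carrier R \<Longrightarrow> h a = 0 \<longleftrightarrow> a = \<zero>"
  using h_inj[of a \<zero>] by simp

lemma h_finsum: "F \<in> I \<rightarrow> carrier R \<Longrightarrow> h (\<Oplus>i\<in>I. F i) = (\<Sum>i\<in>I. h (F i))"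
  by (induction I rule: infinite_finite_induct) (simp_all add: Pi_iff finsum_infinite h_add)

lemma h_finprod: "F \<in> I \<rightarrow> carrier R \<Longrightarrow> h (\<Otimes>i\<in>I. F i) = (\<Prod>i\<in>I. h (F i))"
  by (induction I rule: infinite_finite_induct) (simp_all add: Pi_iff finprod_infinite h_mult)

lemma h_pow: "a \<in> carrier R \<Longrightarrow> h (a [^] (n::nat)) = h a ^ n"
  by (induction n) (simp_all add: h_mult mult.commute)

lemma domain_R: "domain R"
proof
  show "\<one> \<noteq> \<zero>" using h_0 h_1 by (metis zero_neq_one)
  fix a b assume "a \<otimes> b = \<zero>" "a \<in> carrier R" "b \<in> carrier R"
  then show "a = \<zero> \<or> b = \<zero>" using h_mult[of a b] by simp
qed

lemma factorial_domainI:
  assumes ex: "\<And>a. a \<in> S \<Longrightarrow> a \<noteq> 0 \<Longrightarrow> \<exists>u v ps. u \<in> S \<and> v \<in> S \<and> u * v = 1 \<and> a = u * prod_list ps \<and> (\<forall>p\<in>set ps. prime_on S p)"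
  shows "factorial_domain R"
proof -
  interpret domain R by (rule domain_R)
  have dvd: "Divisibility.factor (mult_of R) a b \<longleftrightarrow> (\<exists>c\<in>S. h b = h a * c)"
    if "a \<in> carrier R" "b \<in> carrier R" "a \<noteq> \<zero>" "b \<noteq> \<zero>" for a b
  proof
    assume "Divisibility.factor (mult_of R) a b"
    then show "\<exists>c\<in>S. h b = h a * c" using that by (auto simp: Divisibility.factor_def h_mult)
  next
    assume "\<exists>c\<in>S. h b = h a * c"
    then obtain d where d: "d \<in> S" "h b = h a * d" by blast
    obtain c where "c \<in> carrier R" "h c = d" using h_surj[OF d(1)] by blast
    then have c: "c \<in> carrier R" "h b = h (a \<otimes> c)" using d(2) that(1) by (simp_all add: h_mult)
    then have "b = a \<otimes> c" using that h_inj by simp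
    moreover have "c \<noteq> \<zero>" using calculation that by auto
    ultimately show "Divisibility.factor (mult_of R) a b" using c by (auto simp: Divisibility.factor_def)
  qed
  have "factorial_monoid (mult_of R)"
  proof (rule mult_of.factorial_monoidI_primes)
    fix a assume "a \<in> carrier (mult_of R)"
    then have a: "a \<in> carrier R" "a \<noteq> \<zero>" by auto
    obtain u v ps where uv: "u \<in> S" "v \<in> S" "u * v = 1" and ae: "h a = u * prod_list ps" and
      ps: "\<And>p. p \<in> set ps \<Longrightarrow> prime_on S p"
      using ex[of "h a"] a by auto
    have "\<forall>p\<in>set ps. \<exists>r\<in>carrier R. h r = p" using ps h_surj by (auto simp: prime_on_def)
    then obtain r where r: "\<And>p. p \<in> set ps \<Longrightarrow> r p \<in> carrier R \<and> h (r p) = p" by metis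
    let ?rs = "map r ps"
    have fold: "foldr (\<otimes>) ?rs \<one> \<in> carrier R \<and> h (foldr (\<otimes>) ?rs \<one>) = prod_list ps"
      using r by (induction ps) (auto simp: h_mult)
    have "prod_list ps \<noteq> 0" using a ae by (metis h_eq_0_iff mult_zero_right)
    then have fold0: "foldr (\<otimes>) ?rs \<one> \<noteq> \<zero>" using fold by (metis h_0)
    have "associated (mult_of R) (foldr (\<otimes>) ?rs \<one>) a"
      unfolding associated_def dvd[OF conjunct1[OF fold] a(1) fold0 a(2)]
        dvd[OF a(1) conjunct1[OF fold] a(2) fold0]
    proof (intro conjI bexI)
      show "h a = h (foldr (\<otimes>) ?rs \<one>) * u" by (simp add: ae fold mult.commute)
      have "h a * v = (u * v) * prod_list ps" by (simp add: ae mult_ac)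
      then show "h (foldr (\<otimes>) ?rs \<one>) = h a * v" using uv fold by simp
    qed fact+
    moreover have "prime (mult_of R) p" if p: "p \<in> set ?rs" for p
    proof -
      have pR: "p \<in> carrier R" "prime_on S (h p)" using p r ps by auto
      have prS: "\<forall>a\<in>S. \<forall>b\<in>S. \<forall>c\<in>S. a * b = h p * c \<longrightarrow> (\<exists>d\<in>S. a = h p * d) \<or> (\<exists>d\<in>S. b = h p * d)"
        using pR(2) by (simp add: prime_on_def)
      have pr: "(\<exists>d\<in>S. h b = h p * d) \<or> (\<exists>d\<in>S. h c = h p * d)"
        if "b \<in> carrier R" "c \<in> carrier R" "d \<in> S" "h b * h c = h p * d" for b c d
        using prS[rule_format, OF h_in[OF that(1)] h_in[OF that(2)] that(3,4)] .
      show ?thesis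
      proof (rule primeI)
        show "p \<notin> Units (mult_of R)"
        proof
          assume "p \<in> Units (mult_of R)"
          then obtain c where "c \<in> carrier R" "p \<otimes> c = \<one>" by (auto simp: Units_def)
          then have "h p * h c = 1" using h_mult[OF pR(1)] by (metis h_1)
          then show False using pR(2) \<open>c \<in> carrier R\<close> unfolding prime_on_def by (metis h_in)
        qed
      next
        fix b c assume "b \<in> carrier (mult_of R)" "c \<in> carrier (mult_of R)"
          and d: "Divisibility.factor (mult_of R) p (b \<otimes>\<^bsub>mult_of R\<^esub> c)"
        then have bc: "b \<in> carrier R" "c \<in> carrier R" "b \<noteq> \<zero>" "c \<noteq> \<zero>" by auto
        have p0: "p \<noteq> \<zero>" using pR by (auto simp: prime_on_def)
        have "\<exists>d\<in>S. h (b \<otimes> c) = h p * d"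
          using d dvd[OF pR(1) m_closed[OF bc(1,2)] p0] bc integral_iff by simp
        then obtain d where "d \<in> S" "h b * h c = h p * d" using bc by (auto simp: h_mult)
        then show "Divisibility.factor (mult_of R) p b \<or> Divisibility.factor (mult_of R) p c"
          unfolding dvd[OF pR(1) bc(1) p0 bc(3)] dvd[OF pR(1) bc(2) p0 bc(4)]
          by (rule pr[OF bc(1,2)])
      qed
    qed
    moreover have "r p \<in> carrier R - {\<zero>}" if "p \<in> set ps" for p
      using r[OF that] ps[OF that] h_0 unfolding prime_on_def by (metis DiffI singletonD)
    then have "set ?rs \<subseteq> carrier (mult_of R)" by auto
    ultimately show "\<exists>ps. set ps \<subseteq> carrier (mult_of R) \<and>
        (\<forall>p\<in>set ps. prime (mult_of R) p) \<and> associated (mult_of R) (foldr (\<otimes>) ps \<one>) a"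
      by (intro exI[of _ ?rs]) simp
  qed
  then show ?thesis by (intro factorial_domain.intro) (rule domain_axioms)
qed

lemma algebraically_independent_iff:
  assumes "B \<subseteq> carrier R" "K \<subseteq> carrier R"
  shows "algebraically_independent R K B \<longleftrightarrow>
    (\<forall>T M c. finite T \<and> T \<subseteq> B \<and> finite M \<and> M \<subseteq> (T \<rightarrow>\<^sub>E (UNIV :: nat set)) \<and> c \<in> M \<rightarrow> K \<and>
      (\<Sum>e\<in>M. h (c e) * (\<Prod>s\<in>T. h s ^ e s)) = 0 \<longrightarrow> (\<forall>e\<in>M. h (c e) = 0))"
proof -
  have *: "((\<Oplus>e\<in>M. c e \<otimes> (\<Otimes>s\<in>T. s [^] e s)) = \<zero> \<longrightarrow> (\<forall>e\<in>M. c e = \<zero>)) \<longleftrightarrow>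
      ((\<Sum>e\<in>M. h (c e) * (\<Prod>s\<in>T. h s ^ e s)) = 0 \<longrightarrow> (\<forall>e\<in>M. h (c e) = 0))"
    if "T \<subseteq> B" "c \<in> M \<rightarrow> K" for T and M :: "('a \<Rightarrow> nat) set" and c
  proof -
    have c: "c e \<in> carrier R" if "e \<in> M" for e using \<open>c \<in> M \<rightarrow> K\<close> that assms by auto
    have s: "s \<in> carrier R" if "s \<in> T" for s using \<open>T \<subseteq> B\<close> that assms by auto
    have p: "(\<Otimes>s\<in>T. s [^] e s) \<in> carrier R" for e :: "'a \<Rightarrow> nat" using s by (intro finprod_closed) auto
    have hp: "h (\<Otimes>s\<in>T. s [^] e s) = (\<Prod>s\<in>T. h s ^ e s)" for e :: "'a \<Rightarrow> nat"
      using s by (subst h_finprod) (auto simp: h_pow)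
    have t: "c e \<otimes> (\<Otimes>s\<in>T. s [^] e s) \<in> carrier R" if "e \<in> M" for e using c[OF that] p by simp
    then have "h (\<Oplus>e\<in>M. c e \<otimes> (\<Otimes>s\<in>T. s [^] e s)) = (\<Sum>e\<in>M. h (c e) * (\<Prod>s\<in>T. h s ^ e s))"
      using c p by (subst h_finsum) (auto simp: h_mult hp)
    moreover have "(\<Oplus>e\<in>M. c e \<otimes> (\<Otimes>s\<in>T. s [^] e s)) \<in> carrier R"
      using t by (intro finsum_closed) auto
    ultimately show ?thesis using c by (auto simp flip: h_eq_0_iff)
  qed
  show ?thesis
    unfolding algebraically_independent_def by (simp only: imp_conjL * cong: imp_cong)
qed

end

section \<open>Factoriality of the Asanuma ring\<close>

context asanuma
begin

section \<open>Primality of x\<close>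

lemma sg_nat_in_A: "k \<ge> 0 \<Longrightarrow> sg k 1 \<in> A"
  by (simp add: sg_in_A)

lemma sg_sg: "sg i 1 * (sg j 1 * a) = sg (i + j) 1 * a" for a :: "'a laurent"
  by (simp add: mult_single flip: mult.assoc)

text \<open>Modulo x the ring A becomes (k[z,t]/(f))[y], and l is the degree in y of the residue of
  \<open>a\<close>: a term of degree - m l is y^l times a cofactor, which survives if f does not
  divide it.\<close>

lemma not_in_xA:
  assumes a: "a \<in> A" and nx: "sg (- 1) 1 * a \<notin> A"
  shows "\<exists>l. \<not> f ^ Suc l dvd lookup a (- (int m * int l)) \<and>
    (\<forall>s>l. f ^ Suc s dvd lookup a (- (int m * int s)))"
proof -
  obtain e where e: "\<not> f ^ pole e dvd lookup a (e + 1)"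
    using nx by (auto simp: A_def lookup_sg_mult)
  have d: "f ^ pole (e + 1) dvd lookup a (e + 1)" using a by (simp add: A_def)
  let ?L = "{l. \<not> f ^ Suc l dvd lookup a (- (int m * int l))}"
  have eneg: "e < 0" using e pole_nonneg[of e] by (cases "e < 0") auto
  have "\<not> pole e \<le> pole (e + 1)" using e dvd_trans[OF le_imp_power_dvd d] by (rule contrapos_nn)
  then have lt: "e div int m < (e + 1) div int m" by (auto simp: pole_def)
  have "e mod int m = int m - 1"
  proof (rule ccontr)
    assume "e mod int m \<noteq> int m - 1"
    moreover have "0 \<le> e mod int m" "e mod int m < int m" using m_ge_2 by simp_all
    ultimately have r: "0 \<le> e mod int m + 1" "e mod int m + 1 < int m" by linarith+
    have "e + 1 = int m * (e div int m) + (e mod int m + 1)" by simp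
    then have "(e + 1) div int m = (int m * (e div int m) + (e mod int m + 1)) div int m" by (rule arg_cong)
    also have "\<dots> = e div int m + (e mod int m + 1) div int m" using m_ge_2 by (intro div_mult_self4) simp
    also have "(e mod int m + 1) div int m = 0" using r by (rule div_pos_pos_trivial)
    finally show False using lt by linarith
  qed
  then have k: "e + 1 = int m * (e div int m + 1)"
    using mult_div_mod_eq[of "int m" e] by (simp only: distrib_left)
  define l where "l = nat (- (e div int m + 1))"
  have "e div int m < 0" using eneg m_ge_2 by (intro div_neg_pos_less0) auto
  then have l: "e div int m + 1 = - int l" "pole e = Suc l" by (simp_all add: l_def pole_def)
  then have "l \<in> ?L" using e unfolding k l by simp
  moreover have "finite ?L"
  proof (rule finite_imageD)
    show "finite ((\<lambda>l. - (int m * int l)) ` ?L)"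
      by (rule finite_subset[of _ "keys a"]) (auto simp: in_keys_iff)
    show "inj_on (\<lambda>l. - (int m * int l)) ?L" using m_ge_2 by (auto simp: inj_on_def)
  qed
  ultimately have M: "Max ?L \<in> ?L" "\<forall>s\<in>?L. s \<le> Max ?L"
    using Max_in[of ?L] by (blast, metis Max_ge)
  define M where "M = Max ?L"
  have "M \<in> ?L" "\<forall>s\<in>?L. s \<le> M" using M unfolding M_def by blast+
  then show ?thesis by (intro exI[of _ M]) (auto simp: not_le[symmetric])
qed

text \<open>The leading coefficients in y of the two residues modulo x are multiplied in k[z,t]/(f),
  a domain because f is prime.\<close>

lemma x_prime:
  assumes a: "a \<in> A" "sg (- 1) 1 * a \<notin> A" and b: "b \<in> A" "sg (- 1) 1 * b \<notin> A"
  shows "sg (- 1) 1 * (a * b) \<notin> A"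
proof
  obtain k where k: "\<not> f ^ Suc k dvd lookup a (- (int m * int k))"
    "\<And>s. s > k \<Longrightarrow> f ^ Suc s dvd lookup a (- (int m * int s))" using not_in_xA[OF a] by metis
  obtain l where l: "\<not> f ^ Suc l dvd lookup b (- (int m * int l))"
    "\<And>s. s > l \<Longrightarrow> f ^ Suc s dvd lookup b (- (int m * int s))" using not_in_xA[OF b] by metis
  let ?n = "- (int m * int (k + l))"
  let ?i = "- (int m * int k)"
  have aA: "f ^ pole e dvd lookup a e" and bA: "f ^ pole e dvd lookup b e" for e
    using a b by (simp_all add: A_def)
  have other: "f ^ Suc (k + l) dvd lookup a i * lookup b (?n - i)" if i: "i \<noteq> ?i" for i
  proof (cases "int m dvd i")
    case True
    then obtain s' where "i = int m * s'" by blast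
    then have "i = - (int m * - s')" by simp
    then obtain s where s: "i = - (int m * s)" by blast
    have j: "?n - i = - (int m * (int k + int l - s))" by (simp add: s algebra_simps)
    show ?thesis
    proof (cases "s > int k")
      case True
      have "f ^ Suc (nat s) dvd lookup a i" using k(2)[of "nat s"] True s by simp
      moreover have "f ^ nat (int k + int l - s) dvd lookup b (?n - i)"
        using bA[of "?n - i"] m_ge_2 unfolding j pole_def by (simp add: div_minus_right flip: mult_minus_right)
      ultimately have "f ^ (Suc (nat s) + nat (int k + int l - s)) dvd lookup a i * lookup b (?n - i)"
        unfolding power_add by (rule mult_dvd_mono)
      then show ?thesis by (rule dvd_trans[OF le_imp_power_dvd, rotated]) (use True in linarith)
    next
      case False
      define t where "t = nat (int k + int l - s)"
      have t: "int t = int k + int l - s" "t > l" using False i s by (auto simp: t_def)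
      have "f ^ Suc t dvd lookup b (?n - i)" using l(2)[OF t(2)] j t(1) by simp
      moreover have "f ^ nat s dvd lookup a i"
        using aA[of i] m_ge_2 unfolding s pole_def by (simp add: div_minus_right flip: mult_minus_right)
      ultimately have "f ^ (nat s + Suc t) dvd lookup a i * lookup b (?n - i)"
        unfolding power_add by (intro mult_dvd_mono)
      then show ?thesis by (rule dvd_trans[OF le_imp_power_dvd, rotated]) (use t in linarith)
    qed
  next
    case False
    \<comment> \<open>For i not divisible by m, rounding up both pole orders gains one, which
      supplies the extra factor f.\<close>
    have "?n - i = int m * (- int (k + l)) + - i" by (simp add: algebra_simps)
    then have "(?n - i) div int m = (int m * (- int (k + l)) + - i) div int m" by (rule arg_cong)
    also have "\<dots> = - int (k + l) + (- i) div int m" using m_ge_2 by (intro div_mult_self4) simp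
    finally have "(?n - i) div int m = - int (k + l) + (- i) div int m" .
    also have "(- i) div int m = - (i div int m) - 1"
      using False m_ge_2 by (simp add: zdiv_zminus1_eq_if dvd_eq_mod_eq_0)
    finally have "Suc (k + l) \<le> pole i + pole (?n - i)" by (simp add: pole_def)
    then have "f ^ Suc (k + l) dvd f ^ pole i * f ^ pole (?n - i)"
      unfolding power_add[symmetric] by (rule le_imp_power_dvd)
    then show ?thesis by (rule dvd_trans) (intro mult_dvd_mono aA bA)
  qed
  assume "sg (- 1) 1 * (a * b) \<in> A"
  then have "f ^ pole (?n - 1) dvd lookup (sg (- 1) 1 * (a * b)) (?n - 1)" by (simp only: A_def mem_Collect_eq)
  moreover have "pole (?n - 1) = Suc (k + l)"
  proof -
    have "?n - 1 = int m * (- int (k + l) - 1) + (int m - 1)" by (simp add: algebra_simps)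
    then have "(?n - 1) div int m = - int (k + l) - 1" using m_ge_2 by (simp only: div_mult_self4) simp
    then show ?thesis by (simp add: pole_def)
  qed
  ultimately have dv: "f ^ Suc (k + l) dvd lookup (a * b) ?n" by (simp add: lookup_sg_mult)
  let ?I = "insert ?i (keys a)"
  have "a = (\<Sum>e\<in>?I. sg e (lookup a e))" by (rule laurent_expand) auto
  from arg_cong[OF this, of "\<lambda>a. lookup (a * b) ?n"]
  have "lookup (a * b) ?n = (\<Sum>e\<in>?I. lookup a e * lookup b (?n - e))"
    by (simp only: sum_distrib_right lookup_sum lookup_sg_mult)
  also have "\<dots> = lookup a ?i * lookup b (?n - ?i) + (\<Sum>e\<in>?I - {?i}. lookup a e * lookup b (?n - e))"
    by (rule sum.remove) auto
  finally have eq: "lookup (a * b) ?n = \<dots>" .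
  have "f ^ Suc (k + l) dvd (\<Sum>e\<in>?I - {?i}. lookup a e * lookup b (?n - e))"
    by (rule dvd_sum) (rule other, simp)
  then have main: "f ^ Suc (k + l) dvd lookup a ?i * lookup b (?n - ?i)"
    using dv unfolding eq by (simp add: dvd_add_left_iff)
  have ni: "?n - ?i = - (int m * int l)" by (simp add: algebra_simps)
  obtain \<alpha> \<beta> where ab: "lookup a ?i = f ^ k * \<alpha>" "lookup b (- (int m * int l)) = f ^ l * \<beta>"
    using aA[of ?i] bA[of "- (int m * int l)"] unfolding pole_multiple by (auto elim!: dvdE)
  have "f ^ (k + l) * f dvd f ^ (k + l) * (\<alpha> * \<beta>)"
    using main unfolding ni ab by (simp add: power_add mult_ac)
  then have "f dvd \<alpha> * \<beta>" using f_neq_0 by simp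
  then have "f dvd \<alpha> \<or> f dvd \<beta>" using prime_f by (simp add: prime_elem_dvd_mult_iff)
  then show False using k(1) l(1) unfolding ab power_Suc2 by auto
qed

lemma f_power_not_dvd:
  assumes "c \<noteq> 0"
  obtains l where "\<not> f ^ l dvd c"
proof -
  have "\<not> f ^ Suc (msize c) dvd c"
  proof
    assume "f ^ Suc (msize c) dvd c"
    then obtain d where d: "c = f ^ Suc (msize c) * d" by blast
    then have "f ^ Suc (msize c) \<noteq> 0" "d \<noteq> 0" using assms by auto
    then have "msize c = Suc (msize c) * msize f + msize d"
      by (metis d f_neq_0 msize_mult msize_power)
    moreover obtain n where "msize f = Suc n" using msize_f_pos gr0_conv_Suc by blast
    ultimately show False by simp
  qed
  then show ?thesis by (rule that)
qed

text \<open>A high power of x clears all poles, while a very negative one asks for more factors f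
  than some coefficient has. The first admissible exponent in between gives an element of A outside
  x A.\<close>

lemma reduced_multiple:
  assumes "d \<noteq> 0"
  obtains n where "sg n 1 * d \<in> A" "sg (n - 1) 1 * d \<notin> A"
proof -
  obtain e0 where e0: "lookup d e0 \<noteq> 0" using assms by (auto simp: poly_mapping_eq_iff fun_eq_iff)
  obtain l where l: "\<not> f ^ l dvd lookup d e0" using f_power_not_dvd[OF e0] .
  define n0 where "n0 = - e0 - int m * int l"
  have n0: "sg n0 1 * d \<notin> A"
  proof
    assume "sg n0 1 * d \<in> A"
    then have "f ^ pole (e0 + n0) dvd lookup d e0" by (auto simp: A_def lookup_sg_mult dest: spec[of _ "e0 + n0"])
    moreover have "e0 + n0 = - (int m * int l)" by (simp add: n0_def)
    ultimately show False using l by (simp only: pole_multiple)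
  qed
  define N where "N = (\<Sum>e\<in>keys d. \<bar>e\<bar>)"
  have "\<bar>e\<bar> \<le> N" if "e \<in> keys d" for e unfolding N_def by (rule member_le_sum) (use that in auto)
  then have N: "sg (max N n0) 1 * d \<in> A"
  proof -
    have "lookup d (e - max N n0) = 0" if "e < 0" for e
    proof (rule ccontr)
      assume "lookup d (e - max N n0) \<noteq> 0"
      then have "\<bar>e - max N n0\<bar> \<le> N" using \<open>\<And>e. e \<in> keys d \<Longrightarrow> \<bar>e\<bar> \<le> N\<close> by (simp add: in_keys_iff)
      then show False using that by linarith
    qed
    then have "f ^ pole e dvd lookup d (e - max N n0)" for e by (cases "e < 0") simp_all
    then show ?thesis by (simp add: A_def lookup_sg_mult)
  qed
  define k where "k = (LEAST k. sg (n0 + int k) 1 * d \<in> A)"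
  have "sg (n0 + int (nat (max N n0 - n0))) 1 * d \<in> A" using N by simp
  then have k: "sg (n0 + int k) 1 * d \<in> A" unfolding k_def by (rule LeastI)
  have "k \<noteq> 0" using k n0 by (intro notI) simp
  then have "k - 1 < k" by simp
  then have "sg (n0 + int (k - 1)) 1 * d \<notin> A" unfolding k_def by (rule not_less_Least)
  moreover have "n0 + int (k - 1) = n0 + int k - 1" using \<open>k \<noteq> 0\<close> by (simp add: of_nat_diff)
  ultimately show ?thesis using that[OF k] by metis
qed

section \<open>The polynomial ring k[z,t][x] inside A and its primes\<close>

definition j :: "'a poly poly poly \<Rightarrow> 'a laurent" where "j = evh emb x"

lemma rhom_emb: "rhom (emb :: 'a poly poly \<Rightarrow> 'a laurent)"
  by (simp add: rhom_def emb_add emb_mult)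

lemma rhom_j: "rhom j"
  unfolding j_def by (rule rhom_evh[OF rhom_emb])

lemma j_monom: "j (monom c n) = sg (int n) c"
proof (induction n)
  case 0
  then show ?case by (simp add: j_def monom_0 evh_pCons[OF rhom_emb])
next
  case (Suc n)
  then show ?case by (simp add: j_def monom_Suc evh_pCons[OF rhom_emb] x_def mult_single add.commute)
qed

lemma lookup_j: "lookup (j P) e = (if e \<ge> 0 then coeff P (nat e) else 0)"
proof -
  have "j P = (\<Sum>i\<le>degree P. sg (int i) (coeff P i))"
    by (subst poly_as_sum_of_monoms[of P, symmetric]) (simp only: rhom_sum[OF rhom_j] j_monom)
  then have "lookup (j P) e = (\<Sum>i\<le>degree P. if int i = e then coeff P i else 0)"
    by (simp add: lookup_sum lookup_sg)
  also have "\<dots> = (if e \<ge> 0 then coeff P (nat e) else 0)"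
  proof (cases "e \<ge> 0")
    case True
    then have "int i = e \<longleftrightarrow> i = nat e" for i by auto
    then show ?thesis using True by (simp add: coeff_eq_0)
  qed (auto intro: sum.neutral)
  finally show ?thesis .
qed

lemma j_in_A: "j P \<in> A"
  by (simp add: A_def lookup_j)

lemma j_eq_iff [simp]: "j P = j Q \<longleftrightarrow> P = Q"
proof
  assume *: "j P = j Q"
  have "coeff P n = coeff Q n" for n
    using arg_cong[OF *, of "\<lambda>a. lookup a (int n)"] by (simp add: lookup_j)
  then show "P = Q" by (rule poly_eqI)
qed simp

lemma clear_denominators:
  obtains N P where "N \<ge> M" "sg N 1 * a = j P"
proof -
  define N where "N = max M (\<Sum>e\<in>keys a. \<bar>e\<bar>)"
  have "\<bar>e\<bar> \<le> (\<Sum>e\<in>keys a. \<bar>e\<bar>)" if "e \<in> keys a" for e by (rule member_le_sum) (use that in auto)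
  then have e: "e + N \<ge> 0" if "e \<in> keys a" for e using that unfolding N_def by force
  have "sg N 1 * a = sg N 1 * (\<Sum>e\<in>keys a. sg e (lookup a e))"
    by (rule arg_cong[OF laurent_expand]) auto
  also have "\<dots> = (\<Sum>e\<in>keys a. sg (int (nat (e + N))) (lookup a e))"
    unfolding sum_distrib_left by (intro sum.cong refl) (simp add: mult_single e add.commute)
  also have "\<dots> = j (\<Sum>e\<in>keys a. monom (lookup a e) (nat (e + N)))"
    by (simp only: rhom_sum[OF rhom_j] j_monom)
  finally show ?thesis by (intro that[of N]) (simp_all add: N_def)
qed

lemma f_not_unit: "sg (- 1) 1 \<notin> A"
proof -
  have "(- 1) div int m = - 1" using m_ge_2 by (simp add: div_eq_minus1)
  then show ?thesis using prime_elem_not_unit[OF prime_f] by (simp add: sg_in_A pole_def)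
qed

text \<open>Write d = x^(-n) d' with d' in A but outside x A. If n were positive, p d' = x^n (p d)
  would lie in x A, against primality of x.\<close>

lemma cofactor_in_A:
  assumes p: "p \<in> A" "sg (- 1) 1 * p \<notin> A" and pd: "p * d \<in> A"
  shows "d \<in> A"
proof (cases "d = 0")
  case False
  then obtain n where n: "sg n 1 * d \<in> A" "sg (n - 1) 1 * d \<notin> A" by (rule reduced_multiple)
  have "n \<le> 0"
  proof (rule ccontr)
    assume "\<not> n \<le> 0"
    then have "sg (n - 1) 1 * (p * d) \<in> A" by (intro A_mult sg_nat_in_A pd) simp
    moreover have "sg (n - 1) 1 * (p * d) = sg (- 1) 1 * (p * (sg n 1 * d))"
      using sg_sg[of "- 1" n "p * d"] by (simp only: mult.left_commute) simp
    moreover have "sg (- 1) 1 * (sg n 1 * d) \<notin> A" using n(2) by (simp add: sg_sg)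
    ultimately show False using x_prime[OF p n(1)] by simp
  qed
  then have "sg (- n) 1 * (sg n 1 * d) \<in> A" by (intro A_mult sg_nat_in_A n(1)) simp
  then show ?thesis by (simp add: sg_sg)
qed (simp add: A_0)

lemma prime_on_x: "prime_on A x"
  unfolding prime_on_def
proof (intro conjI ballI impI)
  have x1: "sg (- 1) 1 * (x * c) = c" for c by (simp add: x_def sg_sg)
  have x2: "x * (sg (- 1) 1 * c) = c" for c by (simp add: x_def sg_sg)
  show "x * c \<noteq> 1" if "c \<in> A" for c
  proof
    assume "x * c = 1"
    then have "c = sg (- 1) 1" using x1[of c] by simp
    then show False using f_not_unit that by simp
  qed
  fix a b c assume abc: "a \<in> A" "b \<in> A" "c \<in> A" "a * b = x * c"
  have "sg (- 1) 1 * (a * b) \<in> A" unfolding abc(4) x1 by fact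
  then have "sg (- 1) 1 * a \<in> A \<or> sg (- 1) 1 * b \<in> A" using x_prime abc by blast
  then show "(\<exists>d\<in>A. a = x * d) \<or> (\<exists>d\<in>A. b = x * d)" using x2 by metis
qed (simp_all add: x_neq_0)

text \<open>Clearing denominators moves a factorisation to k[z,t][x], where \<open>r\<close> is
  prime and divides no power of x; \<open>cofactor_in_A\<close> brings the cofactor back to
  A.\<close>

lemma prime_on_reduced:
  fixes r :: "'a poly poly poly"
  assumes r: "prime_elem r" "\<not> r dvd [:0, 1:]"
    and p: "sg n 1 * j r \<in> A" "sg (n - 1) 1 * j r \<notin> A"
  shows "prime_on A (sg n 1 * j r)"
  unfolding prime_on_def
proof (intro conjI ballI impI)
  let ?p = "sg n 1 * j r"
  have X: "sg (int k) 1 = j ([:0, 1:] ^ k)" for k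
    using j_monom[of 1 k] by (simp only: monom_altdef smult_1_left)
  have jm: "j P * j Q = j (P * Q)" for P Q by (simp only: rhomD[OF rhom_j])
  have qX: "\<not> r dvd [:0, 1:] ^ k" for k
    using r(2) prime_elem_dvd_power[OF r(1)] by (rule contrapos_nn)
  have p': "sg (- 1) 1 * ?p \<notin> A" using p(2) by (simp add: sg_sg)
  show "?p \<in> A" by fact
  show "?p \<noteq> 0" using p' A_0 by auto
  show "?p * c \<noteq> 1" if "c \<in> A" for c
  proof
    assume c: "?p * c = 1"
    obtain N C where N: "N \<ge> n" "sg N 1 * c = j C" by (rule clear_denominators)
    have "j r * j C = sg (N - n) 1 * (?p * c)"
      using sg_sg[of "N - n" n "j r * c"] by (auto simp: N(2)[symmetric] mult_ac)
    also have "\<dots> = sg (int (nat (N - n))) 1" using c N by simp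
    finally have "r * C = [:0, 1:] ^ nat (N - n)" by (simp only: X jm j_eq_iff)
    then have "r dvd [:0, 1:] ^ nat (N - n)" by (rule dvdI[OF sym])
    then show False using qX by blast
  qed
  fix a b c assume abc: "a \<in> A" "b \<in> A" "c \<in> A" "a * b = ?p * c"
  obtain N P where P: "N \<ge> 0" "sg N 1 * a = j P" by (rule clear_denominators)
  obtain N' Q where Q: "N' \<ge> 0" "sg N' 1 * b = j Q" by (rule clear_denominators)
  obtain N'' C where C: "N'' \<ge> N + N' + n" "sg N'' 1 * c = j C" by (rule clear_denominators)
  define K where "K = nat (N'' - (N + N' + n))"
  have K: "int K = N'' - (N + N' + n)" using C(1) by (simp add: K_def)
  have "sg (int K) 1 * (j P * j Q) = sg (int K) 1 * (sg N 1 * (sg N' 1 * (a * b)))"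
    by (simp add: P(2)[symmetric] Q(2)[symmetric] mult_ac)
  also have "\<dots> = sg (int K + (N + N') + n) 1 * (j r * c)"
    unfolding abc(4) by (simp add: sg_sg mult.assoc add.assoc)
  also have "\<dots> = j r * j C" unfolding K C(2)[symmetric] by (simp add: mult_ac)
  finally have "[:0, 1:] ^ K * (P * Q) = r * C" unfolding X jm j_eq_iff .
  then have "r dvd [:0, 1:] ^ K * (P * Q)" by simp
  then have PQ: "r dvd P \<or> r dvd Q" using r(1) qX[of K] by (simp add: prime_elem_dvd_mult_iff)
  have cof: "\<exists>d\<in>A. a = ?p * d" if "r dvd P" "sg N 1 * a = j P" "a \<in> A" for a P N
  proof -
    obtain D where D: "P = r * D" using \<open>r dvd P\<close> by blast
    have "a = sg (- N) 1 * (sg N 1 * a)" by (simp add: sg_sg)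
    also have "\<dots> = sg (n + (- N - n)) 1 * (j r * j D)" unfolding that(2) D jm by simp
    also have "\<dots> = ?p * (sg (- N - n) 1 * j D)"
      unfolding sg_sg[symmetric] by (simp only: mult_ac)
    finally have a: "a = ?p * (sg (- N - n) 1 * j D)" .
    then have "sg (- N - n) 1 * j D \<in> A" using cofactor_in_A[OF p(1) p'] \<open>a \<in> A\<close> by simp
    then show ?thesis using a by blast
  qed
  from PQ show "(\<exists>d\<in>A. a = ?p * d) \<or> (\<exists>d\<in>A. b = ?p * d)" by (auto dest: cof[OF _ P(2) abc(1)] cof[OF _ Q(2) abc(2)])
qed

text \<open>Factorisation after inverting x, so n may be negative. The primes are kept outside x A
  so that the sign of the exponent can be controlled at the end.\<close>

definition splits :: "'a laurent \<Rightarrow> bool" where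
  "splits a \<longleftrightarrow> (\<exists>u v n ps. u \<in> A \<and> v \<in> A \<and> u * v = 1 \<and> a = u * (sg n 1 * prod_list ps) \<and>
    (\<forall>p\<in>set ps. prime_on A p \<and> sg (- 1) 1 * p \<notin> A))"

lemma splitsI:
  "u \<in> A \<Longrightarrow> v \<in> A \<Longrightarrow> u * v = 1 \<Longrightarrow> a = u * (sg n 1 * prod_list ps) \<Longrightarrow>
    (\<And>p. p \<in> set ps \<Longrightarrow> prime_on A p \<and> sg (- 1) 1 * p \<notin> A) \<Longrightarrow> splits a"
  unfolding splits_def by blast

lemma splits_mult:
  assumes "splits a" "splits b"
  shows "splits (a * b)"
proof -
  obtain u v n ps where a: "u \<in> A" "v \<in> A" "u * v = 1" "a = u * (sg n 1 * prod_list ps)"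
    "\<forall>p\<in>set ps. prime_on A p \<and> sg (- 1) 1 * p \<notin> A" using assms(1) unfolding splits_def by blast
  obtain u' v' n' ps' where b: "u' \<in> A" "v' \<in> A" "u' * v' = 1" "b = u' * (sg n' 1 * prod_list ps')"
    "\<forall>p\<in>set ps'. prime_on A p \<and> sg (- 1) 1 * p \<notin> A" using assms(2) unfolding splits_def by blast
  show ?thesis
  proof (rule splitsI)
    show "u * u' \<in> A" "v * v' \<in> A" using a b by (simp_all add: A_mult)
    have "(u * u') * (v * v') = (u * v) * (u' * v')" by (simp only: mult_ac)
    then show "(u * u') * (v * v') = 1" using a b by simp
    have "sg (n + n') 1 = (sg n 1 * sg n' 1 :: 'a laurent)" by (simp add: mult_single)
    then show "a * b = (u * u') * (sg (n + n') 1 * prod_list (ps @ ps'))"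
      by (simp add: a(4) b(4) mult_ac)
    show "prime_on A p \<and> sg (- 1) 1 * p \<notin> A" if "p \<in> set (ps @ ps')" for p using that a(5) b(5) by auto
  qed
qed

lemma splits_unit:
  assumes "P * Q = 1"
  shows "splits (j P)"
proof (rule splitsI[of "j P" "j Q" _ 0 "[]"])
  show "j P * j Q = 1" by (simp add: assms rhomD[OF rhom_j] flip: rhomD(3)[OF rhom_j])
qed (simp_all add: j_in_A)

text \<open>An irreducible factor of x is x up to a unit; any other irreducible is shifted by a
  power of x to a prime of A.\<close>

lemma splits_irreducible:
  fixes r :: "'a poly poly poly"
  assumes r: "Factorial_Ring.irreducible r"
  shows "splits (j r)"
proof (cases "r dvd [:0, 1:]")
  case True
  then obtain w where w: "[:0, 1:] = r * w" by blast
  have "coeff r 0 * coeff w 0 = coeff (r * w) 0" "coeff r 1 * coeff w 0 + coeff r 0 * coeff w 1 = coeff (r * w) 1"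
    by (simp_all add: coeff_mult add.commute)
  moreover have nz: "r \<noteq> 0" "w \<noteq> 0" using w by auto
  moreover have "degree r + degree w = 1" using arg_cong[OF w, of degree] nz by (simp add: degree_mult_eq)
  ultimately have c: "coeff r 1 * coeff w 0 + coeff r 0 * coeff w 1 = 1" and "degree r = 0 \<or> degree w = 0"
    unfolding w[symmetric] by auto
  moreover have "degree r \<noteq> 0"
  proof
    assume 0: "degree r = 0"
    then obtain c0 where c0: "r = [:c0:]" by (rule degree_eq_zeroE)
    then have "r * [:coeff w 1:] = 1" using c by (simp add: mult.commute)
    then have "is_unit r" by (rule dvdI[OF sym])
    then show False using r by (simp add: Factorial_Ring.irreducible_def)
  qed
  ultimately obtain w0 where w0: "w = [:w0:]" by (auto elim: degree_eq_zeroE)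
  then have u: "[:coeff r 1:] * w = 1" using c by (simp add: mult.commute)
  have "r = ([:coeff r 1:] * w) * r" unfolding u by simp
  also have "\<dots> = [:coeff r 1:] * [:0, 1:]" unfolding w by (simp only: mult_ac)
  finally have "r = [:coeff r 1:] * [:0, 1:]" .
  then have "j r = j [:coeff r 1:] * j [:0, 1:]" by (metis rhomD(3)[OF rhom_j])
  also have "splits \<dots>"
  proof (rule splits_mult[OF splits_unit[OF u]])
    have "j [:0, 1:] = 1 * (sg 1 1 * prod_list [])" using j_monom[of 1 1] by (simp add: monom_Suc monom_0)
    then show "splits (j [:0, 1:])" by (rule splitsI[rotated 3]) (simp_all add: A_1)
  qed
  finally show ?thesis .
next
  case False
  have "j r \<noteq> 0" using j_eq_iff[of r 0] r rhom_0[OF rhom_j] by auto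
  then obtain n where n: "sg n 1 * j r \<in> A" "sg (n - 1) 1 * j r \<notin> A" by (rule reduced_multiple)
  have "prime_elem r" using r by simp
  then have p: "prime_on A (sg n 1 * j r)" by (rule prime_on_reduced[OF _ False n])
  show ?thesis
  proof (rule splitsI)
    show "j r = 1 * (sg (- n) 1 * prod_list [sg n 1 * j r])" by (simp add: sg_sg)
    show "prime_on A p \<and> sg (- 1) 1 * p \<notin> A" if "p \<in> set [sg n 1 * j r]" for p
      using that p n(2) by (simp add: sg_sg)
  qed (simp_all add: A_1)
qed

lemma splits_j:
  assumes "P \<noteq> 0"
  shows "splits (j P)"
proof (cases "P dvd 1")
  case True
  then obtain Q where "1 = P * Q" by blast
  then show ?thesis by (intro splits_unit[OF sym])
next
  case False
  obtain F where F: "mset_factors F P" using mset_factors_exist[OF assms False] by blast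
  have "splits (j (prod_mset F))" if "\<forall>r\<in>#F. Factorial_Ring.irreducible r" for F
    using that
  proof (induction F)
    case empty
    show ?case using splits_unit[of 1 1] by simp
  next
    case (add r F)
    then show ?case using splits_mult[OF splits_irreducible] by (simp add: rhomD[OF rhom_j])
  qed
  then show ?thesis using F by (auto elim!: mset_factorsE)
qed

lemma A_prime_factorization:
  assumes a: "a \<in> A" "a \<noteq> 0"
  shows "\<exists>u v ps. u \<in> A \<and> v \<in> A \<and> u * v = 1 \<and> a = u * prod_list ps \<and> (\<forall>p\<in>set ps. prime_on A p)"
proof -
  obtain N P where P: "N \<ge> 0" "sg N 1 * a = j P" by (rule clear_denominators)
  have aP: "a = sg (- N) 1 * j P" by (simp add: P(2)[symmetric] sg_sg)
  then have "P \<noteq> 0" using a(2) rhom_0[OF rhom_j] by auto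
  then obtain u v n ps where u: "u \<in> A" "v \<in> A" "u * v = 1" and jP: "j P = u * (sg n 1 * prod_list ps)" and
    ps: "\<forall>p\<in>set ps. prime_on A p \<and> sg (- 1) 1 * p \<notin> A" using splits_j unfolding splits_def by blast
  define t where "t = n - N"
  have at: "a = sg t 1 * (u * prod_list ps)" unfolding aP jP t_def by (simp add: mult.left_commute sg_sg)
  have u1: "sg (- 1) 1 * u \<notin> A"
  proof
    assume "sg (- 1) 1 * u \<in> A"
    from A_mult[OF this u(2)] show False using u(3) f_not_unit by (simp add: mult.assoc)
  qed
  have "u * prod_list ps \<in> A \<and> sg (- 1) 1 * (u * prod_list ps) \<notin> A"
    using ps
  proof (induction ps)
    case (Cons p ps)
    then have "p \<in> A" "sg (- 1) 1 * p \<notin> A" "u * prod_list ps \<in> A" "sg (- 1) 1 * (u * prod_list ps) \<notin> A"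
      by (auto simp: prime_on_def)
    then have "p * (u * prod_list ps) \<in> A" "sg (- 1) 1 * (p * (u * prod_list ps)) \<notin> A"
      by (simp_all add: A_mult x_prime)
    then show ?case by (simp add: mult.left_commute)
  qed (use u u1 in simp)
  then have up: "sg (- 1) 1 * (u * prod_list ps) \<notin> A" by blast
  \<comment> \<open>A negative exponent would put u times the product of the primes into x A,
    although x is prime and none of these factors lies in x A.\<close>
  have "t \<ge> 0"
  proof (rule ccontr)
    assume "\<not> t \<ge> 0"
    then have "sg (- t - 1) 1 * a \<in> A" by (intro A_mult sg_nat_in_A a) simp
    then show False using up unfolding at by (simp add: sg_sg)
  qed
  then have "sg t 1 = x ^ nat t" by (simp add: x_def sg_power)
  then have ax: "a = u * prod_list (replicate (nat t) x @ ps)" unfolding at by (simp add: mult.left_commute)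
  show ?thesis
    by (intro exI conjI, fact, fact, fact, fact ax) (use ps prime_on_x in auto)
qed

end

section \<open>The presentation of the Asanuma ring\<close>

context asanuma
begin

definition ylin :: "'a poly poly poly \<Rightarrow> 'a laurent" where "ylin = evh emb y"

definition pres :: "'a poly poly poly poly \<Rightarrow> 'a laurent" where "pres = evh ylin x"

lemma rhom_ylin: "rhom ylin"
  unfolding ylin_def by (rule rhom_evh[OF rhom_emb])

lemma rhom_pres: "rhom pres"
  unfolding pres_def by (rule rhom_evh[OF rhom_ylin])

lemma pres_const: "pres [:[:c:]:] = emb c" and pres_x: "pres [:0, 1:] = x" and pres_y: "pres [:[:0, 1:]:] = y"
  using rhomD(1)[OF rhom_ylin] unfolding pres_def evh_pCons[OF rhom_ylin]
  by (simp_all add: ylin_def evh_pCons[OF rhom_emb] del: pCons_one)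

lemma pres_asanuma_polynomial: "pres (asanuma_polynomial m f) = 0"
proof -
  have pow: "pres (P ^ n) = pres P ^ n" for P n
    by (induction n) (simp_all add: rhomD[OF rhom_pres])
  show ?thesis
    unfolding asanuma_polynomial_def Let_def rhomD(2,3)[OF rhom_pres] pow
    by (simp add: pres_const pres_x pres_y x_power_y del: pCons_one)
qed

lemma range_pres: "range pres = A"
proof
  show "range pres \<subseteq> A"
  proof safe
    fix P
    have "ylin P \<in> A" for P
      unfolding ylin_def by (rule evh_in_subring[OF rhom_emb]) (auto simp: A_add A_mult)
    then show "pres P \<in> A"
      unfolding pres_def by (intro evh_in_subring[OF rhom_ylin]) (auto simp: A_add A_mult)
  qed
  show "A \<subseteq> range pres"
  proof (rule A_subset_if_gens)
    show "range sc \<subseteq> range pres" "xz \<in> range pres" "xt \<in> range pres"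
      unfolding sc_def xz_def xt_def pres_const[symmetric] by blast+
    show "x \<in> range pres" "y \<in> range pres" unfolding pres_x[symmetric] pres_y[symmetric] by blast+
    show "a + b \<in> range pres" "a * b \<in> range pres" if "a \<in> range pres" "b \<in> range pres" for a b
      using that by (auto simp flip: rhomD[OF rhom_pres])
  qed
qed

lemma lookup_ylin:
  "lookup (ylin S) e = (\<Sum>l\<le>degree S. if e = - (int m * int l) then (- f) ^ l * coeff S l else 0)"
  unfolding ylin_def evh_sum[OF rhom_emb le_refl] lookup_sum y_power
  by (intro sum.cong refl) (simp add: mult_single lookup_sg mult.commute)

text \<open>The monomials x^i y^l with i < m have pairwise different degrees i - m l in x, so their
  coefficients cannot cancel.\<close>

lemma pres_small_degree:
  assumes R: "degree R < m" "pres R = 0"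
  shows "R = 0"
proof (rule ccontr)
  assume "R \<noteq> 0"
  then obtain i where i: "coeff R i \<noteq> 0" by (auto simp: poly_eq_iff)
  then obtain l where l: "coeff (coeff R i) l \<noteq> 0" by (auto simp: poly_eq_iff)
  let ?e = "int i - int m * int l"
  have im: "i < m" using i R(1) le_degree[of R i] by linarith
  have "pres R = (\<Sum>k\<le>degree R. sg (int k) 1 * ylin (coeff R k))"
    unfolding pres_def evh_sum[OF rhom_ylin le_refl] by (simp add: x_def sg_power mult.commute)
  then have "lookup (pres R) ?e = (\<Sum>k\<le>degree R. lookup (ylin (coeff R k)) (?e - int k))"
    by (simp add: lookup_sum lookup_sg_mult)
  also have "\<dots> = (\<Sum>k\<le>degree R. if k = i then (- f) ^ l * coeff (coeff R i) l else 0)"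
  proof (intro sum.cong refl)
    fix k assume "k \<in> {..degree R}"
    then have km: "k < m" using R(1) by simp
    have "?e - int k = - (int m * int l') \<longleftrightarrow> k = i \<and> l' = l" for l'
    proof
      assume *: "?e - int k = - (int m * int l')"
      then have eq: "int i + int m * int l' = int k + int m * int l" by (simp add: algebra_simps)
      then have "(int i + int m * int l') mod int m = (int k + int m * int l) mod int m" by simp
      then have "k = i" using im km by simp
      then show "k = i \<and> l' = l" using eq im by simp
    qed auto
    then have "lookup (ylin (coeff R k)) (?e - int k) =
      (\<Sum>l'\<le>degree (coeff R k). if k = i \<and> l' = l then (- f) ^ l * coeff (coeff R i) l else 0)"
      unfolding lookup_ylin by (intro sum.cong refl) auto
    also have "\<dots> = (if k = i then (- f) ^ l * coeff (coeff R i) l else 0)"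
      using l by (auto intro: le_degree)
    finally show "lookup (ylin (coeff R k)) (?e - int k) =
      (if k = i then (- f) ^ l * coeff (coeff R i) l else 0)" .
  qed
  also have "\<dots> = (- f) ^ l * coeff (coeff R i) l" using le_degree[OF i] by simp
  finally show False using R(2) l by simp
qed

text \<open>Here \<open>[:0, 1:]\<close> is y as a coefficient. It is not a zero divisor modulo the
  polynomial: at y = 0 the polynomial becomes f, which is nonzero, so y divides Q and can be
  cancelled.\<close>

lemma asanuma_polynomial_dvd_cancel:
  "smult ([:0, 1:] ^ n) P = asanuma_polynomial m f * Q \<Longrightarrow> asanuma_polynomial m f dvd P"
proof (induction n arbitrary: P Q)
  case (Suc n)
  let ?T = "map_poly (\<lambda>c :: 'a poly poly poly. coeff c 0)"
  have m0: "m \<noteq> 0" using m_ge_2 by simp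
  have Tmult: "?T (P * Q) = ?T P * ?T Q" for P Q
    by (rule map_poly_mult_hom) (simp_all add: coeff_mult)
  have "?T (smult ([:0, 1:] ^ Suc n) P) = 0"
    by (rule poly_eqI) (simp add: coeff_map_poly coeff_mult)
  then have "?T (asanuma_polynomial m f) * ?T Q = 0" unfolding Suc.prems Tmult .
  moreover have "coeff (coeff (asanuma_polynomial m f) 0) 0 = f"
    using m0 by (simp add: asanuma_polynomial_def coeff_mult coeff_0_power)
  then have "?T (asanuma_polynomial m f) \<noteq> 0"
    by (metis coeff_map_poly coeff_0 f_neq_0)
  ultimately have "?T Q = 0" by simp
  then have "coeff (coeff Q i) 0 = 0" for i
    by (metis coeff_map_poly coeff_0)
  then have "[:0, 1:] dvd coeff Q i" for i
    using poly_eq_0_iff_dvd[of "coeff Q i" 0] by (simp add: poly_0_coeff_0)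
  then obtain Q' where Q': "Q = [:[:0, 1:]:] * Q'" using const_poly_dvd_iff[of "[:0, 1:]" Q] by (auto elim: dvdE)
  have "smult [:0, 1:] (smult ([:0, 1:] ^ n) P - asanuma_polynomial m f * Q') = 0"
    using Suc.prems by (simp add: Q' smult_diff_right)
  then have "smult ([:0, 1:] ^ n) P = asanuma_polynomial m f * Q'" by simp
  then show ?case by (rule Suc.IH)
qed auto

text \<open>Pseudo-division by the polynomial, whose leading coefficient in x is y, leaves a
  remainder of degree below m. It is killed by \<open>pres\<close>, hence zero, and the power of y
  introduced by the division cancels.\<close>

lemma pres_eq_0_iff: "pres P = 0 \<longleftrightarrow> asanuma_polynomial m f dvd P"
proof
  let ?G = "asanuma_polynomial m f"
  have m0: "m \<noteq> 0" using m_ge_2 by simp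
  have G: "?G = monom [:0, 1:] m + [:[:f:]:]"
    by (simp add: asanuma_polynomial_def monom_altdef)
  have c: "coeff ?G m = [:0, 1:]" unfolding G using m0 by (simp add: coeff_pCons split: nat.split)
  have "degree ?G = m"
  proof (rule antisym)
    show "degree ?G \<le> m" unfolding G by (intro degree_add_le) (simp_all add: degree_monom_le)
    show "m \<le> degree ?G" using c by (intro le_degree) simp
  qed
  assume P: "pres P = 0"
  have G0: "?G \<noteq> 0" using c by auto
  obtain Q R where QR: "pseudo_divmod P ?G = (Q, R)" by fastforce
  define n where "n = Suc (degree P) - degree ?G"
  have eq: "smult ([:0, 1:] ^ n) P = ?G * Q + R" and R: "R = 0 \<or> degree R < m"
    using pseudo_divmod[OF G0 QR] c \<open>degree ?G = m\<close> unfolding n_def by simp_all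
  have "pres ([:[:0, 1:] ^ n:] * P) = pres (?G * Q + R)" using eq by simp
  then have "pres R = 0" unfolding rhomD(2,3)[OF rhom_pres] pres_asanuma_polynomial P by simp
  then have "R = 0" using R pres_small_degree by blast
  then show "?G dvd P" using eq asanuma_polynomial_dvd_cancel by simp
next
  assume "asanuma_polynomial m f dvd P"
  then show "pres P = 0" by (auto simp: rhomD[OF rhom_pres] pres_asanuma_polynomial)
qed

end

section \<open>Quotients by principal ideals\<close>

lemma ring_of_type_simps [simp]:
  "carrier (ring_of_type_algebra :: 'r::comm_ring_1 ring) = UNIV"
  "monoid.mult (ring_of_type_algebra :: 'r::comm_ring_1 ring) = (*)"
  "one (ring_of_type_algebra :: 'r::comm_ring_1 ring) = 1"
  "ring.zero (ring_of_type_algebra :: 'r::comm_ring_1 ring) = 0"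
  "add (ring_of_type_algebra :: 'r::comm_ring_1 ring) = (+)"
  by (simp_all add: ring_of_type_algebra_def)

lemma PIdl_type: "PIdl\<^bsub>ring_of_type_algebra\<^esub> g = {a. g dvd a}" for g :: "'r::comm_ring_1"
  by (auto simp: cgenideal_def dvd_def mult.commute)

lemma residue_class_altdef: "residue_class g a = {b. g dvd b - a}"
proof -
  have "(\<exists>c. g dvd c \<and> b = c + a) \<longleftrightarrow> g dvd b - a" for b
    by (auto intro: exI[of _ "b - a"])
  then show ?thesis unfolding residue_class_def a_r_coset_def' PIdl_type by auto
qed

lemma residue_class_eq_iff: "residue_class g a = residue_class g b \<longleftrightarrow> g dvd a - b"
proof
  assume "residue_class g a = residue_class g b"
  moreover have "a \<in> residue_class g a" by (simp add: residue_class_altdef)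
  ultimately show "g dvd a - b" by (simp add: residue_class_altdef)
next
  assume *: "g dvd a - b"
  have "g dvd c - a \<longleftrightarrow> g dvd c - b" for c
    using dvd_add_left_iff[OF *, of "c - a"] by simp
  then show "residue_class g a = residue_class g b" by (simp add: residue_class_altdef)
qed

lemma ideal_PIdl_type: "ideal (PIdl\<^bsub>ring_of_type_algebra\<^esub> g) ring_of_type_algebra" for g :: "'r::comm_ring_1"
  by (rule cring.cgenideal_ideal[OF cring_from_type_algebra]) simp

lemma cring_principal_quot: "cring (principal_quot g)"
  unfolding principal_quot_def by (rule ideal.quotient_is_cring[OF ideal_PIdl_type cring_from_type_algebra])

lemma residue_class_hom: "residue_class g \<in> Ring.ring_hom ring_of_type_algebra (principal_quot g)"
proof -
  have "residue_class g = (+>\<^bsub>ring_of_type_algebra\<^esub>) (PIdl\<^bsub>ring_of_type_algebra\<^esub> g)"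
    by (simp add: fun_eq_iff residue_class_def)
  then show ?thesis unfolding principal_quot_def using ideal.rcos_ring_hom[OF ideal_PIdl_type] by simp
qed

lemma carrier_principal_quot: "carrier (principal_quot g) = range (residue_class g)"
  unfolding principal_quot_def FactRing_def A_RCOSETS_def' residue_class_def by auto

lemma principal_quot_iso:
  fixes h :: "'r::comm_ring_1 \<Rightarrow> 's::comm_ring_1"
  assumes h: "rhom h" and S: "range h = S" and ker: "\<And>a. h a = 0 \<longleftrightarrow> g dvd a"
  shows "\<exists>H \<in> ring_iso (principal_quot g) (ring_on S). \<forall>a. H (residue_class g a) = h a"
proof -
  have eq: "h a = h b \<longleftrightarrow> residue_class g a = residue_class g b" for a b
  proof -
    have "h a = h (a - b) + h b" by (simp flip: rhomD(2)[OF h])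
    then show ?thesis unfolding residue_class_eq_iff ker[symmetric] by simp
  qed
  define H where "H C = h (SOME a. C = residue_class g a)" for C
  have H: "H (residue_class g a) = h a" for a
  proof -
    have "residue_class g a = residue_class g (SOME b. residue_class g a = residue_class g b)"
      by (rule someI[of _ a]) simp
    then show ?thesis unfolding H_def eq by simp
  qed
  note hom = ring_hom_memE(2-4)[OF residue_class_hom[of g], symmetric, simplified]
  have "H \<in> ring_iso (principal_quot g) (ring_on S)"
  proof (rule ring_iso_memI)
    show "bij_betw H (carrier (principal_quot g)) (carrier (ring_on S))"
      unfolding carrier_principal_quot bij_betw_def inj_on_def
      using S by (auto simp: H eq image_image)
  qed (use S in \<open>auto simp: carrier_principal_quot H rhomD[OF h] hom\<close>)
  then show ?thesis using H by blast
qed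

lemma rhom_of_principal_quot_iso:
  fixes H :: "'r::comm_ring_1 set \<Rightarrow> 's::comm_ring_1"
  assumes H: "H \<in> ring_iso (principal_quot g) ring_of_type_algebra"
  defines "h \<equiv> \<lambda>a. H (residue_class g a)"
  shows "rhom h" "surj h" "h a = 0 \<longleftrightarrow> g dvd a"
proof -
  note hom = ring_hom_memE(2-4)[OF residue_class_hom[of g], simplified]
  note iso = ring_iso_memE[OF H]
  have c: "residue_class g a \<in> carrier (principal_quot g)" for a by (simp add: carrier_principal_quot)
  show "rhom h"
    unfolding rhom_def h_def hom by (simp add: iso(2-4) c)
  then have "h 0 = 0" by (rule rhom_0)
  have bij: "bij_betw H (range (residue_class g)) UNIV" using iso(5) by (simp add: carrier_principal_quot)
  then show "surj h" unfolding h_def bij_betw_def by (simp add: image_image)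
  have "h a = h 0 \<longleftrightarrow> residue_class g a = residue_class g 0"
    unfolding h_def using bij by (intro inj_on_eq_iff) (auto simp: bij_betw_def)
  then show "h a = 0 \<longleftrightarrow> g dvd a" unfolding \<open>h 0 = 0\<close> residue_class_eq_iff by simp
qed

lemma line_exists:
  fixes f :: "'a::field poly poly"
  assumes "k_isomorphic (principal_quot f) (\<lambda>c. residue_class f [:[:c:]:])
    (ring_of_type_algebra :: 'a poly ring) (\<lambda>c. [:c:])"
  shows "\<exists>\<psi> q. line f \<psi> q"
proof -
  obtain H where H: "H \<in> ring_iso (principal_quot f) (ring_of_type_algebra :: 'a poly ring)"
    "\<And>c. H (residue_class f [:[:c:]:]) = [:c:]"
    using assms unfolding k_isomorphic_def by blast
  define \<psi> where "\<psi> a = H (residue_class f a)" for a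
  have \<psi>: "rhom \<psi>" "surj \<psi>" "\<And>a. \<psi> a = 0 \<longleftrightarrow> f dvd a"
    using rhom_of_principal_quot_iso[OF H(1)] unfolding \<psi>_def by blast+
  obtain q where q: "\<psi> q = [:0, 1:]" using \<psi>(2) by (metis surjD)
  have cst: "\<psi> (cst c) = [:c:]" for c using H(2) by (simp add: \<psi>_def cst_def)
  \<comment> \<open>For f = 0 the map \<psi> is injective and every element is a polynomial in q.
    Degrees in the outer variable exclude this: t has degree 0 without being constant, so q has
    degree 0, but z has degree 1.\<close>
  have "f \<noteq> 0"
  proof
    assume "f = 0"
    then have inj: "\<psi> a = 0 \<longleftrightarrow> a = 0" for a using \<psi>(3) by simp
    have ev: "\<psi> (ev P q) = P" for P
      by (induction P rule: pCons_induct)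
         (simp_all add: inj rhomD[OF \<psi>(1)] cst q)
    have surj: "a = ev (\<psi> a) q" for a
    proof -
      have "\<psi> (a - ev (\<psi> a) q) + \<psi> (ev (\<psi> a) q) = \<psi> a" by (simp flip: rhomD(2)[OF \<psi>(1)])
      then show ?thesis using inj[of "a - ev (\<psi> a) q"] by (simp add: ev)
    qed
    have deg: "degree (ev P q) = degree P * degree q" for P
    proof -
      have "ev P q = pcompose (map_poly (\<lambda>c. [:c:]) P) q"
        by (induction P rule: pCons_induct) (simp_all add: map_poly_pCons pcompose_pCons cst_def)
      then show ?thesis by (simp add: degree_pcompose degree_map_poly)
    qed
    let ?t = "[:[:0, 1 :: 'a:]:]" and ?z = "[:0, 1 :: 'a poly:]"
    have "degree ?t = degree (\<psi> ?t) * degree q"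
      using arg_cong[OF surj[of ?t], of degree] by (simp only: deg)
    then have "degree (\<psi> ?t) = 0 \<or> degree q = 0" by simp
    moreover have "degree (\<psi> ?t) \<noteq> 0"
    proof
      assume "degree (\<psi> ?t) = 0"
      then obtain c where "\<psi> ?t = [:c:]" by (rule degree_eq_zeroE)
      with surj[of ?t] have "?t = ev [:c:] q" by simp
      then show False by (simp add: cst_def)
    qed
    ultimately have "degree q = 0" by simp
    moreover have "degree ?z = degree (\<psi> ?z) * degree q"
      using arg_cong[OF surj[of ?z], of degree] by (simp only: deg)
    ultimately show False by simp
  qed
  then have "line f \<psi> q" using \<psi> q cst by unfold_locales (simp_all add: rhomD)
  then show ?thesis by blast
qed

section \<open>Transcendence degree and gradings\<close>

context asanuma
begin

section \<open>The transcendence basis x, z, t\<close>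

lemma sg_sum: "sg n (sum F I) = (\<Sum>i\<in>I. sg n (F i))" for F :: "_ \<Rightarrow> 'a poly poly"
  by (induction I rule: infinite_finite_induct) (simp_all add: single_add)

lemma ring_polynomials_spanned:
  obtains F k where "finite F" "j P = (\<Sum>d\<in>F. sc (k d) * mon3 x xz xt d)"
proof -
  define I where "I = (\<Union>i\<le>degree P. {p. cf (coeff P i) p \<noteq> 0})"
  have I: "finite I" unfolding I_def by (auto intro: finite_cf)
  have "j P = (\<Sum>i\<le>degree P. sg (int i) (coeff P i))"
    by (subst poly_as_sum_of_monoms[of P, symmetric]) (simp only: rhom_sum[OF rhom_j] j_monom)
  also have "\<dots> = (\<Sum>i\<le>degree P. \<Sum>p\<in>I. sc (cf (coeff P i) p) * mon3 x xz xt (i, p))"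
  proof (intro sum.cong refl)
    fix i assume "i \<in> {..degree P}"
    then have "coeff P i = (\<Sum>p\<in>I. cst (cf (coeff P i) p) * mono p)"
      by (intro cf_expand I) (auto simp: I_def)
    from arg_cong[OF this, of "sg (int i)"]
    have "sg (int i) (coeff P i) = (\<Sum>p\<in>I. sg (int i) (cst (cf (coeff P i) p) * mono p))"
      by (simp only: sg_sum)
    then show "sg (int i) (coeff P i) = (\<Sum>p\<in>I. sc (cf (coeff P i) p) * mon3 x xz xt (i, p))"
      by (simp only: mon3_x_z_t sc_def mult_single fst_conv snd_conv add_0)
  qed
  also have "\<dots> = (\<Sum>d\<in>{..degree P} \<times> I. sc (cf (coeff P (fst d)) (snd d)) * mon3 x xz xt d)"
    by (simp add: sum.cartesian_product case_prod_beta)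
  finally show ?thesis using I by (intro that[of "{..degree P} \<times> I"]) auto
qed

text \<open>For maximality, a power of x turns any further element into a polynomial in x, z and t;
  this is a relation with coefficient -1 at the monomial containing that element.\<close>

theorem transcendence_degree_3:
  assumes R: "ring_embedding R h A" and \<alpha>: "\<And>c. \<alpha> c \<in> carrier R \<and> h (\<alpha> c) = sc c"
  shows "has_transcendence_degree R (range \<alpha>) 3"
proof -
  interpret R: ring_embedding R h A by fact
  have K: "range \<alpha> \<subseteq> carrier R" using \<alpha> by auto
  have xzA: "xz \<in> A" "xt \<in> A" by (simp_all add: xz_def xt_def)
  obtain b1 b2 b3 where bR: "b1 \<in> carrier R" "b2 \<in> carrier R" "b3 \<in> carrier R" and
    h: "h b1 = x" "h b2 = xz" "h b3 = xt"
    using R.h_surj[OF x_in_A] R.h_surj[OF xzA(1)] R.h_surj[OF xzA(2)] by blast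
  have dist: "b1 \<noteq> b2" "b1 \<noteq> b3" "b2 \<noteq> b3"
  proof -
    have "lookup x 1 = 1" "lookup xz 1 = 0" "lookup xt 1 = 0"
      by (simp_all add: x_def xz_def xt_def lookup_sg)
    then show "b1 \<noteq> b2" "b1 \<noteq> b3" using h by auto
    have "xz \<noteq> xt" by (simp add: xz_def xt_def)
    then show "b2 \<noteq> b3" using h by auto
  qed
  let ?S = "{b1, b2, b3}"
  have indep: "algebraically_independent R (range \<alpha>) ?S"
    unfolding R.algebraically_independent_iff[OF _ K, of ?S, simplified, OF conjI[OF bR(1) conjI[OF bR(2,3)]]]
  proof (intro allI impI ballI)
    fix T M c e assume *: "finite T \<and> T \<subseteq> ?S \<and> finite M \<and> M \<subseteq> (T \<rightarrow>\<^sub>E UNIV) \<and> c \<in> M \<rightarrow> range \<alpha> \<and>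
      (\<Sum>e\<in>M. h (c e) * (\<Prod>s\<in>T. h s ^ e s)) = 0" and e: "e \<in> M"
    \<comment> \<open>Exponent vectors are \<open>undefined\<close> outside T; they are replaced by
      0 there, to obtain exponents for all three basis elements.\<close>
    define z where "z e s = (if s \<in> T then e s else 0)" for e :: "'b \<Rightarrow> nat" and s
    define tr where "tr e = (z e b1, z e b2, z e b3)" for e
    have "(\<Prod>s\<in>T. h s ^ e s) = mon3 x xz xt (tr e)" for e
    proof -
      have "(\<Prod>s\<in>T. h s ^ e s) = (\<Prod>s\<in>T. h s ^ z e s)" by (intro prod.cong) (auto simp: z_def)
      also have "\<dots> = (\<Prod>s\<in>?S. h s ^ z e s)"
        by (rule prod.mono_neutral_left) (use * in \<open>auto simp: z_def\<close>)
      also have "\<dots> = mon3 x xz xt (tr e)" using dist by (simp add: mon3_def tr_def h mult.assoc)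
      finally show ?thesis .
    qed
    moreover have "\<forall>e\<in>M. \<exists>k. c e = \<alpha> k" using * by auto
    then obtain k where k: "\<And>e. e \<in> M \<Longrightarrow> c e = \<alpha> (k e)" by metis
    ultimately have sum: "(\<Sum>e\<in>M. sc (k e) * mon3 x xz xt (tr e)) = 0"
      using * \<alpha> by simp
    have inj: "inj_on tr M"
    proof (rule inj_onI)
      fix d e assume de: "d \<in> M" "e \<in> M" "tr d = tr e"
      have "d s = e s" for s
      proof (cases "s \<in> T")
        case True
        then have "s \<in> ?S" using * by blast
        then have "z d s = z e s" using de(3) by (auto simp: tr_def)
        then show ?thesis using True by (simp add: z_def)
      next
        case False
        have "d \<in> T \<rightarrow>\<^sub>E UNIV" "e \<in> T \<rightarrow>\<^sub>E UNIV" using * de by auto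
        then show ?thesis using False by (auto simp: PiE_iff extensional_def)
      qed
      then show "d = e" by blast
    qed
    have "(\<Sum>d\<in>tr ` M. sc (k (the_inv_into M tr d)) * mon3 x xz xt d) = 0"
      unfolding sum.reindex[OF inj] using sum by (simp add: the_inv_into_f_f[OF inj])
    then have "k (the_inv_into M tr (tr e)) = 0"
      by (intro indep3D[OF indep3_x_z_t, of "tr ` M"]) (use * e in auto)
    then show "h (c e) = 0" using k[OF e] e \<alpha> by (simp add: the_inv_into_f_f[OF inj])
  qed
  have maximal: "S' = ?S" if S': "?S \<subseteq> S'" "S' \<subseteq> carrier R" "algebraically_independent R (range \<alpha>) S'" for S'
  proof (rule ccontr)
    assume "S' \<noteq> ?S"
    then obtain b where b: "b \<in> S'" "b \<notin> ?S" using S'(1) by blast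
    obtain N P where P: "N \<ge> 0" "sg N 1 * h b = j P" by (rule clear_denominators)
    obtain F k where F: "finite F" "j P = (\<Sum>d\<in>F. sc (k d) * mon3 x xz xt d)"
      by (rule ring_polynomials_spanned)
    let ?T = "{b1, b2, b3, b}"
    define E where "E d = (\<lambda>s\<in>?T. if s = b1 then fst d else if s = b2 then fst (snd d) else if s = b3 then snd (snd d) else 0)"
      for d :: "nat \<times> nat \<times> nat"
    \<comment> \<open>The exponent vector of x^N b; its exponent 1 at b separates it from every
      \<open>E d\<close>.\<close>
    define eb where "eb = (\<lambda>s\<in>?T. if s = b1 then nat N else if s = b then 1 else 0)"
    define c where "c e = (if e = eb then \<alpha> (- 1) else \<alpha> (k (e b1, e b2, e b3)))" for e
    have Eb: "E d b = 0" "E d b1 = fst d" "E d b2 = fst (snd d)" "E d b3 = snd (snd d)" for d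
      using b dist by (auto simp: E_def)
    have ebb: "eb b = 1" "eb b1 = nat N" "eb b2 = 0" "eb b3 = 0" using b dist by (auto simp: eb_def)
    have prod: "(\<Prod>s\<in>?T. h s ^ e s) = x ^ e b1 * (xz ^ e b2 * (xt ^ e b3 * h b ^ e b))" for e
      using b(2) dist by (simp add: h eq_commute[of _ b])
    have ne: "E d \<noteq> eb" for d using Eb(1)[of d] ebb(1) by auto
    have cE: "c (E d) = \<alpha> (k d)" for d using ne by (simp add: c_def Eb)
    have inj: "inj_on E F" by (rule inj_onI) (metis Eb(2-4) prod_eqI)
    have "eb \<notin> E ` F" using ne by auto
    then have "(\<Sum>e\<in>insert eb (E ` F). h (c e) * (\<Prod>s\<in>?T. h s ^ e s)) =
      h (c eb) * (\<Prod>s\<in>?T. h s ^ eb s) + (\<Sum>d\<in>F. h (c (E d)) * (\<Prod>s\<in>?T. h s ^ E d s))"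
      using F(1) by (simp add: sum.reindex[OF inj])
    also have "h (c eb) * (\<Prod>s\<in>?T. h s ^ eb s) = - (x ^ nat N * h b)"
      using \<alpha>[of "- 1"] by (simp only: prod ebb) (simp add: c_def sc_uminus)
    also have "(\<Sum>d\<in>F. h (c (E d)) * (\<Prod>s\<in>?T. h s ^ E d s)) = (\<Sum>d\<in>F. sc (k d) * mon3 x xz xt d)"
      by (intro sum.cong refl) (simp only: prod cE Eb, simp add: \<alpha> mon3_def mult.assoc)
    also have "\<dots> = x ^ nat N * h b" using P F(2) by (simp add: x_def sg_power)
    finally have 0: "(\<Sum>e\<in>insert eb (E ` F). h (c e) * (\<Prod>s\<in>?T. h s ^ e s)) = 0" by simp
    have "?T \<subseteq> S'" using b S'(1) by auto
    moreover have "E d \<in> ?T \<rightarrow>\<^sub>E UNIV" "eb \<in> ?T \<rightarrow>\<^sub>E UNIV" for d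
      unfolding E_def eb_def by (simp_all only: restrict_PiE_iff UNIV_I ball_simps)
    then have "insert eb (E ` F) \<subseteq> ?T \<rightarrow>\<^sub>E UNIV" by auto
    moreover have "c \<in> insert eb (E ` F) \<rightarrow> range \<alpha>" by (auto simp: c_def)
    moreover have "finite ?T" "finite (insert eb (E ` F))" using F(1) by simp_all
    ultimately have "finite ?T \<and> ?T \<subseteq> S' \<and> finite (insert eb (E ` F)) \<and> insert eb (E ` F) \<subseteq> ?T \<rightarrow>\<^sub>E UNIV \<and>
      c \<in> insert eb (E ` F) \<rightarrow> range \<alpha> \<and> (\<Sum>e\<in>insert eb (E ` F). h (c e) * (\<Prod>s\<in>?T. h s ^ e s)) = 0"
      using 0 by (intro conjI)
    then have "h (c eb) = 0"
      by (rule S'(3)[unfolded R.algebraically_independent_iff[OF S'(2) K], rule_format]) simp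
    then show False using \<alpha>[of "- 1"] by (simp add: c_def)
  qed
  show ?thesis
    unfolding has_transcendence_degree_def transcendence_basis_def
    using bR dist indep maximal by (intro exI[of _ ?S]) auto
qed

section \<open>Gradings carried over to A\<close>

lemma graded_asanumaI:
  fixes B :: "int \<Rightarrow> 'a laurent set"
  defines "dec \<equiv> \<lambda>a v. (\<forall>i. v i \<in> B i) \<and> finite {i. v i \<noteq> 0} \<and> a = (\<Sum>i | v i \<noteq> 0. v i)"
  assumes B: "\<And>i a. a \<in> B i \<Longrightarrow> a \<in> A" "\<And>i. 0 \<in> B i" "\<And>i a b. a \<in> B i \<Longrightarrow> b \<in> B i \<Longrightarrow> a + b \<in> B i"
    and mult: "\<And>i j a b. a \<in> B i \<Longrightarrow> b \<in> B j \<Longrightarrow> a * b \<in> B (i + j)"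
    and neg: "\<And>i. i < 0 \<Longrightarrow> B i = {0}" and const: "B 0 = range sc"
    and ex1: "\<And>a. a \<in> A \<Longrightarrow> \<exists>!v. dec a v"
  shows "graded_asanuma f \<psi> q m B (\<lambda>i a. (THE v. dec a v) i)"
proof -
  define c where "c i a = (THE v. dec a v) i" for i a
  have cdec: "dec a (\<lambda>i. c i a)" if "a \<in> A" for a
    unfolding c_def using theI'[OF ex1[OF that]] by simp
  have uniq: "c i a = v i" if "dec a v" "a \<in> A" for a v i
    using ex1[OF that(2)] cdec[OF that(2)] that(1) by metis
  have sumI: "(\<Sum>i | v i \<noteq> 0. v i) = sum v I" if "finite I" "{i. v i \<noteq> 0} \<subseteq> I"
    for v :: "int \<Rightarrow> 'a laurent" and I using that by (intro sum.mono_neutral_left) auto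
  have add: "c i (a + b) = c i a + c i b" if ab: "a \<in> A" "b \<in> A" for a b i
  proof (rule uniq)
    let ?I = "{i. c i a \<noteq> 0} \<union> {i. c i b \<noteq> 0}"
    have d: "dec a (\<lambda>i. c i a)" "dec b (\<lambda>i. c i b)" by (intro cdec ab)+
    then have I: "finite ?I" by (simp add: dec_def)
    have sub: "{i. c i a + c i b \<noteq> 0} \<subseteq> ?I" by auto
    have "a = sum (\<lambda>i. c i a) ?I" "b = sum (\<lambda>i. c i b) ?I"
      using d sumI[OF I, of "\<lambda>i. c i a"] sumI[OF I, of "\<lambda>i. c i b"] by (auto simp: dec_def)
    then have "a + b = (\<Sum>i\<in>?I. c i a + c i b)" by (simp only: sum.distrib)
    also have "\<dots> = (\<Sum>i | c i a + c i b \<noteq> 0. c i a + c i b)" using sumI[OF I sub] by simp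
    finally show "dec (a + b) (\<lambda>i. c i a + c i b)"
      using d finite_subset[OF sub I] B(3) by (simp add: dec_def)
    show "a + b \<in> A" by (rule A_add[OF ab])
  qed
  have hom: "c i a = (if i = j then a else 0)" if a: "a \<in> B j" for a i j
  proof (rule uniq)
    have "{i. (if i = j then a else 0) \<noteq> 0} \<subseteq> {j}" by auto
    from sumI[OF _ this] show "dec a (\<lambda>i. if i = j then a else 0)"
      using a B(2) by (auto simp: dec_def)
    show "a \<in> A" by (rule B(1)[OF a])
  qed
  have "graded_asanuma f \<psi> q m B c"
    by unfold_locales (use B mult neg const cdec add hom in \<open>simp_all add: dec_def\<close>)
  then show ?thesis unfolding c_def by (simp add: fun_eq_iff)
qed

theorem variable_if_positive_grading_over:
  assumes R: "ring_embedding R h A" and \<alpha>: "\<And>c. \<alpha> c \<in> carrier R \<and> h (\<alpha> c) = sc c"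
    and char: "CHAR('a) > 0" and grading: "positive_grading_over R (range \<alpha>) B"
  shows "\<exists>g. subalgebra2 f g = UNIV"
proof -
  interpret R: ring_embedding R h A by fact
  note g = grading[unfolded positive_grading_over_def int_grading_over_def int_grading_def]
  note g1 = g[THEN conjunct1, THEN conjunct1] and neg = g[THEN conjunct2, THEN conjunct1, rule_format]
    and const = g[THEN conjunct2, THEN conjunct2]
  note sub = g1[THEN conjunct1, rule_format] and dec = g1[THEN conjunct2, THEN conjunct1, rule_format]
    and mult = g1[THEN conjunct2, THEN conjunct2, rule_format]
  have BR: "b \<in> carrier R" if "b \<in> B i" for b i using additive_subgroup.a_Hcarr[OF sub that] .
  let ?B = "\<lambda>i. h ` B i"
  let ?dec = "\<lambda>a v. (\<forall>i. v i \<in> ?B i) \<and> finite {i. v i \<noteq> 0} \<and> a = (\<Sum>i | v i \<noteq> 0. v i)"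
  let ?decR = "\<lambda>a u. (\<forall>i. u i \<in> B i) \<and> finite {i. u i \<noteq> \<zero>\<^bsub>R\<^esub>} \<and>
    a = (\<Oplus>\<^bsub>R\<^esub>i\<in>{i. u i \<noteq> \<zero>\<^bsub>R\<^esub>}. u i)"
  have decR: "?dec (h b) (\<lambda>i. h (u i)) \<longleftrightarrow> ?decR b u" if u: "\<And>i. u i \<in> B i" and b: "b \<in> carrier R" for b u
  proof -
    have z: "h (u i) = 0 \<longleftrightarrow> u i = \<zero>\<^bsub>R\<^esub>" for i using BR[OF u] by simp
    have "(\<Sum>i | u i \<noteq> \<zero>\<^bsub>R\<^esub>. h (u i)) = h (\<Oplus>\<^bsub>R\<^esub>i\<in>{i. u i \<noteq> \<zero>\<^bsub>R\<^esub>}. u i)"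
      by (rule R.h_finsum[symmetric]) (use BR[OF u] in auto)
    moreover have "(\<Oplus>\<^bsub>R\<^esub>i\<in>{i. u i \<noteq> \<zero>\<^bsub>R\<^esub>}. u i) \<in> carrier R"
      by (rule R.finsum_closed) (use BR[OF u] in auto)
    ultimately show ?thesis using u b by (simp add: z R.h_inj)
  qed
  interpret graded_asanuma f \<psi> q m ?B "\<lambda>i a. (THE v. ?dec a v) i"
  proof (rule graded_asanumaI)
    show "a \<in> A" if "a \<in> ?B i" for a i using that BR by auto
    show "0 \<in> ?B i" for i
      using imageI[OF additive_subgroup.zero_closed[OF sub[of i]], of h] by simp
    show "a + b \<in> ?B i" if ab: "a \<in> ?B i" "b \<in> ?B i" for a b i
    proof -
      obtain a' b' where ab': "a' \<in> B i" "a = h a'" "b' \<in> B i" "b = h b'" using ab by blast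
      have "h (a' \<oplus>\<^bsub>R\<^esub> b') = a + b" using R.h_add[OF BR[OF ab'(1)] BR[OF ab'(3)]] ab' by simp
      then show ?thesis using imageI[OF additive_subgroup.a_closed[OF sub ab'(1,3)], of h] by simp
    qed
    show "a * b \<in> ?B (i + j)" if ab: "a \<in> ?B i" "b \<in> ?B j" for a b i j
    proof -
      obtain a' b' where ab': "a' \<in> B i" "a = h a'" "b' \<in> B j" "b = h b'" using ab by blast
      have "h (a' \<otimes>\<^bsub>R\<^esub> b') = a * b" using R.h_mult[OF BR[OF ab'(1)] BR[OF ab'(3)]] ab' by simp
      then show ?thesis using imageI[OF mult[OF ab'(1,3)], of h] by simp
    qed
    show "?B i = {0}" if "i < 0" for i using neg[OF that] by simp
    show "?B 0 = range sc" unfolding const image_image using \<alpha> by simp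
    fix a assume "a \<in> A"
    then obtain b where b: "b \<in> carrier R" "a = h b" using R.h_surj by blast
    have ex: "\<exists>!u. ?decR b u" by (rule dec[OF b(1)])
    obtain u where u: "?decR b u" using ex1_implies_ex[OF ex] by (rule exE)
    show "\<exists>!v. ?dec a v"
    proof (rule ex1I)
      show "?dec a (\<lambda>i. h (u i))" unfolding b(2) by (rule iffD2[OF decR]) (use u b(1) in auto)
      fix v assume v: "?dec a v"
      then have "\<forall>i. \<exists>w. w \<in> B i \<and> v i = h w" by blast
      from choice[OF this] obtain w where "\<forall>i. w i \<in> B i \<and> v i = h (w i)" by (rule exE)
      then have w: "\<And>i. w i \<in> B i" "v = (\<lambda>i. h (w i))" by auto
      have "?decR b w" by (rule iffD1[OF decR]) (use v w b in auto)
      with ex u have "w = u" unfolding Ex1_def by metis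
      then show "v = (\<lambda>i. h (u i))" using w(2) by simp
    qed
  qed
  show ?thesis by (rule variable_if_positively_graded[OF char])
qed

end

theorem corollary6p5:
  fixes f :: "'a::field poly poly" and p m :: nat
  assumes "CHAR('a) = p" and "p > 0"
    and "k_isomorphic (principal_quot f) (\<lambda>c. residue_class f [:[:c:]:])
           (ring_of_type_algebra :: 'a poly ring) (\<lambda>c. [:c:])"
    and "\<not> (\<exists>g. subalgebra2 f g = UNIV)"
    and "m \<ge> 2"
  shows "factorial_domain (asanuma_ring m f)
    \<and> has_transcendence_degree (asanuma_ring m f) (range (asanuma_const m f)) 3
    \<and> \<not> in_UG 3 (asanuma_ring m f) (asanuma_const m f)
    \<and> \<not> (\<exists>B. positive_grading_over (asanuma_ring m f) (range (asanuma_const m f)) B)"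
proof -
  obtain \<psi> q where "line f \<psi> q" using line_exists[OF assms(3)] by blast
  then interpret asanuma f \<psi> q m by (intro asanuma.intro asanuma_axioms.intro assms(5))
  let ?R = "asanuma_ring m f"
  obtain H where H: "H \<in> ring_iso ?R (ring_on A)" "\<And>P. H (residue_class (asanuma_polynomial m f) P) = pres P"
    using principal_quot_iso[OF rhom_pres range_pres pres_eq_0_iff] unfolding asanuma_ring_def by blast
  have R: "ring_embedding ?R H A"
    by (intro ring_embedding.intro ring_embedding_axioms.intro H(1))
       (simp add: asanuma_ring_def cring_principal_quot)
  have \<alpha>: "asanuma_const m f c \<in> carrier ?R \<and> H (asanuma_const m f c) = sc c" for c
    using H(2) pres_const[of "cst c"]
    by (simp add: asanuma_const_def asanuma_ring_def carrier_principal_quot sc_def cst_def)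
  have "factorial_domain ?R" by (rule ring_embedding.factorial_domainI[OF R]) (rule A_prime_factorization)
  moreover have "has_transcendence_degree ?R (range (asanuma_const m f)) 3"
    by (rule transcendence_degree_3[OF R \<alpha>])
  moreover have "\<not> positive_grading_over ?R (range (asanuma_const m f)) B" for B
    using variable_if_positive_grading_over[OF R \<alpha>] assms(1,2,4) by blast
  ultimately show ?thesis by (simp add: in_UG_def)
qed

end
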